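(* Assume the following for every $i\in\mathcal N$. (1) $r_i$ is convex and lower semicontinuous with effective domain $\mathcal X_i$, a closed compact set; for every fixed $x_{-i}\in\prod_{j\ne i}\mathcal X_j$ the map $x_i\mapsto f_i(x_i,h_i(x_i)+\sigma(x_{-i}))$ is convex on $\mathcal X_i$; and $f_i$ is continuously differentiable in $(x_i,\sigma)$ on an open set containing $\mathcal X_i\times\mathbb R^m$. (2) $\phi$ is Lipschitz continuous with constant $L$ and monotone on $\mathcal X=\prod_{i=1}^N\mathcal X_i$, i.e. $\|\phi(x)-\phi(x')\|\le L\|x-x'\|$ and $(\phi(x)-\phi(x'))^T(x-x')\ge 0$ for all $x,x'\in\mathcal X$. (3) $h_i$ is $L_{hi}$-Lipschitz on $\mathcal X_i$; and for every $c_z>0$ there is a constant $L_{fi}$ (possibly depending on $c_z$) such that $\|F_i(x_i,z_1)-F_i(x_i,z_2)\|\le L_{fi}\|z_1-z_2\|$ for all $x_i\in\mathcal X_i$ and all $z_1,z_2\in\mathbb R^m$ with $\|z_1\|,\|z_2\|\le c_z$. (4) $\psi_i(\cdot,\cdot;\xi_i)$ is differentiable on $\mathcal C_i\times\mathbb R^m$ for every fixed $\xi_i\in\mathbb R^{d_i}$, where $\mathcal C_i$ is an open set containing $\mathcal X_i$; and for all $x_i\in\mathcal X_i$, $z_i\in\mathbb R^m$, $\mathbb E[q_i(x_i,z_i;\xi_i)\mid x_i]=F_i(x_i,z_i)$ and $\mathbb E[\|q_i(x_i,z_i;\xi_i)-F_i(x_i,z_i)\|^2\mid x_i]\le\upsilon_i^2$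 for some $\upsilon_i>0$. (5) $W_k$ is doubly stochastic for all $k\ge0$; there is $\varsigma\in(0,1)$ with $\omega_{ij,k}\ge\varsigma$ for all $k\ge 0$, $i\in\mathcal N$, $j\in\mathcal N_{i,k}$; and there is a positive integer $P$ such that the graph $(\mathcal N,\bigcup_{l=1}^P\mathcal E_{k+l})$ is strongly connected for every $k\ge0$. (6) The positive sequences $\{\alpha_{i,k}\}_k$ and $\{\eta_{i,k}\}_k$ are deterministic and monotonically decreasing to zero, and with $\alpha_{\max,k}=\max_i\alpha_{i,k}$, $\alpha_{\min,k}=\min_i\alpha_{i,k}$, $\eta_{\max,k}=\max_i\eta_{i,k}$, $\eta_{\min,k}=\min_i\eta_{i,k}$: $\lim_{k}\frac{\alpha_{\max,k}^2}{\alpha_{\min,k}\eta_{\min,k}}=0$, $\lim_k\frac{\alpha_{\max,k}-\alpha_{\min,k}}{\alpha_{\min,k}\eta_{\min,k}}=0$, $\sum_{k}\alpha_{\min,k}\eta_{\min,k}=\infty$, $\sum_k\alpha_{i,k}^2<\infty$ for each $i$, and $\sum_{k\ge1}\Big(1+\frac{1}{\alpha_{\min,k}\eta_{\min,k}}\Big)\frac{(\eta_{\max,k-1}-\eta_{\min,k})^2}{\eta_{\min,k}^2}<\infty$. Let $x_k=(x_{1,k},\dots,x_{N,k})$ be generated by the algorithm described in the context. Then, almost surely: (i) if $\limsup_{k\to\infty}\eta_{\max,k}/\eta_{\min,k}<\infty$, every limit point of $\{x_k\}$ is a Nash equilibrium; (ii) if $\limsup_{k\to\infty}\eta_{\max,k}/\eta_{\min,k}=1$,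 then $\{x_k\}$ converges to the least-norm Nash equilibrium, i.e. $\lim_{k\to\infty}x_k=x^*$ with $x^*=\operatorname{argmin}_{x\in\mathcal X^*}\|x\|$, where $\mathcal X^*$ is the set of Nash equilibria.
   Context: Game. There are $N$ players, $\mathcal N=\{1,\dots,N\}$; player $i$ controls $x_i\in\mathbb R^{m_i}$, $m=\sum_i m_i$, $x=(x_1,\dots,x_N)$, and $x_{-i}=(x_j)_{j\ne i}$. The functions $h_j:\mathbb R^{m_j}\to\mathbb R^m$ are continuously differentiable, $\sigma(x)=\sum_{j=1}^N h_j(x_j)$ and $\sigma(x_{-i})=\sum_{j\ne i}h_j(x_j)$. Given $x_{-i}$, player $i$ minimizes over $x_i$ the cost $f_i(x_i,h_i(x_i)+\sigma(x_{-i}))+r_i(x_i)$, where $f_i(x_i,s)=\mathbb E[\psi_i(x_i,s;\xi_i)]$, $\xi_i$ is an $\mathbb R^{d_i}$-valued random variable, $\psi_i:\mathbb R^{m_i}\times\mathbb R^m\times\mathbb R^{d_i}\to\mathbb R$, and $r_i:\mathbb R^{m_i}\to\mathbb R\cup\{+\infty\}$. A Nash equilibrium is a tuple $x^*=(x_1^*,\dots,x_N^* )$ such that for each $i$, $x_i^*$ minimizes player $i$'s cost given $x_{-i}^*$. Maps. $F_i(x_i,z_i)=\big(\nabla_{x_i}f_i(x_i,\sigma)+\nabla h_i(x_i)\nabla_\sigma f_i(x_i,\sigma)\big)\big|_{\sigma=z_i}$ (here $\nabla h_i$ is the transposed Jacobian), $\phi_i(x)=F_i(x_i,\sigma(x))$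 (the gradient in $x_i$ of $f_i(x_i,\sigma(x))$), $\phi=(\phi_1,\dots,\phi_N)$, and $q_i(x_i,z_i;\xi_i)=\big(\nabla_{x_i}\psi_i(x_i,\sigma;\xi_i)+\nabla h_i(x_i)\nabla_\sigma\psi_i(x_i,\sigma;\xi_i)\big)\big|_{\sigma=z_i}$. $\|\cdot\|$ is the Euclidean norm. $\mathrm{prox}_{\alpha r}(x)=\operatorname{argmin}_y\big(r(y)+\frac1{2\alpha}\|y-x\|^2\big)$. Network. At time $k$, players communicate over a digraph $\mathcal G_k=(\mathcal N,\mathcal E_k)$, $(j,i)\in\mathcal E_k$ meaning $i$ receives information from $j$; $\mathcal N_{i,k}=\{j:(j,i)\in\mathcal E_k\}$, and $i\in\mathcal N_{i,k}$. $W_k=[\omega_{ij,k}]$ is the nonnegative matrix with $\omega_{ij,k}>0$ iff $(j,i)\in\mathcal E_k$, and $\omega_{ij,k}=0$ otherwise. Algorithm. Start with $x_{i,0}\in\mathcal X_i$, $v_{i,0}=h_i(x_{i,0})$. For $k=0,1,2,\dots$ and each $i$: $\hat v_{i,k}=\sum_{j\in\mathcal N_{i,k}}\omega_{ij,k}v_{j,k}$; $x_{i,k+1}=\mathrm{prox}_{\alpha_{i,k}r_i}\big(x_{i,k}-\alpha_{i,k}(q_i(x_{i,k},N\hat v_{i,k};\xi_{i,k})+\eta_{i,k}x_{i,k})\big)$; $v_{i,k+1}=\hat v_{i,k}+h_i(x_{i,k+1})-h_i(x_{i,k})$. Here $\xi_{i,k}$ is a fresh realization of $\xi_i$ at time $k$;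 with $\zeta_{i,k}=q_i(x_{i,k},N\hat v_{i,k};\xi_{i,k})-F_i(x_{i,k},N\hat v_{i,k})$ and $\mathcal F_k$ the $\sigma$-algebra generated by $x_0$ and $\zeta_{i,l}$, $i\in\mathcal N$, $0\le l\le k-1$, the sampling is such that $\mathbb E[\zeta_{i,k}\mid\mathcal F_k]=0$ and $\mathbb E[\|\zeta_{i,k}\|^2\mid\mathcal F_k]\le\upsilon_i^2$ a.s. *)

theory Defs
  imports "HOL-Probability.Probability"
begin

text \<open>
  Vectors with blocks. A finite type of coordinates is partitioned by a map \<open>own\<close> that sends a
  coordinate to the player it belongs to, so that the number \<open>m_i\<close> of coordinates of player \<open>i\<close> is
  the cardinality of \<open>{c. own c = i}\<close>, and \<open>m = CARD('c)\<close> is the sum of the \<open>m_i\<close>. The factor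
  \<open>R^{m_i}\<close> of \<open>R^m\<close> is the coordinate subspace \<open>block_space own i\<close>, and \<open>x_i\<close> is \<open>block own i x\<close>.

  A function \<open>g\<close> on \<open>R^{m_i}\<close> is only ever evaluated on \<open>block_space own i\<close>. Where it is
  differentiated, it is first extended to \<open>R^m\<close> as \<open>\<lambda>y. g (block own i y)\<close>; the derivative of the
  extension at a point of the subspace exists iff that of \<open>g\<close> does and vanishes in the foreign
  coordinates, so that gradients in \<open>x_i\<close> lie in \<open>block_space own i\<close>.
\<close>

definition block :: "('c \<Rightarrow> 'p) \<Rightarrow> 'p \<Rightarrow> real^'c \<Rightarrow> real^'c::finite" where
  "block own i x = (\<chi> c. if own c = i then x $ c else 0)"

definition block_space :: "('c \<Rightarrow> 'p) \<Rightarrow> 'p \<Rightarrow> (real^'c::finite) set" where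
  "block_space own i = {x. \<forall>c. own c \<noteq> i \<longrightarrow> x $ c = 0}"

definition grad :: "('a::real_inner \<Rightarrow> real) \<Rightarrow> 'a \<Rightarrow> 'a" where
  "grad f x = (THE g. GDERIV f x :> g)"

definition continuously_differentiable_on ::
    "'a set \<Rightarrow> ('a::real_normed_vector \<Rightarrow> 'b::real_normed_vector) \<Rightarrow> bool" where
  "continuously_differentiable_on S f \<longleftrightarrow>
     (\<exists>f' :: 'a \<Rightarrow> 'a \<Rightarrow>\<^sub>L 'b. (\<forall>x\<in>S. (f has_derivative blinfun_apply (f' x)) (at x)) \<and>
        continuous_on S f')"

text \<open>Extended-real-valued functions on a set, used with values different from \<open>-\<infinity>\<close> only.\<close>

definition ereal_convex_on :: "'a::real_vector set \<Rightarrow> ('a \<Rightarrow> ereal) \<Rightarrow> bool" where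
  "ereal_convex_on S r \<longleftrightarrow> convex S \<and>
     (\<forall>x\<in>S. \<forall>y\<in>S. \<forall>t. 0 < t \<longrightarrow> t < 1 \<longrightarrow>
        r ((1 - t) *\<^sub>R x + t *\<^sub>R y) \<le> ereal (1 - t) * r x + ereal t * r y)"

definition lower_semicontinuous_on :: "'a::topological_space set \<Rightarrow> ('a \<Rightarrow> ereal) \<Rightarrow> bool" where
  "lower_semicontinuous_on S r \<longleftrightarrow> (\<forall>x\<in>S. r x \<le> Liminf (at x within S) r)"

definition prox :: "'a::real_normed_vector set \<Rightarrow> real \<Rightarrow> ('a \<Rightarrow> ereal) \<Rightarrow> 'a \<Rightarrow> 'a" where
  "prox V \<alpha> r x = arg_min (\<lambda>y. r y + ereal (1 / (2 * \<alpha>) * (norm (y - x))\<^sup>2)) (\<lambda>y. y \<in> V)"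

definition eff_dom :: "('c \<Rightarrow> 'p) \<Rightarrow> ('p \<Rightarrow> real^'c::finite \<Rightarrow> ereal) \<Rightarrow> 'p \<Rightarrow> (real^'c) set" where
  "eff_dom own r i = {x \<in> block_space own i. r i x < \<infinity>}"

definition joint_dom :: "('c \<Rightarrow> 'p) \<Rightarrow> ('p \<Rightarrow> real^'c::finite \<Rightarrow> ereal) \<Rightarrow> (real^'c) set" where
  "joint_dom own r = {x. \<forall>i. block own i x \<in> eff_dom own r i}"

definition aggregate ::
    "('c \<Rightarrow> 'p::finite) \<Rightarrow> ('p \<Rightarrow> real^'c \<Rightarrow> real^'c) \<Rightarrow> real^'c \<Rightarrow> real^'c::finite" where
  "aggregate own h x = (\<Sum>j\<in>UNIV. h j (block own j x))"

definition others_aggregate ::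
    "('c \<Rightarrow> 'p::finite) \<Rightarrow> ('p \<Rightarrow> real^'c \<Rightarrow> real^'c) \<Rightarrow> 'p \<Rightarrow> real^'c \<Rightarrow> real^'c::finite" where
  "others_aggregate own h i x = (\<Sum>j\<in>UNIV - {i}. h j (block own j x))"

definition nash_equilibria ::
    "('c \<Rightarrow> 'p::finite) \<Rightarrow> ('p \<Rightarrow> real^'c::finite \<Rightarrow> real^'c) \<Rightarrow>
     ('p \<Rightarrow> real^'c \<Rightarrow> real^'c \<Rightarrow> real) \<Rightarrow> ('p \<Rightarrow> real^'c \<Rightarrow> ereal) \<Rightarrow> (real^'c) set" where
  "nash_equilibria own h f r =
     {x. \<forall>i. is_arg_min
               (\<lambda>y. ereal (f i y (h i y + others_aggregate own h i x)) + r i y)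
               (\<lambda>y. y \<in> block_space own i) (block own i x)}"

text \<open>
  For \<open>g\<close> on \<open>R^{m_i} \<times> R^m\<close>, the vector
  \<open>\<nabla>_x g(x,\<sigma>) + \<nabla>h_i(x) \<nabla>_\<sigma> g(x,\<sigma>)\<close> at \<open>\<sigma> = z\<close>, with \<open>\<nabla>h_i\<close> the transposed Jacobian.
  This is \<open>F_i\<close> for \<open>g = f_i\<close> and \<open>q_i(\<cdot>,\<cdot>;\<xi>)\<close> for \<open>g = \<psi>_i(\<cdot>,\<cdot>;\<xi>)\<close>.
\<close>

definition marginal_grad ::
    "('c \<Rightarrow> 'p) \<Rightarrow> ('p \<Rightarrow> real^'c \<Rightarrow> real^'c) \<Rightarrow> 'p \<Rightarrow>
     (real^'c \<Rightarrow> real^'c \<Rightarrow> real) \<Rightarrow> real^'c \<Rightarrow> real^'c \<Rightarrow> real^'c::finite" where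
  "marginal_grad own h i g x z =
     grad (\<lambda>y. g (block own i y) z) x +
     transpose (jacobian (\<lambda>y. h i (block own i y)) (at x)) *v grad (\<lambda>s. g x s) z"

definition pseudo_grad ::
    "('c \<Rightarrow> 'p::finite) \<Rightarrow> ('p \<Rightarrow> real^'c \<Rightarrow> real^'c) \<Rightarrow>
     ('p \<Rightarrow> real^'c \<Rightarrow> real^'c \<Rightarrow> real) \<Rightarrow> real^'c \<Rightarrow> real^'c::finite" where
  "pseudo_grad own h f x =
     (\<chi> c. marginal_grad own h (own c) (f (own c)) (block own (own c) x) (aggregate own h x) $ c)"

definition doubly_stochastic :: "real^'p^'p::finite \<Rightarrow> bool" where
  "doubly_stochastic W \<longleftrightarrow> (\<forall>i j. 0 \<le> W $ i $ j) \<and>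
     (\<forall>i. (\<Sum>j\<in>UNIV. W $ i $ j) = 1) \<and> (\<forall>j. (\<Sum>i\<in>UNIV. W $ i $ j) = 1)"

definition strongly_connected :: "('p \<times> 'p) set \<Rightarrow> bool" where
  "strongly_connected E \<longleftrightarrow> (\<forall>i j. (i, j) \<in> E\<^sup>*)"

definition pmax :: "(nat \<Rightarrow> 'p::finite \<Rightarrow> real) \<Rightarrow> nat \<Rightarrow> real" where
  "pmax a k = Max (range (a k))"

definition pmin :: "(nat \<Rightarrow> 'p::finite \<Rightarrow> real) \<Rightarrow> nat \<Rightarrow> real" where
  "pmin a k = Min (range (a k))"

definition noise_history ::
    "'w measure \<Rightarrow> ('w \<Rightarrow> 'a::topological_space) \<Rightarrow>
     (nat \<Rightarrow> 'p \<Rightarrow> 'w \<Rightarrow> 'b::topological_space) \<Rightarrow> nat \<Rightarrow> 'w measure" where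
  "noise_history M x0 \<zeta> k = sigma (space M)
     ({x0 -` A \<inter> space M |A. A \<in> sets borel} \<union>
      {\<zeta> l i -` A \<inter> space M |l i A. l < k \<and> A \<in> sets borel})"

text \<open>The library's conditional expectation is real-valued; vectors are treated componentwise.\<close>

definition vec_cond_exp ::
    "'w measure \<Rightarrow> 'w measure \<Rightarrow> ('w \<Rightarrow> real^'c) \<Rightarrow> 'w \<Rightarrow> real^'c::finite" where
  "vec_cond_exp M G Z \<omega> = (\<chi> c. real_cond_exp M G (\<lambda>\<omega>'. Z \<omega>' $ c) \<omega>)"

end

theory Submission
  imports Defs
begin

text \<open>Nash equilibria are the solutions of the variational inequality for \<open>\<phi>\<close> and the subdifferential of
  \<open>\<Sum>i. r i\<close>. Let \<open>y k\<close> be the solution of the regularized inequality, in which \<open>\<phi> y\<close> is replaced by the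
  strongly monotone \<open>\<phi> y + (\<eta> k i y\<^sub>i)\<^sub>i\<close>. Limits of \<open>y k\<close> solve the original inequality, and if the
  ratios of the \<open>\<eta> k i\<close> tend to \<open>1\<close> they satisfy \<open>y \<bullet> (z - y) \<ge> 0\<close> for every equilibrium \<open>z\<close>, which
  singles out the equilibrium of least norm. So it suffices that \<open>x k - y k\<close> tends to \<open>0\<close>.

  The squared distance \<open>u k\<close> of \<open>x (k + 1)\<close> from \<open>y k\<close> satisfies \<open>u (k + 1) \<le> (1 - a k) u k + m k\<close> with
  divergent \<open>\<Sum>k. a k\<close>. All that \<open>m\<close> has to be is summable, conditionally, for \<open>u\<close> to tend to \<open>0\<close>.
  Hence probability enters only through two almost sure statements, the summability of \<open>\<alpha>\<^sup>2 \<parallel>\<zeta>\<parallel>\<^sup>2\<close>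
  and the convergence of the martingale \<open>\<Sum>k. \<alpha> k i ((x k - y k)\<^sub>i \<bullet> \<zeta> k i)\<close>; everything else is done
  along a fixed path.

  The step of a proximal iteration need not be of order \<open>\<alpha>\<close>, since the subgradients of \<open>r i\<close> can be
  unbounded on its domain. Instead, the descent of \<open>r i\<close> in the proximal step and Abel summation with the
  decreasing \<open>\<alpha> k i\<close> bound the sum of the squared steps. This makes the consensus errors square
  summable, so their products with \<open>\<alpha> k i\<close> are summable.\<close>

section \<open>Recursions for real sequences\<close>

text \<open>Player-dependent step sizes break monotonicity: \<open>phi_monotone\<close> controls
  only the unweighted sum of the players' inner products, while the recursion weights them by
  \<open>\<alpha> k i\<close>. The excess is of order \<open>(pmax \<alpha> k - pmin \<alpha> k) *
  (norm (x k - y k))\<^sup>2\<close>, and \<open>rate2\<close> lets the contraction absorb it. A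
  circularity has to be broken: \<open>F\<close> is Lipschitz in the aggregate only on bounded sets,
  so the estimates must be bounded before any constant is available. Compact domains and geometric
  mixing give a crude bound; the square summability of the consensus errors comes afterwards. The
  reference point \<open>y k\<close> depends on \<open>\<eta> k\<close> alone and is deterministic.
  Hence \<open>x k - y k\<close> is known before the noise at time \<open>k\<close>, and its
  products with that noise, scaled by the step size, are martingale differences with second moments
  of order \<open>(\<alpha> k i)\<^sup>2\<close>. The distance is taken with a lag, from
  \<open>x (k + 1)\<close> to \<open>y k\<close>, so that the drift \<open>y (k + 1) - y k\<close>
  is weighed against the contraction rate at \<open>k + 1\<close>, as in
  \<open>rate5\<close>.\<close>

lemma contraction_with_summable_error_tendsto_0:
  fixes u a m :: "nat \<Rightarrow> real"
  assumes u: "\<And>k. u k \<ge> 0" and a: "\<And>k. 0 \<le> a k"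
    and a1: "\<forall>\<^sub>F k in sequentially. a k \<le> 1"
    and div: "filterlim (\<lambda>n. \<Sum>k<n. a k) at_top sequentially"
    and m: "summable m"
    and step: "\<forall>\<^sub>F k in sequentially. u (Suc k) \<le> (1 - a k) * u k + m k"
  shows "u \<longlonglongrightarrow> 0"
proof -
  \<comment> \<open>The tail sums take up the errors by telescoping. Only their smallness matters,
    so \<open>m\<close> may change sign.\<close>
  define s where "s k = (\<Sum>l. m (l + k))" for k
  have s0: "s \<longlonglongrightarrow> 0"
    using suminf_exist_split2[OF m] by (simp add: s_def[abs_def])
  have s_step: "s k = m k + s (Suc k)" for k
    using suminf_split_head[OF summable_ignore_initial_segment[OF m, of k]]
    by (simp add: s_def)
  show ?thesis
  proof (rule tendstoI, goal_cases)
    case (1 e)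
    define \<epsilon> where "\<epsilon> = e / 4"
    have \<epsilon>: "\<epsilon> > 0" using 1 by (simp add: \<epsilon>_def)
    have "\<forall>\<^sub>F k in sequentially. \<bar>s k\<bar> < \<epsilon>"
      using tendstoD[OF s0 \<epsilon>] by simp
    with a1 step have "\<forall>\<^sub>F k in sequentially. \<bar>s k\<bar> < \<epsilon> \<and> a k \<le> 1 \<and> u (Suc k) \<le> (1 - a k) * u k + m k"
      by eventually_elim auto
    then obtain K where K: "\<And>k. k \<ge> K \<Longrightarrow> \<bar>s k\<bar> < \<epsilon>" "\<And>k. k \<ge> K \<Longrightarrow> a k \<le> 1"
      "\<And>k. k \<ge> K \<Longrightarrow> u (Suc k) \<le> (1 - a k) * u k + m k"
      by (auto simp: eventually_sequentially)
    \<comment> \<open>Once \<open>s k < \<epsilon>\<close>, subtracting \<open>\<epsilon>\<close>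
      makes \<open>a k * (s k - \<epsilon>)\<close> nonpositive, and the recursion for
      \<open>w\<close> has no error term.\<close>
    define w where "w k = u k + s k - \<epsilon>" for k
    have w_step: "w (Suc k) \<le> (1 - a k) * w k" if "k \<ge> K" for k
    proof -
      have "a k * s k \<le> a k * \<epsilon>" using K(1)[OF that] a[of k] by (intro mult_left_mono) auto
      then show ?thesis using K(3)[OF that] s_step[of k] by (simp add: w_def algebra_simps)
    qed
    \<comment> \<open>\<open>w\<close> may be negative, but \<open>1 - a k \<le> exp (- a k)\<close>
      can only be multiplied by a nonnegative bound.\<close>
    define C where "C = max (w K) 0"
    have C: "w k \<le> C * exp (- (\<Sum>l=K..<k. a l))" if "k \<ge> K" for k
      using that
    proof (induction k rule: dec_induct)
      case base then show ?case by (simp add: C_def)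
    next
      case (step k)
      have "w (Suc k) \<le> (1 - a k) * w k" using w_step step.hyps by simp
      also have "\<dots> \<le> (1 - a k) * (C * exp (- (\<Sum>l=K..<k. a l)))"
        using step.IH K(2)[of k] step.hyps by (intro mult_left_mono) auto
      also have "\<dots> \<le> exp (- a k) * (C * exp (- (\<Sum>l=K..<k. a l)))"
        using exp_ge_add_one_self[of "- a k"] by (intro mult_right_mono) (auto simp: C_def)
      also have "\<dots> = C * exp (- (\<Sum>l=K..<Suc k. a l))"
        using step.hyps by (simp add: exp_add[symmetric] algebra_simps)
      finally show ?case .
    qed
    have "filterlim (\<lambda>n. (- (\<Sum>l<K. a l)) + (\<Sum>k<n. a k)) at_top sequentially"
      by (rule filterlim_tendsto_add_at_top[OF tendsto_const div])
    moreover have "\<forall>\<^sub>F n in sequentially. (- (\<Sum>l<K. a l)) + (\<Sum>k<n. a k) = (\<Sum>l=K..<n. a l)"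
    proof (rule eventually_sequentiallyI[of K])
      fix n assume "K \<le> n"
      then show "(- (\<Sum>l<K. a l)) + (\<Sum>k<n. a k) = (\<Sum>l=K..<n. a l)"
        using sum.atLeastLessThan_concat[of 0 K n a] by (simp add: lessThan_atLeast0)
    qed
    ultimately have "filterlim (\<lambda>n. \<Sum>l=K..<n. a l) at_top sequentially"
      by (rule filterlim_mono_eventually[OF _ order_refl order_refl])
    then have "(\<lambda>n. C * exp (- (\<Sum>l=K..<n. a l))) \<longlonglongrightarrow> C * 0"
      by (intro tendsto_mult tendsto_const filterlim_compose[OF exp_at_bot])
        (simp add: filterlim_uminus_at_bot)
    then have "\<forall>\<^sub>F n in sequentially. C * exp (- (\<Sum>l=K..<n. a l)) < \<epsilon>"
      using \<epsilon> by (intro order_tendstoD(2)) auto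
    then show ?case
      using eventually_ge_at_top[of K]
    proof eventually_elim
      case (elim k)
      show ?case using C[of k] K(1)[of k] elim u[of k] 1 by (simp add: w_def \<epsilon>_def)
    qed
  qed
qed

lemma delayed_contraction_bounded:
  fixes s :: "nat \<Rightarrow> real"
  assumes T: "T > 0" and d: "0 < d" "d \<le> 1" and step: "\<And>k. s (k + T) \<le> (1 - d) * s k + C"
  shows "\<exists>B. \<forall>k. s k \<le> B"
proof -
  \<comment> \<open>\<open>\<bar>C\<bar> / d\<close> is the fixed point of t -> (1 - d) t + |C|; the
    maximum covers the \<open>T\<close> starting values, which no step bounds.\<close>
  define B where "B = Max ((\<lambda>k. \<bar>s k\<bar>) ` {..<T}) + \<bar>C\<bar> / d"
  have Bs: "\<bar>s k\<bar> + \<bar>C\<bar> / d \<le> B" if "k < T" for k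
    using that by (auto simp: B_def)
  have Cd: "0 \<le> \<bar>C\<bar> / d" using d by simp
  have "s k \<le> B" for k
  proof (induction k rule: less_induct)
    case (less k)
    show ?case
    proof (cases "k < T")
      case True then show ?thesis using Bs[OF True] Cd by linarith
    next
      case False
      then have "s k \<le> (1 - d) * s (k - T) + C" using step[of "k - T"] by simp
      also have "\<dots> \<le> (1 - d) * B + \<bar>C\<bar>"
        using less.IH[of "k - T"] False T d by (intro add_mono mult_left_mono) auto
      also have "\<bar>C\<bar> = d * (\<bar>C\<bar> / d)" using d by simp
      also have "\<dots> \<le> d * B" using Bs[of 0] T d by (intro mult_left_mono) auto
      finally show ?thesis by (simp add: algebra_simps)
    qed
  qed
  then show ?thesis by blast
qed

text \<open>With y the sum of the inputs, (1 - d) s + y is the convex combination (1 - d) s + d (y /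
  d). Convexity of the square keeps the contraction factor 1 - d and leaves the error y^2 /
  d.\<close>

lemma delayed_contraction_square_summable:
  fixes s c :: "nat \<Rightarrow> real"
  assumes T: "T > 0" and d: "0 < d" "d \<le> 1" and s: "\<And>k. s k \<ge> 0" and c: "\<And>k. c k \<ge> 0"
    and step: "\<And>k. s (k + T) \<le> (1 - d) * s k + (\<Sum>l<T. c (k + l))"
    and c2: "summable (\<lambda>k. (c k)\<^sup>2)"
  shows "summable (\<lambda>k. (s k)\<^sup>2)"
proof -
  have sq: "(s (k + T))\<^sup>2 \<le> (1 - d) * (s k)\<^sup>2 + (T / d) * (\<Sum>l<T. (c (k + l))\<^sup>2)" for k
  proof -
    define y where "y = (\<Sum>l<T. c (k + l))"
    have "(s (k + T))\<^sup>2 \<le> ((1 - d) * s k + y)\<^sup>2"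
      using step[of k] s by (intro power_mono) (auto simp: y_def)
    also have "\<dots> \<le> (1 - d) * (s k)\<^sup>2 + y\<^sup>2 / d"
    proof -
      \<comment> \<open>The exact gap in Jensen's inequality for the square with weights 1 - d and
        d.\<close>
      have "(1 - d) * (s k)\<^sup>2 + y\<^sup>2 / d - ((1 - d) * s k + y)\<^sup>2 = (1 - d) * d * (s k - y / d)\<^sup>2"
        using d by (simp add: field_simps power2_eq_square)
      moreover have "\<dots> \<ge> 0" using d by simp
      ultimately show ?thesis by linarith
    qed
    also have "y\<^sup>2 \<le> T * (\<Sum>l<T. (c (k + l))\<^sup>2)"
      using Cauchy_Schwarz_ineq_sum[of "\<lambda>l. 1" "\<lambda>l. c (k + l)" "{..<T}"] by (simp add: y_def)
    finally show ?thesis using d by (simp add: divide_right_mono)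
  qed
  define C where "C = (\<Sum>k. (c k)\<^sup>2)"
  define B where "B = (\<Sum>k<T. (s k)\<^sup>2)"
  \<comment> \<open>The sum of squares is at most its first \<open>T\<close> terms plus the shifted
    sum, which is at most 1 - d times the sum itself plus errors; this part is absorbed on the left.
    Each square of \<open>c\<close> is counted at most \<open>T\<close> times.\<close>
  have bound: "d * (\<Sum>k<n. (s k)\<^sup>2) \<le> B + (T / d) * (T * C)" for n
  proof -
    have le: "(\<Sum>k<n. (s k)\<^sup>2) \<le> (\<Sum>k<n + T. (s k)\<^sup>2)" by (rule sum_mono2) auto
    have "(\<Sum>k<n + T. (s k)\<^sup>2) = B + (\<Sum>k<n. (s (k + T))\<^sup>2)"
      unfolding B_def by (induction n) (auto simp: algebra_simps)
    also have "(\<Sum>k<n. (s (k + T))\<^sup>2) \<le> (\<Sum>k<n. (1 - d) * (s k)\<^sup>2 + (T / d) * (\<Sum>l<T. (c (k + l))\<^sup>2))"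
      by (intro sum_mono sq)
    also have "\<dots> = (1 - d) * (\<Sum>k<n. (s k)\<^sup>2) + (T / d) * (\<Sum>l<T. \<Sum>k<n. (c (k + l))\<^sup>2)"
      by (subst sum.swap) (simp add: sum.distrib sum_distrib_left)
    also have "(\<Sum>l<T. \<Sum>k<n. (c (k + l))\<^sup>2) \<le> (\<Sum>l<T. C)"
    proof (intro sum_mono)
      fix l
      have "(\<Sum>k<n. (c (k + l))\<^sup>2) \<le> (\<Sum>k. (c (k + l))\<^sup>2)"
        by (rule sum_le_suminf[OF summable_ignore_initial_segment[OF c2]]) auto
      also have "\<dots> \<le> C"
        using suminf_split_initial_segment[OF c2, of l] sum_nonneg[of "{..<l}" "\<lambda>k. (c k)\<^sup>2"]
        by (simp add: C_def)
      finally show "(\<Sum>k<n. (c (k + l))\<^sup>2) \<le> C" .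
    qed
    finally have "(\<Sum>k<n. (s k)\<^sup>2) \<le> B + ((1 - d) * (\<Sum>k<n. (s k)\<^sup>2) + (T / d) * (T * C))"
      using le d by (simp add: mult_left_mono divide_right_mono)
    then show ?thesis by (simp add: algebra_simps)
  qed
  show ?thesis
  proof (rule bounded_imp_summable)
    show "(\<Sum>k\<le>n. (s k)\<^sup>2) \<le> (B + (T / d) * (T * C)) / d" for n
      using bound[of "Suc n"] d by (simp add: lessThan_Suc_atMost field_simps)
  qed auto
qed

lemma summable_product_if_square_summable:
  fixes a b :: "nat \<Rightarrow> real"
  assumes "summable (\<lambda>k. (a k)\<^sup>2)" "summable (\<lambda>k. (b k)\<^sup>2)"
  shows "summable (\<lambda>k. a k * b k)"
proof (rule summable_comparison_test'[of "\<lambda>k. (a k)\<^sup>2 + (b k)\<^sup>2" 0])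
  show "norm (a k * b k) \<le> (a k)\<^sup>2 + (b k)\<^sup>2" for k
  proof -
    have "0 \<le> \<bar>a k\<bar> * \<bar>b k\<bar>" by simp
    then show ?thesis
      using sum_squares_bound[of "\<bar>a k\<bar>" "\<bar>b k\<bar>"]
      unfolding real_norm_def abs_mult power2_abs mult.assoc by linarith
  qed
qed (intro summable_add assms)

text \<open>Abel summation: a decreasing weight on the increments of a bounded below sequence cannot
  produce an infinite total decrease.\<close>

lemma summable_square_from_weighted_descent:
  fixes a \<rho> D g :: "nat \<Rightarrow> real"
  assumes a: "decseq a" "\<And>k. a k \<ge> 0" and low: "\<And>k. \<rho> k \<ge> B"
    and g: "summable (\<lambda>k. (a k)\<^sup>2 * (g k)\<^sup>2)"
    and descent: "\<And>k. (D k)\<^sup>2 \<le> a k * (\<rho> k - \<rho> (Suc k)) + a k * g k * D k"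
  shows "summable (\<lambda>k. (D k)\<^sup>2)"
proof -
  \<comment> \<open>Young's inequality for \<open>a k * g k * D k\<close> spends half of
    \<open>(D k)\<^sup>2\<close>.\<close>
  have half: "(D k)\<^sup>2 \<le> 2 * (a k * (\<rho> k - \<rho> (Suc k))) + (a k)\<^sup>2 * (g k)\<^sup>2" for k
    using descent[of k] sum_squares_bound[of "a k * g k" "D k"]
    by (simp add: power_mult_distrib algebra_simps)
  \<comment> \<open>The induction carries the boundary term \<open>a n * (\<rho> n - B)\<close>. It
    is nonnegative, and it does not increase when the weight passes from \<open>a n\<close> to
    \<open>a (Suc n)\<close>.\<close>
  have abel: "(\<Sum>k<n. a k * (\<rho> k - \<rho> (Suc k))) + a n * (\<rho> n - B) \<le> a 0 * (\<rho> 0 - B)" for n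
  proof (induction n)
    case (Suc n)
    have "a (Suc n) * (\<rho> (Suc n) - B) \<le> a n * (\<rho> (Suc n) - B)"
      using decseqD[OF a(1), of n "Suc n"] low[of "Suc n"] by (intro mult_right_mono) auto
    then show ?case using Suc by (simp add: algebra_simps)
  qed simp
  show ?thesis
  proof (rule bounded_imp_summable)
    fix n
    have "(\<Sum>k<Suc n. (D k)\<^sup>2) \<le> (\<Sum>k<Suc n. 2 * (a k * (\<rho> k - \<rho> (Suc k))) + (a k)\<^sup>2 * (g k)\<^sup>2)"
      by (intro sum_mono half)
    also have "\<dots> = 2 * (\<Sum>k<Suc n. a k * (\<rho> k - \<rho> (Suc k))) + (\<Sum>k<Suc n. (a k)\<^sup>2 * (g k)\<^sup>2)"
      by (simp only: sum.distrib sum_distrib_left)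
    also have "\<dots> \<le> 2 * (a 0 * (\<rho> 0 - B)) + (\<Sum>k. (a k)\<^sup>2 * (g k)\<^sup>2)"
    proof (intro add_mono mult_left_mono sum_le_suminf[OF g])
      have "0 \<le> a (Suc n) * (\<rho> (Suc n) - B)" using a(2) low[of "Suc n"] by simp
      then show "(\<Sum>k<Suc n. a k * (\<rho> k - \<rho> (Suc k))) \<le> a 0 * (\<rho> 0 - B)"
        using abel[of "Suc n"] by linarith
    qed auto
    finally show "(\<Sum>k\<le>n. (D k)\<^sup>2) \<le> 2 * (a 0 * (\<rho> 0 - B)) + (\<Sum>k. (a k)\<^sup>2 * (g k)\<^sup>2)"
      by (simp only: lessThan_Suc_atMost)
  qed auto
qed

section \<open>Averaging over jointly connected networks\<close>

text \<open>The oscillation over the players: it vanishes exactly at consensus, and averaging with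
  row-stochastic weights cannot increase it.\<close>

definition spread :: "('p::finite \<Rightarrow> real) \<Rightarrow> real" where
  "spread u = Max (range u) - Min (range u)"

lemma range_bounds [simp]:
  fixes u :: "'p::finite \<Rightarrow> 'a::linorder"
  shows "u i \<le> Max (range u)" "Min (range u) \<le> u i"
  by auto

lemma abs_diff_le_spread:
  fixes u :: "'p::finite \<Rightarrow> real"
  assumes "Min (range u) \<le> a" "a \<le> Max (range u)" "Min (range u) \<le> b" "b \<le> Max (range u)"
  shows "\<bar>a - b\<bar> \<le> spread u"
  using assms by (auto simp: spread_def)

lemma spread_nonneg: "0 \<le> spread u"
  using abs_diff_le_spread[of u "u i" "u i" for i] range_bounds by fastforce

lemma spread_leI:
  assumes "\<And>i. a \<le> u i" "\<And>i. u i \<le> b"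
  shows "spread u \<le> b - a"
proof -
  have "Max (range u) \<le> b" "a \<le> Min (range u)" using assms by auto
  then show ?thesis unfolding spread_def by linarith
qed

lemma spread_perturb:
  assumes "\<And>i. \<bar>u i - w i\<bar> \<le> e"
  shows "spread u \<le> spread w + 2 * e"
proof -
  have "spread u \<le> (Max (range w) + e) - (Min (range w) - e)"
  proof (rule spread_leI)
    fix i
    show "Min (range w) - e \<le> u i" "u i \<le> Max (range w) + e"
      using assms[of i] range_bounds[of w i] by linarith+
  qed
  then show ?thesis unfolding spread_def by linarith
qed

text \<open>The half of double stochasticity that governs the spread; the column sums enter in
  \<open>sum_v\<close>, where they preserve the total.\<close>

definition row_stochastic :: "real^'p^'p::finite \<Rightarrow> bool" where
  "row_stochastic A \<longleftrightarrow> (\<forall>i j. 0 \<le> A $ i $ j) \<and> (\<forall>i. (\<Sum>j\<in>UNIV. A $ i $ j) = 1)"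

lemma row_stochastic_ge:
  assumes "row_stochastic A" "\<And>j. c \<le> u j"
  shows "c \<le> (\<Sum>j\<in>UNIV. A $ i $ j * u j)"
proof -
  have "c = (\<Sum>j\<in>UNIV. A $ i $ j * c)"
    using assms(1) by (simp add: row_stochastic_def flip: sum_distrib_right)
  also have "\<dots> \<le> (\<Sum>j\<in>UNIV. A $ i $ j * u j)"
    using assms by (intro sum_mono mult_left_mono) (auto simp: row_stochastic_def)
  finally show ?thesis .
qed

lemma row_stochastic_le:
  assumes "row_stochastic A" "\<And>j. u j \<le> c"
  shows "(\<Sum>j\<in>UNIV. A $ i $ j * u j) \<le> c"
  using row_stochastic_ge[of A "- c" "\<lambda>j. - u j" i] assms by (simp add: sum_negf)

text \<open>The players whose value after \<open>t\<close> rounds can depend on the initial value of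
  \<open>j\<close>: paths take exactly one edge in each round.\<close>

fun reachable_at :: "(nat \<Rightarrow> ('p \<times> 'p) set) \<Rightarrow> 'p \<Rightarrow> nat \<Rightarrow> 'p set" where
  "reachable_at E j 0 = {j}"
| "reachable_at E j (Suc t) = E t `` reachable_at E j t"

text \<open>Self-loops keep the set from shrinking. If it does not grow over \<open>Suc P\<close>
  rounds, it is closed under the edges of rounds t + 1 to t + P, hence everything by strong
  connectivity. The extra round is there because the window begins at t + 1. Otherwise a player is
  gained per window, and \<open>CARD('p)\<close> windows suffice.\<close>

lemma reachable_at_UNIV:
  fixes E :: "nat \<Rightarrow> ('p::finite \<times> 'p) set"
  assumes loops: "\<And>k i. (i, i) \<in> E k"
    and connected: "\<And>k. strongly_connected (\<Union>l\<in>{1..P}. E (k + l))"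
  shows "reachable_at E j (CARD('p) * Suc P) = UNIV"
proof -
  let ?R = "reachable_at E j"
  have mono: "?R t \<subseteq> ?R (t + s)" for t s
  proof (induction s)
    case (Suc s)
    then show ?case using loops by auto
  qed simp
  have grow: "card (?R (t + Suc P)) > card (?R t)" if "?R t \<noteq> UNIV" for t
  proof (rule ccontr)
    assume "\<not> card (?R (t + Suc P)) > card (?R t)"
    then have eq: "?R (t + Suc P) = ?R t"
      using mono[of t "Suc P"] by (metis card_seteq finite not_less)
    have closed: "b \<in> ?R t" if "a \<in> ?R t" "(a, b) \<in> (\<Union>l\<in>{1..P}. E (t + l))" for a b
    proof -
      from that(2) obtain l where l: "l \<in> {1..P}" "(a, b) \<in> E (t + l)" by blast
      have "a \<in> ?R (t + l)" using mono that by blast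
      with l have "b \<in> ?R (t + Suc l)" by auto
      moreover have "?R (t + Suc l) \<subseteq> ?R (t + Suc P)"
        using mono[of "t + Suc l" "P - l"] l by simp
      ultimately show ?thesis using eq by auto
    qed
    have j: "j \<in> ?R t" using mono[of 0 t] by simp
    have "b \<in> ?R t" for b
    proof -
      have "(j, b) \<in> (\<Union>l\<in>{1..P}. E (t + l))\<^sup>*"
        using connected[of t] by (simp add: strongly_connected_def)
      then show ?thesis
        by (induction rule: rtrancl_induct) (use j closed in auto)
    qed
    then show False using that by auto
  qed
  have "?R (n * Suc P) = UNIV \<or> card (?R (n * Suc P)) > n" for n
  proof (induction n)
    case (Suc n)
    show ?case
    proof (cases "?R (n * Suc P) = UNIV")
      case True
      then show ?thesis using mono[of "n * Suc P" "Suc P"] by (simp only: mult_Suc add.commute) auto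
    next
      case False
      then show ?thesis using Suc grow[OF False] by (simp only: mult_Suc add.commute) auto
    qed
  qed simp
  from this[of "CARD('p)"] show ?thesis
    by (metis card_mono finite not_less top_greatest)
qed

text \<open>Follow a player \<open>j\<close> that holds the maximum: whoever is reached from
  \<open>j\<close> after \<open>t\<close> rounds lies above the old minimum by at least
  \<open>c ^ t\<close> times the old spread. Once all are reached, the minimum has risen while the
  maximum has not.\<close>

lemma homogeneous_averaging_contracts:
  fixes A :: "nat \<Rightarrow> real^'p^'p::finite"
  assumes stoch: "\<And>t. row_stochastic (A t)"
    and c: "0 < c" "\<And>t i j. (j, i) \<in> E t \<Longrightarrow> A t $ i $ j \<ge> c"
    and w: "\<And>t i. w (Suc t) i = (\<Sum>j\<in>UNIV. A t $ i $ j * w t j)"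
    and reach: "\<And>j. reachable_at E j T = UNIV"
  shows "spread (w T) \<le> (1 - c ^ T) * spread (w 0)"
proof -
  define lo hi where "lo = Min (range (w 0))" and "hi = Max (range (w 0))"
  have bounds: "lo \<le> w t i \<and> w t i \<le> hi" for t i
  proof (induction t arbitrary: i)
    case 0
    then show ?case by (simp add: lo_def hi_def)
  next
    case (Suc t)
    then show ?case
      unfolding w using row_stochastic_ge[OF stoch, of lo] row_stochastic_le[OF stoch, of _ hi] by blast
  qed
  have "hi \<in> range (w 0)" unfolding hi_def by (intro Max_in) auto
  then obtain j where j: "w 0 j = hi" by auto
  have lift: "w t i \<ge> lo + c ^ t * (hi - lo)" if "i \<in> reachable_at E j t" for t i
    using that
  proof (induction t arbitrary: i)
    case 0
    then show ?case using j by simp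
  next
    case (Suc t)
    then obtain a where a: "a \<in> reachable_at E j t" "(a, i) \<in> E t" by auto
    have lohi: "lo \<le> hi" using bounds[of 0 j] j by simp
    have "w (Suc t) i - lo = (\<Sum>j\<in>UNIV. A t $ i $ j * (w t j - lo))"
      using stoch[of t] by (simp add: w row_stochastic_def right_diff_distrib sum_subtractf
          flip: sum_distrib_right)
    also have "\<dots> \<ge> A t $ i $ a * (w t a - lo)"
      using stoch[of t] bounds by (intro member_le_sum) (auto simp: row_stochastic_def)
    finally have "w (Suc t) i - lo \<ge> A t $ i $ a * (w t a - lo)" .
    moreover have "A t $ i $ a * (w t a - lo) \<ge> c * (c ^ t * (hi - lo))"
      using c a Suc.IH[OF a(1)] lohi
      by (intro mult_mono) (auto intro: order_trans[OF less_imp_le])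
    ultimately show ?case by simp
  qed
  have "spread (w T) \<le> hi - (lo + c ^ T * (hi - lo))"
    using lift bounds reach by (intro spread_leI) auto
  then show ?thesis by (simp add: spread_def lo_def hi_def algebra_simps)
qed

text \<open>Compare with the unperturbed run \<open>w\<close> from the same start. Averaging does
  not enlarge the largest deviation, so the deviations are at most the accumulated inputs; the
  factor 2 accounts for maximum and minimum moving in opposite directions.\<close>

lemma perturbed_averaging_contracts:
  fixes A :: "nat \<Rightarrow> real^'p^'p::finite"
  assumes stoch: "\<And>t. row_stochastic (A t)"
    and c: "0 < c" "\<And>t i j. (j, i) \<in> E t \<Longrightarrow> A t $ i $ j \<ge> c"
    and u: "\<And>t i. u (Suc t) i = (\<Sum>j\<in>UNIV. A t $ i $ j * u t j) + d t i"
    and d: "\<And>t i. \<bar>d t i\<bar> \<le> e t"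
    and reach: "\<And>j. reachable_at E j T = UNIV"
  shows "spread (u T) \<le> (1 - c ^ T) * spread (u 0) + 2 * (\<Sum>t<T. e t)"
proof -
  define w where "w = rec_nat (u 0) (\<lambda>t y i. \<Sum>j\<in>UNIV. A t $ i $ j * y j)"
  have w: "w 0 = u 0" "\<And>t i. w (Suc t) i = (\<Sum>j\<in>UNIV. A t $ i $ j * w t j)"
    by (simp_all add: w_def)
  have "\<bar>u t i - w t i\<bar> \<le> (\<Sum>l<t. e l)" for t i
  proof (induction t arbitrary: i)
    case (Suc t)
    have eq: "u (Suc t) i - w (Suc t) i = (\<Sum>j\<in>UNIV. A t $ i $ j * (u t j - w t j)) + d t i"
      by (simp add: u w right_diff_distrib sum_subtractf)
    have "- (\<Sum>l<t. e l) \<le> (\<Sum>j\<in>UNIV. A t $ i $ j * (u t j - w t j))"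
      using Suc.IH by (intro row_stochastic_ge[OF stoch]) (metis abs_le_iff minus_le_iff)
    moreover have "(\<Sum>j\<in>UNIV. A t $ i $ j * (u t j - w t j)) \<le> (\<Sum>l<t. e l)"
      using Suc by (intro row_stochastic_le[OF stoch]) (auto simp: abs_le_iff)
    ultimately show ?case using d[of t i] unfolding eq by (simp add: abs_le_iff)
  qed (simp add: w)
  then have "spread (u T) \<le> spread (w T) + 2 * (\<Sum>t<T. e t)" by (rule spread_perturb)
  moreover have "spread (w T) \<le> (1 - c ^ T) * spread (w 0)"
    by (rule homogeneous_averaging_contracts[where E = E and A = A and w = w, OF stoch c w(2) reach])
  ultimately show ?thesis by (simp add: w(1))
qed

section \<open>Proximal points and variational inequalities\<close>

text \<open>Real-valued counterpart of \<open>lower_semicontinuous_on\<close>, for functions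
  restricted to their effective domain, where sums are unproblematic.\<close>

definition lsc_on :: "'a::topological_space set \<Rightarrow> ('a \<Rightarrow> real) \<Rightarrow> bool" where
  "lsc_on S g \<longleftrightarrow> (\<forall>x\<in>S. \<forall>e>0. \<forall>\<^sub>F y in at x within S. g x - e < g y)"

lemma lsc_onD_nhds:
  assumes "lsc_on S g" "x \<in> S" "0 < e"
  shows "\<forall>\<^sub>F y in nhds x. y \<in> S \<longrightarrow> g x - e < g y"
proof -
  have "\<forall>\<^sub>F y in nhds x. y \<noteq> x \<longrightarrow> y \<in> S \<longrightarrow> g x - e < g y"
    using assms by (simp add: lsc_on_def eventually_at_filter)
  then show ?thesis
  proof eventually_elim
    case (elim y)
    then show ?case using assms(3) by (cases "y = x") auto
  qed
qed

lemma lsc_on_add: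
  assumes "lsc_on S f" "lsc_on S g"
  shows "lsc_on S (\<lambda>x. f x + g x)"
  unfolding lsc_on_def
proof (intro ballI allI impI)
  fix x :: 'a and e :: real assume x: "x \<in> S" and e: "0 < e"
  have "\<forall>\<^sub>F y in at x within S. f x - e / 2 < f y" "\<forall>\<^sub>F y in at x within S. g x - e / 2 < g y"
    using assms x e by (auto simp: lsc_on_def)
  then show "\<forall>\<^sub>F y in at x within S. f x + g x - e < f y + g y"
    by eventually_elim (simp add: field_simps)
qed

lemma lsc_on_sum:
  assumes "\<And>i. i \<in> I \<Longrightarrow> lsc_on S (f i)"
  shows "lsc_on S (\<lambda>x. \<Sum>i\<in>I. f i x)"
proof (cases "finite I")
  case True
  then show ?thesis using assms
  proof (induction I rule: finite_induct)
    case (insert i I)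
    then show ?case using lsc_on_add[of S "f i" "\<lambda>x. \<Sum>i\<in>I. f i x"] by simp
  qed (simp add: lsc_on_def)
qed (simp add: lsc_on_def)

lemma continuous_imp_lsc_on:
  fixes g :: "'a::topological_space \<Rightarrow> real"
  assumes "continuous_on S g"
  shows "lsc_on S g"
  unfolding lsc_on_def
proof (intro ballI allI impI)
  fix x and e :: real assume "x \<in> S" "0 < e"
  then show "\<forall>\<^sub>F y in at x within S. g x - e < g y"
    using assms by (auto simp: continuous_on_def intro: order_tendstoD)
qed

lemma lsc_on_compose:
  assumes g: "lsc_on T g" and f: "continuous_on S f" "f ` S \<subseteq> T"
  shows "lsc_on S (\<lambda>x. g (f x))"
  unfolding lsc_on_def
proof (intro ballI allI impI)
  fix x and e :: real assume x: "x \<in> S" and e: "0 < e"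
  have ev: "\<forall>\<^sub>F y in nhds (f x). y \<in> T \<longrightarrow> g (f x) - e < g y"
    using lsc_onD_nhds[OF g _ e] f(2) x by blast
  have "(f \<longlongrightarrow> f x) (at x within S)" using f x by (simp add: continuous_on_def)
  then have "\<forall>\<^sub>F y in at x within S. f y \<in> T \<longrightarrow> g (f x) - e < g (f y)"
    by (rule eventually_compose_filterlim[OF ev])
  moreover have "\<forall>\<^sub>F y in at x within S. y \<in> S" by (simp add: eventually_at_filter)
  ultimately show "\<forall>\<^sub>F y in at x within S. g (f x) - e < g (f y)"
    by eventually_elim (use f(2) in auto)
qed

text \<open>The form in which limits are taken in variational inequalities: the values
  \<open>g (y n)\<close> need not converge, only their upper bounds do.\<close>

lemma lsc_on_sequentially:
  assumes g: "lsc_on S g" and y: "y \<longlonglongrightarrow> x" "\<And>n. y n \<in> S" "x \<in> S"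
    and c: "c \<longlonglongrightarrow> (l::real)" "\<And>n. g (y n) \<le> c n"
  shows "g x \<le> l"
proof (rule field_le_epsilon)
  fix e :: real assume e: "0 < e"
  have "\<forall>\<^sub>F z in nhds x. z \<in> S \<longrightarrow> g x - e < g z"
    by (rule lsc_onD_nhds[OF g y(3) e])
  from eventually_compose_filterlim[OF this y(1)]
  have "\<forall>\<^sub>F n in sequentially. g x - e \<le> c n"
    by eventually_elim (use y(2) c(2) in \<open>auto intro: order_trans[OF less_imp_le]\<close>)
  from tendsto_lowerbound[OF c(1) this] show "g x \<le> l + e" by simp
qed

text \<open>The sublevel sets \<open>K z\<close> are closed, and finitely many of them share the
  best of their base points. Compactness gives a point common to all.\<close>

lemma lsc_attains_inf:
  fixes g :: "'a::metric_space \<Rightarrow> real"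
  assumes "compact S" "S \<noteq> {}" "lsc_on S g"
  shows "\<exists>x\<in>S. \<forall>y\<in>S. g x \<le> g y"
proof -
  define K where "K z = {y \<in> S. g y \<le> g z}" for z
  have closed: "closed (K z)" for z
    unfolding closed_sequential_limits
  proof (intro allI impI)
    fix y l assume y: "(\<forall>n. y n \<in> K z) \<and> y \<longlonglongrightarrow> l"
    then have "l \<in> S"
      using compact_imp_closed[OF assms(1)] unfolding K_def closed_sequential_limits by blast
    then show "l \<in> K z"
      using y lsc_on_sequentially[OF assms(3), of y l "\<lambda>_. g z" "g z"] by (auto simp: K_def)
  qed
  have "S \<inter> \<Inter>(K ` S) \<noteq> {}"
  proof (rule compact_imp_fip_image[OF assms(1)])
    fix I assume I: "finite I" "I \<subseteq> S"
    show "S \<inter> (\<Inter>i\<in>I. K i) \<noteq> {}"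
    proof (cases "I = {}")
      case False
      define z where "z = arg_min_on g I"
      have "z \<in> I" "\<And>i. i \<in> I \<Longrightarrow> g z \<le> g i"
        using I False by (auto simp: z_def arg_min_if_finite arg_min_least)
      then show ?thesis using I by (auto simp: K_def)
    qed (use assms in auto)
  qed (use closed in auto)
  then show ?thesis by (auto simp: K_def)
qed

lemma norm_diff_square:
  fixes a b :: "'a::real_inner"
  shows "(norm (a - b))\<^sup>2 = (norm a)\<^sup>2 - 2 * (a \<bullet> b) + (norm b)\<^sup>2"
  by (simp add: power2_norm_eq_inner inner_diff_left inner_diff_right inner_commute)

text \<open>The optimality condition of the proximal problem: \<open>(u - p) / t\<close> is a
  subgradient at \<open>p\<close> of \<open>g\<close> restricted to \<open>S\<close>. The estimates
  on the iterates use this inequality, not minimality.\<close>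

definition prox_point :: "'a::real_inner set \<Rightarrow> ('a \<Rightarrow> real) \<Rightarrow> real \<Rightarrow> 'a \<Rightarrow> 'a \<Rightarrow> bool" where
  "prox_point S g t u p \<longleftrightarrow> p \<in> S \<and> (\<forall>z\<in>S. (u - p) \<bullet> (z - p) \<le> t * (g z - g p))"

text \<open>Comparing \<open>p\<close> with \<open>p + s (z - p)\<close> and letting \<open>s\<close> tend to \<open>0\<close>.\<close>

lemma prox_pointI:
  assumes S: "convex S" and g: "convex_on S g" and t: "t > 0" and p: "p \<in> S"
    and min: "\<And>z. z \<in> S \<Longrightarrow> g p + 1 / (2 * t) * (norm (p - u))\<^sup>2 \<le> g z + 1 / (2 * t) * (norm (z - u))\<^sup>2"
  shows "prox_point S g t u p"
  unfolding prox_point_def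
proof (intro conjI p ballI)
  fix z assume z: "z \<in> S"
  have le: "(u - p) \<bullet> (z - p) \<le> t * (g z - g p) + s * ((norm (z - p))\<^sup>2 / 2)" if s: "0 < s" "s < 1" for s
  proof -
    let ?y = "(1 - s) *\<^sub>R p + s *\<^sub>R z"
    have y: "?y \<in> S" using S p z s by (intro convexD) auto
    have "g ?y \<le> (1 - s) * g p + s * g z"
      using g p z s by (intro convex_onD) auto
    with min[OF y] have "1 / (2 * t) * (norm (p - u))\<^sup>2 \<le> s * (g z - g p) + 1 / (2 * t) * (norm (?y - u))\<^sup>2"
      by (simp add: algebra_simps)
    then have "(norm (p - u))\<^sup>2 \<le> 2 * t * (s * (g z - g p)) + (norm (?y - u))\<^sup>2"
      using t by (simp add: field_simps)
    also have "?y - u = s *\<^sub>R (z - p) - (u - p)" by (simp add: algebra_simps)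
    also have "(norm \<dots>)\<^sup>2 = (norm (p - u))\<^sup>2 - 2 * s * ((u - p) \<bullet> (z - p)) + s\<^sup>2 * (norm (z - p))\<^sup>2"
      by (simp add: norm_diff_square[of "s *\<^sub>R (z - p)"] power_mult_distrib inner_commute norm_minus_commute[of p u])
    finally have "s * (2 * ((u - p) \<bullet> (z - p))) \<le> s * (2 * t * (g z - g p) + s * (norm (z - p))\<^sup>2)"
      by (simp add: algebra_simps power2_eq_square)
    then show ?thesis using s by simp
  qed
  have "((\<lambda>s. t * (g z - g p) + s * ((norm (z - p))\<^sup>2 / 2)) \<longlongrightarrow> t * (g z - g p) + 0 * ((norm (z - p))\<^sup>2 / 2))
      (at_right 0)"
    by (intro tendsto_intros)
  then have "((\<lambda>s. t * (g z - g p) + s * ((norm (z - p))\<^sup>2 / 2)) \<longlongrightarrow> t * (g z - g p)) (at_right 0)"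
    by simp
  then show "(u - p) \<bullet> (z - p) \<le> t * (g z - g p)"
  proof (rule tendsto_lowerbound)
    show "\<forall>\<^sub>F s in at_right 0. (u - p) \<bullet> (z - p) \<le> t * (g z - g p) + s * ((norm (z - p))\<^sup>2 / 2)"
      using le by (auto simp: eventually_at_right[of 0 1] intro!: exI[of _ 1])
  qed simp
qed

lemma prox_point_exists:
  fixes S :: "'a::real_inner set"
  assumes S: "compact S" "S \<noteq> {}" "convex S" and g: "convex_on S g" "lsc_on S g" and t: "t > 0"
  shows "\<exists>p. prox_point S g t u p"
proof -
  have "lsc_on S (\<lambda>z. g z + 1 / (2 * t) * (norm (z - u))\<^sup>2)"
    by (intro lsc_on_add g(2) continuous_imp_lsc_on continuous_intros)
  from lsc_attains_inf[OF S(1,2) this] obtain p where "p \<in> S"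
    "\<And>z. z \<in> S \<Longrightarrow> g p + 1 / (2 * t) * (norm (p - u))\<^sup>2 \<le> g z + 1 / (2 * t) * (norm (z - u))\<^sup>2"
    by blast
  from prox_pointI[OF S(3) g(1) t this] show ?thesis by blast
qed

text \<open>Testing each inequality at the other point and adding cancels \<open>g\<close>; this is
  firm nonexpansiveness, and Cauchy-Schwarz finishes.\<close>

lemma prox_point_nonexpansive:
  assumes "prox_point S g t u p" "prox_point S g t u' p'"
  shows "norm (p - p') \<le> norm (u - u')"
proof -
  have "(u - p) \<bullet> (p' - p) \<le> t * (g p' - g p)" "(u' - p') \<bullet> (p - p') \<le> t * (g p - g p')"
    using assms by (auto simp: prox_point_def)
  then have "(norm (p - p'))\<^sup>2 \<le> (u - u') \<bullet> (p - p')"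
    unfolding power2_norm_eq_inner inner_diff_left inner_diff_right
    by (simp add: inner_commute algebra_simps)
  also have "\<dots> \<le> norm (u - u') * norm (p - p')" by (rule norm_cauchy_schwarz)
  finally have "norm (p - p') * norm (p - p') \<le> norm (u - u') * norm (p - p')"
    by (simp add: power2_eq_square)
  then show ?thesis
    using mult_right_le_imp_le[of "norm (p - p')" "norm (p - p')"] by (cases "p = p'") auto
qed

text \<open>For convex \<open>g\<close> this says that \<open>- A y\<close> is a subgradient at
  \<open>y\<close> of \<open>g\<close> restricted to \<open>S\<close>.\<close>

definition vi_solution :: "'a::real_inner set \<Rightarrow> ('a \<Rightarrow> real) \<Rightarrow> ('a \<Rightarrow> 'a) \<Rightarrow> 'a \<Rightarrow> bool" where
  "vi_solution S g A y \<longleftrightarrow> y \<in> S \<and> (\<forall>z\<in>S. A y \<bullet> (z - y) + g z - g y \<ge> 0)"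

text \<open>A solution is a fixed point of \<open>y \<mapsto> prox\<^sub>t\<^sub>g (y - t A y)\<close>, a contraction for \<open>t = \<mu> / \<Lambda>\<^sup>2\<close>.\<close>

lemma strongly_monotone_vi_solution_exists:
  fixes S :: "'a::{real_inner, heine_borel} set"
  assumes S: "compact S" "S \<noteq> {}" "convex S" and g: "convex_on S g" "lsc_on S g"
    and lip: "\<And>x y. x \<in> S \<Longrightarrow> y \<in> S \<Longrightarrow> norm (A x - A y) \<le> \<Lambda> * norm (x - y)"
    and mono: "\<And>x y. x \<in> S \<Longrightarrow> y \<in> S \<Longrightarrow> (A x - A y) \<bullet> (x - y) \<ge> \<mu> * (norm (x - y))\<^sup>2"
    and \<mu>: "0 < \<mu>" "\<mu> \<le> \<Lambda>"
  shows "\<exists>y. vi_solution S g A y"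
proof -
  define t where "t = \<mu> / \<Lambda>\<^sup>2"
  have t: "t > 0" using \<mu> by (simp add: t_def)
  have "\<forall>y. \<exists>p. prox_point S g t (y - t *\<^sub>R A y) p"
    using prox_point_exists[OF S g t] by blast
  then obtain T where T: "\<And>y. prox_point S g t (y - t *\<^sub>R A y) (T y)" by metis
  \<comment> \<open>The square root of 1 - 2 t \<mu> + t^2 \<Lambda>^2, which is smallest at the
    chosen \<open>t\<close>; \<open>\<mu> \<le> \<Lambda>\<close> keeps the radicand
    nonnegative.\<close>
  define c where "c = sqrt (1 - (\<mu> / \<Lambda>)\<^sup>2)"
  have "0 < \<mu> / \<Lambda>" "\<mu> / \<Lambda> \<le> 1" using \<mu> by auto
  then have ml: "0 < (\<mu> / \<Lambda>)\<^sup>2" "(\<mu> / \<Lambda>)\<^sup>2 \<le> 1" by (auto simp: power_le_one)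
  have c: "0 \<le> c" "c < 1" using ml by (auto simp: c_def)
  have contr: "dist (T x) (T y) \<le> c * dist x y" if xy: "x \<in> S" "y \<in> S" for x y
  proof -
    have "norm (T x - T y) \<le> norm ((x - y) - t *\<^sub>R (A x - A y))"
      using prox_point_nonexpansive[OF T[of x] T[of y]] by (simp add: algebra_simps)
    also have "\<dots> \<le> c * norm (x - y)"
    proof (rule power2_le_imp_le)
      have "(norm ((x - y) - t *\<^sub>R (A x - A y)))\<^sup>2
          = (norm (x - y))\<^sup>2 - 2 * t * ((A x - A y) \<bullet> (x - y)) + t\<^sup>2 * (norm (A x - A y))\<^sup>2"
        by (simp add: norm_diff_square[of "x - y"] power_mult_distrib inner_commute)
      also have "\<dots> \<le> (norm (x - y))\<^sup>2 - 2 * t * (\<mu> * (norm (x - y))\<^sup>2) + t\<^sup>2 * (\<Lambda> * norm (x - y))\<^sup>2"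
        using mono[OF xy] lip[OF xy] t by (intro add_mono diff_left_mono mult_left_mono power_mono) auto
      also have "\<dots> = (1 - (\<mu> / \<Lambda>)\<^sup>2) * (norm (x - y))\<^sup>2"
        using \<mu> by (simp add: t_def field_simps power2_eq_square)
      also have "\<dots> = (c * norm (x - y))\<^sup>2" using ml by (simp add: c_def power_mult_distrib)
      finally show "(norm ((x - y) - t *\<^sub>R (A x - A y)))\<^sup>2 \<le> (c * norm (x - y))\<^sup>2" .
    qed (use c in auto)
    finally show ?thesis by (simp add: dist_norm)
  qed
  have "\<exists>!x\<in>S. T x = x"
    using contr T c S(2) compact_imp_complete[OF S(1)]
    by (intro Banach_fix[of S c T]) (auto simp: prox_point_def)
  then obtain y where y: "y \<in> S" "T y = y" by blast
  have "A y \<bullet> (z - y) + g z - g y \<ge> 0" if "z \<in> S" for z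
  proof -
    have "t * 0 \<le> t * (A y \<bullet> (z - y) + g z - g y)"
      using T[of y] y that by (auto simp: prox_point_def algebra_simps)
    then show ?thesis using t by (simp only: mult_le_cancel_left_pos)
  qed
  then show ?thesis using y by (auto simp: vi_solution_def)
qed

section \<open>Convergence of square-integrable martingales\<close>

text \<open>\<open>m k\<close> is revealed at time \<open>Suc k\<close>. This indexing fits
  \<open>noise_history\<close>, which at time \<open>k\<close> contains the noise before
  \<open>k\<close> only.\<close>

locale square_integrable_martingale_differences = prob_space M
  for M :: "'w measure" +
  fixes G :: "nat \<Rightarrow> 'w measure" and m :: "nat \<Rightarrow> 'w \<Rightarrow> real"
  assumes subalg: "\<And>k. subalgebra M (G k)"
    and mono: "\<And>k. sets (G k) \<subseteq> sets (G (Suc k))"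
    and adapted: "\<And>k. m k \<in> borel_measurable (G (Suc k))"
    and square_integrable: "\<And>k. integrable M (\<lambda>\<omega>. (m k \<omega>)\<^sup>2)"
    and centered: "\<And>k. AE \<omega> in M. real_cond_exp M (G k) (m k) \<omega> = 0"
begin

lemma measurable_mono:
  assumes "f \<in> borel_measurable (G k)" "k \<le> l"
  shows "f \<in> borel_measurable (G l)"
proof -
  have "sets (G k) \<subseteq> sets (G l)" using assms(2)
    by (induction l rule: dec_induct) (use mono in auto)
  moreover have "space (G k) = space (G l)"
    using subalg[of k] subalg[of l] by (simp add: subalgebra_def)
  ultimately have "subalgebra (G l) (G k)" by (simp add: subalgebra_def)
  then show ?thesis using assms(1) measurable_from_subalg by blast
qed

lemma measurable_M: "f \<in> borel_measurable (G k) \<Longrightarrow> f \<in> borel_measurable M"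
  using measurable_from_subalg[OF subalg] by blast

lemma measurable_m [measurable]: "m k \<in> borel_measurable M"
  by (rule measurable_M[OF adapted])

lemma integrable_product:
  fixes X Y :: "'w \<Rightarrow> real"
  assumes [measurable]: "X \<in> borel_measurable M" "Y \<in> borel_measurable M"
    and "integrable M (\<lambda>\<omega>. (X \<omega>)\<^sup>2)" "integrable M (\<lambda>\<omega>. (Y \<omega>)\<^sup>2)"
  shows "integrable M (\<lambda>\<omega>. X \<omega> * Y \<omega>)"
proof (rule Bochner_Integration.integrable_bound)
  show "integrable M (\<lambda>\<omega>. (X \<omega>)\<^sup>2 + (Y \<omega>)\<^sup>2)" using assms by simp
  show "AE \<omega> in M. norm (X \<omega> * Y \<omega>) \<le> norm ((X \<omega>)\<^sup>2 + (Y \<omega>)\<^sup>2)"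
  proof (intro AE_I2)
    fix \<omega>
    have "2 * (\<bar>X \<omega>\<bar> * \<bar>Y \<omega>\<bar>) \<le> (X \<omega>)\<^sup>2 + (Y \<omega>)\<^sup>2"
      using sum_squares_bound[of "\<bar>X \<omega>\<bar>" "\<bar>Y \<omega>\<bar>"] by (simp add: mult.assoc)
    moreover have "0 \<le> \<bar>X \<omega>\<bar> * \<bar>Y \<omega>\<bar>" by simp
    ultimately show "norm (X \<omega> * Y \<omega>) \<le> norm ((X \<omega>)\<^sup>2 + (Y \<omega>)\<^sup>2)"
      unfolding real_norm_def abs_mult by linarith
  qed
qed simp

text \<open>A factor known at time \<open>k\<close> moves out of the conditional expectation. This
  removes the cross terms when squares of partial sums are expanded.\<close>

lemma orthogonal:
  assumes Y: "Y \<in> borel_measurable (G k)" "integrable M (\<lambda>\<omega>. (Y \<omega>)\<^sup>2)"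
  shows "integrable M (\<lambda>\<omega>. Y \<omega> * m k \<omega>)" "(\<integral>\<omega>. Y \<omega> * m k \<omega> \<partial>M) = 0"
proof -
  interpret finite_measure_subalgebra M "G k" by unfold_locales (rule subalg)
  show int: "integrable M (\<lambda>\<omega>. Y \<omega> * m k \<omega>)"
    by (intro integrable_product square_integrable Y measurable_M[OF Y(1)] measurable_m)
  have "(\<integral>\<omega>. Y \<omega> * m k \<omega> \<partial>M) = (\<integral>\<omega>. Y \<omega> * real_cond_exp M (G k) (m k) \<omega> \<partial>M)"
    by (rule real_cond_exp_intg(2)[symmetric, OF int Y(1) measurable_m])
  also have "\<dots> = (\<integral>\<omega>. 0 \<partial>M)"
    using centered[of k] measurable_M[OF Y(1)] by (intro integral_cong_AE) auto
  finally show "(\<integral>\<omega>. Y \<omega> * m k \<omega> \<partial>M) = 0" by simp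
qed

text \<open>Kolmogorov's maximal inequality, by applying Markov's inequality to the martingale that is
  stopped when it first leaves \<open>(-e, e)\<close>.\<close>

lemma maximal_inequality:
  assumes e: "e > 0"
  shows "prob {\<omega> \<in> space M. \<exists>k\<le>n. e \<le> \<bar>\<Sum>l<k. m l \<omega>\<bar>} \<le> (\<Sum>k<n. expectation (\<lambda>\<omega>. (m k \<omega>)\<^sup>2)) / e\<^sup>2"
proof -
  define S where "S k \<omega> = (\<Sum>l<k. m l \<omega>)" for k \<omega>
  \<comment> \<open>Whether the partial sums are still inside at time \<open>k\<close>; it is known
    before \<open>m k\<close> is revealed, so \<open>T\<close> below, the stopped sum, is again a
    martingale.\<close>
  define I :: "nat \<Rightarrow> 'w \<Rightarrow> real" where "I k \<omega> = (if \<forall>j\<le>k. \<bar>S j \<omega>\<bar> < e then 1 else 0)" for k \<omega>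
  define T where "T k \<omega> = (\<Sum>l<k. I l \<omega> * m l \<omega>)" for k \<omega>
  have S_meas: "S j \<in> borel_measurable (G k)" if "j \<le> k" for j k
    unfolding S_def using that by (intro borel_measurable_sum measurable_mono[OF adapted]) auto
  have I_meas: "I k \<in> borel_measurable (G k)" for k
  proof -
    have [measurable]: "Measurable.pred (G k) (\<lambda>\<omega>. \<bar>S j \<omega>\<bar> < e)" if "j \<le> k" for j
    proof -
      have [measurable]: "S j \<in> borel_measurable (G k)" by (rule S_meas[OF that])
      show ?thesis by measurable
    qed
    have "Measurable.pred (G k) (\<lambda>\<omega>. \<forall>j\<in>{..k}. \<bar>S j \<omega>\<bar> < e)"
      by (intro pred_intros_finite) auto
    then show ?thesis unfolding I_def by (simp add: Ball_def)
  qed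
  have T_meas: "T j \<in> borel_measurable (G k)" if "j \<le> k" for j k
    unfolding T_def using that
    by (intro borel_measurable_sum borel_measurable_times measurable_mono[OF adapted] measurable_mono[OF I_meas]) auto
  note [measurable] = measurable_M[OF T_meas[OF order_refl]] measurable_M[OF I_meas]
    measurable_M[OF S_meas[OF order_refl]]
  have T_sq: "integrable M (\<lambda>\<omega>. (T k \<omega>)\<^sup>2) \<and>
      expectation (\<lambda>\<omega>. (T k \<omega>)\<^sup>2) \<le> (\<Sum>l<k. expectation (\<lambda>\<omega>. (m l \<omega>)\<^sup>2))" for k
  proof (induction k)
    case 0
    then show ?case by (simp add: T_def)
  next
    case (Suc k)
    have I01: "I k \<omega> = 0 \<or> I k \<omega> = 1" for \<omega> by (simp add: I_def)
    \<comment> \<open>\<open>I k\<close> is 0 or 1, hence equal to its square. The middle term has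
      mean 0 by \<open>orthogonal\<close>.\<close>
    have eq: "(T (Suc k) \<omega>)\<^sup>2 = (T k \<omega>)\<^sup>2 + (2 * ((T k \<omega> * I k \<omega>) * m k \<omega>) + I k \<omega> * (m k \<omega>)\<^sup>2)" for \<omega>
      using I01[of \<omega>] by (auto simp: T_def power2_sum)
    have TI: "integrable M (\<lambda>\<omega>. (T k \<omega> * I k \<omega>)\<^sup>2)"
      by (rule Bochner_Integration.integrable_bound[of M "\<lambda>\<omega>. (T k \<omega>)\<^sup>2"])
        (use Suc I01 in \<open>auto simp: power_mult_distrib I_def\<close>)
    have TI_meas: "(\<lambda>\<omega>. T k \<omega> * I k \<omega>) \<in> borel_measurable (G k)"
      by (intro borel_measurable_times T_meas I_meas) simp
    note orth = orthogonal[OF TI_meas TI]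
    have Im: "integrable M (\<lambda>\<omega>. I k \<omega> * (m k \<omega>)\<^sup>2)"
      by (rule Bochner_Integration.integrable_bound[OF square_integrable[of k]]) (auto simp: I_def)
    have "expectation (\<lambda>\<omega>. (T (Suc k) \<omega>)\<^sup>2)
        = expectation (\<lambda>\<omega>. (T k \<omega>)\<^sup>2) + expectation (\<lambda>\<omega>. I k \<omega> * (m k \<omega>)\<^sup>2)"
      unfolding eq using Suc orth Im by (subst Bochner_Integration.integral_add) auto
    moreover have "expectation (\<lambda>\<omega>. I k \<omega> * (m k \<omega>)\<^sup>2) \<le> expectation (\<lambda>\<omega>. (m k \<omega>)\<^sup>2)"
      by (intro integral_mono Im square_integrable) (auto simp: I_def)
    ultimately show ?case unfolding eq using Suc orth Im by (auto simp: eq)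
  qed
  have sub: "{\<omega> \<in> space M. \<exists>k\<le>n. e \<le> \<bar>S k \<omega>\<bar>} \<subseteq> {\<omega> \<in> space M. e\<^sup>2 \<le> (T n \<omega>)\<^sup>2}"
  proof safe
    fix \<omega> k assume k: "k \<le> n" "e \<le> \<bar>S k \<omega>\<bar>"
    \<comment> \<open>The first exit time. The stopped sum is frozen there, so at time
      \<open>n\<close> it still has the value that left the interval.\<close>
    define j where "j = (LEAST k. e \<le> \<bar>S k \<omega>\<bar>)"
    have j: "e \<le> \<bar>S j \<omega>\<bar>" unfolding j_def using k(2) by (rule LeastI)
    have jn: "j \<le> n" unfolding j_def using Least_le[of "\<lambda>k. e \<le> \<bar>S k \<omega>\<bar>", OF k(2)] k(1) by simp
    have below: "\<bar>S i \<omega>\<bar> < e" if "i < j" for i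
      using not_less_Least[of i "\<lambda>k. e \<le> \<bar>S k \<omega>\<bar>"] that by (simp add: j_def)
    have "T n \<omega> = (\<Sum>l<j. m l \<omega>)"
    proof -
      have "T n \<omega> = (\<Sum>l<j. I l \<omega> * m l \<omega>)"
        unfolding T_def using jn j by (intro sum.mono_neutral_right) (auto simp: I_def)
      then show ?thesis using below by (simp add: I_def)
    qed
    then have "e \<le> \<bar>T n \<omega>\<bar>" using j by (simp add: S_def)
    then have "e\<^sup>2 \<le> \<bar>T n \<omega>\<bar>\<^sup>2" using e by (intro power_mono) auto
    then show "e\<^sup>2 \<le> (T n \<omega>)\<^sup>2" by simp
  qed
  have "prob {\<omega> \<in> space M. \<exists>k\<le>n. e \<le> \<bar>S k \<omega>\<bar>} \<le> prob {\<omega> \<in> space M. e\<^sup>2 \<le> (T n \<omega>)\<^sup>2}"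
    by (intro finite_measure_mono sub) measurable
  also have "\<dots> \<le> expectation (\<lambda>\<omega>. (T n \<omega>)\<^sup>2) / e\<^sup>2"
    by (rule integral_Markov_inequality_measure[where A = "{}"]) (use T_sq[of n] e in auto)
  also have "\<dots> \<le> (\<Sum>k<n. expectation (\<lambda>\<omega>. (m k \<omega>)\<^sup>2)) / e\<^sup>2"
    using T_sq[of n] by (intro divide_right_mono) auto
  finally show ?thesis by (simp add: S_def)
qed

lemma maximal_inequality_infinite:
  assumes e: "e > 0" and sum: "summable (\<lambda>k. expectation (\<lambda>\<omega>. (m k \<omega>)\<^sup>2))"
  shows "prob {\<omega> \<in> space M. \<exists>k. e \<le> \<bar>\<Sum>l<k. m l \<omega>\<bar>} \<le> (\<Sum>k. expectation (\<lambda>\<omega>. (m k \<omega>)\<^sup>2)) / e\<^sup>2"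
proof -
  define A where "A n = {\<omega> \<in> space M. \<exists>k\<le>n. e \<le> \<bar>\<Sum>l<k. m l \<omega>\<bar>}" for n
  have "range A \<subseteq> events" by (auto simp: A_def)
  moreover have "incseq A" by (rule incseq_SucI) (auto simp: A_def intro: le_SucI)
  ultimately have "(\<lambda>n. prob (A n)) \<longlonglongrightarrow> prob (\<Union>n. A n)"
    by (rule finite_Lim_measure_incseq)
  then have "prob (\<Union>n. A n) \<le> (\<Sum>k. expectation (\<lambda>\<omega>. (m k \<omega>)\<^sup>2)) / e\<^sup>2"
  proof (rule tendsto_upperbound)
    show "\<forall>\<^sub>F n in sequentially. prob (A n) \<le> (\<Sum>k. expectation (\<lambda>\<omega>. (m k \<omega>)\<^sup>2)) / e\<^sup>2"
    proof (intro always_eventually allI)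
      fix n
      have "prob (A n) \<le> (\<Sum>k<n. expectation (\<lambda>\<omega>. (m k \<omega>)\<^sup>2)) / e\<^sup>2"
        unfolding A_def by (rule maximal_inequality[OF e])
      also have "\<dots> \<le> (\<Sum>k. expectation (\<lambda>\<omega>. (m k \<omega>)\<^sup>2)) / e\<^sup>2"
        by (intro divide_right_mono sum_le_suminf[OF sum]) auto
      finally show "prob (A n) \<le> (\<Sum>k. expectation (\<lambda>\<omega>. (m k \<omega>)\<^sup>2)) / e\<^sup>2" .
    qed
  qed simp
  moreover have "(\<Union>n. A n) = {\<omega> \<in> space M. \<exists>k. e \<le> \<bar>\<Sum>l<k. m l \<omega>\<bar>}" by (auto simp: A_def)
  ultimately show ?thesis by simp
qed

end

text \<open>The maximal inequality for the differences after \<open>N\<close> bounds the probability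
  of an oscillation by \<open>e\<close> after time \<open>N\<close> by a tail of the series over
  \<open>e\<^sup>2\<close>. So oscillations of size \<open>e\<close> persist for all
  \<open>N\<close> only on a null set.\<close>

theorem square_summable_martingale_differences_converge:
  assumes "square_integrable_martingale_differences M G m"
    and sum: "summable (\<lambda>k. \<integral>\<omega>. (m k \<omega>)\<^sup>2 \<partial>M)"
  shows "AE \<omega> in M. summable (\<lambda>k. m k \<omega>)"
proof -
  interpret square_integrable_martingale_differences M G m by fact
  have shifted: "square_integrable_martingale_differences M (\<lambda>k. G (k + N)) (\<lambda>k. m (k + N))" for N
    by unfold_locales (use subalg mono adapted square_integrable centered in auto)
  have small: "AE \<omega> in M. \<exists>N. \<forall>k. \<bar>\<Sum>l<k. m (l + N) \<omega>\<bar> < e" if e: "e > 0" for e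
  proof -
    define B where "B N = {\<omega> \<in> space M. \<exists>k. e \<le> \<bar>\<Sum>l<k. m (l + N) \<omega>\<bar>}" for N
    have B_meas: "B N \<in> events" for N unfolding B_def by measurable
    have "prob (\<Inter>N. B N) \<le> 0"
    proof (rule tendsto_lowerbound)
      have "(\<lambda>N. (\<Sum>k. expectation (\<lambda>\<omega>. (m (k + N) \<omega>)\<^sup>2)) / e\<^sup>2) \<longlonglongrightarrow> 0 / e\<^sup>2"
        by (intro tendsto_divide suminf_exist_split2 sum tendsto_const) (use e in auto)
      then show "(\<lambda>N. (\<Sum>k. expectation (\<lambda>\<omega>. (m (k + N) \<omega>)\<^sup>2)) / e\<^sup>2) \<longlonglongrightarrow> 0" by simp
      show "\<forall>\<^sub>F N in sequentially. prob (\<Inter>N. B N) \<le> (\<Sum>k. expectation (\<lambda>\<omega>. (m (k + N) \<omega>)\<^sup>2)) / e\<^sup>2"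
      proof (intro always_eventually allI)
        fix N
        interpret shift: square_integrable_martingale_differences M "\<lambda>k. G (k + N)" "\<lambda>k. m (k + N)"
          by (rule shifted)
        have "prob (\<Inter>N. B N) \<le> prob (B N)" by (intro finite_measure_mono B_meas) auto
        also have "\<dots> \<le> (\<Sum>k. expectation (\<lambda>\<omega>. (m (k + N) \<omega>)\<^sup>2)) / e\<^sup>2"
          unfolding B_def
          by (rule shift.maximal_inequality_infinite[OF e summable_ignore_initial_segment[OF sum]])
        finally show "prob (\<Inter>N. B N) \<le> (\<Sum>k. expectation (\<lambda>\<omega>. (m (k + N) \<omega>)\<^sup>2)) / e\<^sup>2" .
      qed
    qed simp
    moreover have meas: "(\<Inter>N. B N) \<in> events" using B_meas by (intro sets.countable_INT) auto
    ultimately have "(\<Inter>N. B N) \<in> null_sets M"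
      by (intro null_setsI) (auto simp: emeasure_eq_measure measure_le_0_iff)
    then show ?thesis
      by (rule AE_I') (auto simp: B_def not_less)
  qed
  \<comment> \<open>Only countably many sizes, so that a single null set serves for all of
    them.\<close>
  have "AE \<omega> in M. \<forall>q. \<exists>N. \<forall>k. \<bar>\<Sum>l<k. m (l + N) \<omega>\<bar> < 1 / real (Suc q)"
    unfolding AE_all_countable using small by simp
  then show ?thesis
  proof eventually_elim
    case (elim \<omega>)
    show ?case
      unfolding summable_iff_convergent Cauchy_convergent_iff[symmetric]
    proof (rule CauchyI')
      fix e :: real assume e: "0 < e"
      then obtain q where q: "1 / real (Suc q) < e / 2"
        using reals_Archimedean[of "e / 2"] by (auto simp: inverse_eq_divide)
      obtain N where N: "\<And>k. \<bar>\<Sum>l<k. m (l + N) \<omega>\<bar> < 1 / real (Suc q)" using elim by blast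
      have diff: "(\<Sum>l<k. m l \<omega>) = (\<Sum>l<N. m l \<omega>) + (\<Sum>l<k - N. m (l + N) \<omega>)" if "k \<ge> N" for k
        using that sum.atLeastLessThan_concat[of 0 N k "\<lambda>l. m l \<omega>"]
          sum.shift_bounds_nat_ivl[of "\<lambda>l. m l \<omega>" 0 N "k - N"]
        by (simp add: lessThan_atLeast0)
      show "\<exists>K. \<forall>k\<ge>K. \<forall>n>k. dist (\<Sum>l<k. m l \<omega>) (\<Sum>l<n. m l \<omega>) < e"
      proof (intro exI[of _ N] allI impI)
        fix k n assume "N \<le> k" "k < n"
        then show "dist (\<Sum>l<k. m l \<omega>) (\<Sum>l<n. m l \<omega>) < e"
          using diff[of k] diff[of n] N[of "k - N"] N[of "n - N"] q
          unfolding dist_real_def by linarith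
      qed
    qed
  qed
qed

section \<open>Blocks and gradients\<close>

lemma block_in_space [simp]: "block own i x \<in> block_space own i"
  by (simp add: block_def block_space_def)

lemma block_id: "x \<in> block_space own i \<Longrightarrow> block own i x = x"
  by (auto simp: block_def block_space_def vec_eq_iff)

lemma block_block: "block own i (block own j x) = (if i = j then block own i x else 0)"
  by (auto simp: block_def vec_eq_iff)

lemma linear_block: "linear (block own i)"
  by (rule linearI) (auto simp: block_def vec_eq_iff)

lemmas block_add = linear_add[OF linear_block]
  and block_diff = linear_diff[OF linear_block]
  and block_scaleR = linear_scale[OF linear_block]

lemma bounded_linear_block: "bounded_linear (block own i)"
  by (rule linear_conv_bounded_linear[THEN iffD1, OF linear_block])

lemma continuous_on_block [continuous_intros]:
  "continuous_on S f \<Longrightarrow> continuous_on S (\<lambda>x. block own i (f x))"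
  by (rule bounded_linear.continuous_on[OF bounded_linear_block])

lemma block_space_diff:
  "x \<in> block_space own i \<Longrightarrow> y \<in> block_space own i \<Longrightarrow> x - y \<in> block_space own i"
  by (simp add: block_space_def)

lemma sum_block: "(\<Sum>i\<in>UNIV. block own i x) = x" for own :: "'c::finite \<Rightarrow> 'p::finite"
  unfolding vec_eq_iff by (simp add: block_def)

lemma inner_block_right: "x \<bullet> block own i y = block own i x \<bullet> block own i y"
  unfolding inner_vec_def by (intro sum.cong refl) (simp add: block_def)

lemma inner_sum_blocks:
  fixes own :: "'c::finite \<Rightarrow> 'p::finite"
  shows "x \<bullet> y = (\<Sum>i\<in>UNIV. x \<bullet> block own i y)"
  using sum_block[of own y] by (metis inner_sum_right)

lemma norm_sq_sum_blocks:
  fixes own :: "'c::finite \<Rightarrow> 'p::finite"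
  shows "(norm x)\<^sup>2 = (\<Sum>i\<in>UNIV. (norm (block own i x))\<^sup>2)"
proof -
  have "(norm x)\<^sup>2 = (\<Sum>i\<in>UNIV. x \<bullet> block own i x)"
    using inner_sum_blocks[of x x own] by (simp add: power2_norm_eq_inner)
  also have "\<dots> = (\<Sum>i\<in>UNIV. (norm (block own i x))\<^sup>2)"
    by (rule sum.cong[OF refl]) (metis power2_norm_eq_inner inner_block_right)
  finally show ?thesis .
qed

lemma norm_block_le: "norm (block own i x) \<le> norm x"
  by (rule norm_le_componentwise_cart) (auto simp: block_def)

text \<open>\<open>grad\<close> is a definite description, so it can be evaluated only after the
  Riesz vector of the derivative is shown to be the unique candidate.\<close>

lemma grad_inner:
  fixes f :: "'a::euclidean_space \<Rightarrow> real"
  assumes f: "(f has_derivative f') (at x)"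
  shows "grad f x \<bullet> d = f' d"
proof -
  define w where "w = (\<Sum>b\<in>Basis. f' b *\<^sub>R b)"
  have lin: "linear f'" using f by (rule has_derivative_linear)
  have w: "w \<bullet> d = f' d" for d
  proof -
    have "f' d = f' (\<Sum>b\<in>Basis. (d \<bullet> b) *\<^sub>R b)" by (simp add: euclidean_representation)
    also have "\<dots> = (\<Sum>b\<in>Basis. (d \<bullet> b) * f' b)"
      by (simp add: linear_sum[OF lin] linear_scale[OF lin])
    finally show ?thesis
      by (simp add: w_def inner_sum_left mult.commute) (simp add: inner_commute)
  qed
  then have "f' = (\<lambda>d. d \<bullet> w)" by (auto simp: inner_commute)
  then have gd: "GDERIV f x :> w" using f by (simp add: gderiv_def)
  have "grad f x = w"
    unfolding grad_def
  proof (rule the_equality[where P = "\<lambda>g. GDERIV f x :> g", OF gd])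
    fix g assume "GDERIV f x :> g"
    then have "(\<lambda>d. d \<bullet> g) = (\<lambda>d. d \<bullet> w)"
      using gd has_derivative_unique unfolding gderiv_def by blast
    then have "d \<bullet> g = d \<bullet> w" for d by metis
    then show "g = w" by (intro vector_eq_rdot[THEN iffD1]) (simp add: inner_commute)
  qed
  then show ?thesis using w by simp
qed

text \<open>The chain rule for y -> g(y, h_i(y) + const): the transposed Jacobian moves to the other
  side of the inner product, and the two partial derivatives add up to \<open>D\<close>.\<close>

lemma marginal_grad_inner:
  assumes y: "y \<in> block_space own i"
    and g: "((\<lambda>(y, s). g (block own i y) s) has_derivative D) (at (y, z))"
    and h: "((\<lambda>y. h i (block own i y)) has_derivative H) (at y)"
  shows "marginal_grad own h i g y z \<bullet> d = D (d, H d)"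
proof -
  have lin: "linear D" using g by (rule has_derivative_linear)
  have 1: "((\<lambda>y. g (block own i y) z) has_derivative (\<lambda>d. D (d, 0))) (at y)"
  proof -
    have "((\<lambda>y. (y, z)) has_derivative (\<lambda>d. (d, 0))) (at y)"
      by (auto intro!: derivative_eq_intros)
    from has_derivative_compose[OF this, of "\<lambda>(y, s). g (block own i y) s" D] g
    show ?thesis by simp
  qed
  have 2: "((\<lambda>s. g y s) has_derivative (\<lambda>d. D (0, d))) (at z)"
  proof -
    have "((\<lambda>s. (y, s)) has_derivative (\<lambda>d. (0, d))) (at z)"
      by (auto intro!: derivative_eq_intros)
    from has_derivative_compose[OF this, of "\<lambda>(y, s). g (block own i y) s" D] g
    show ?thesis by (simp add: block_id[OF y])
  qed
  have jac: "jacobian (\<lambda>y. h i (block own i y)) (at y) *v d = H d"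
    using h frechet_derivative_at[OF h] has_derivative_linear[OF h]
    by (simp add: jacobian_def matrix_works)
  have "marginal_grad own h i g y z \<bullet> d = D (d, 0) + D (0, H d)"
    unfolding marginal_grad_def inner_add_left grad_inner[OF 1] transpose_matrix_vector
      dot_lmul_matrix jac grad_inner[OF 2] ..
  also have "\<dots> = D (d, H d)" by (simp add: linear_add[OF lin, symmetric])
  finally show ?thesis .
qed

text \<open>One-sided on purpose: in the applications \<open>x + s *\<^sub>R (z - x)\<close> is
  known to stay in the convex set only for s in [0, 1].\<close>

lemma has_derivative_directional:
  fixes G :: "'a::real_normed_vector \<Rightarrow> real"
  assumes "(G has_derivative G') (at x)"
  shows "((\<lambda>s. (G (x + s *\<^sub>R d) - G x) / s) \<longlongrightarrow> G' d) (at_right 0)"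
proof -
  have "((\<lambda>s. x + s *\<^sub>R d) has_derivative (\<lambda>s. s *\<^sub>R d)) (at (0::real))"
    by (auto intro!: derivative_eq_intros)
  from has_derivative_compose[OF this, of G G'] assms
  have "((\<lambda>s. G (x + s *\<^sub>R d)) has_derivative (\<lambda>s. G' (s *\<^sub>R d))) (at 0)" by simp
  moreover have "G' (s *\<^sub>R d) = G' d * s" for s
    using linear_scale[OF has_derivative_linear[OF assms]] by simp
  ultimately have "((\<lambda>s. G (x + s *\<^sub>R d)) has_field_derivative G' d) (at 0)"
    by (simp add: has_field_derivative_def)
  then have "((\<lambda>s. (G (x + s *\<^sub>R d) - G x) / s) \<longlongrightarrow> G' d) (at 0)"
    by (simp add: has_field_derivative_iff)
  then show ?thesis by (rule tendsto_within_subset) simp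
qed

lemma convex_on_ge_tangent:
  fixes G :: "'a::real_normed_vector \<Rightarrow> real"
  assumes G: "(G has_derivative G') (at x)" and conv: "convex_on S G" and x: "x \<in> S" and z: "z \<in> S"
  shows "G' (z - x) \<le> G z - G x"
proof (rule tendsto_upperbound[OF has_derivative_directional[OF G]])
  show "\<forall>\<^sub>F s in at_right 0. (G (x + s *\<^sub>R (z - x)) - G x) / s \<le> G z - G x"
    unfolding eventually_at_right[OF zero_less_one]
  proof (intro exI[of _ 1] conjI allI impI)
    fix s :: real assume s: "0 < s" "s < 1"
    have "G ((1 - s) *\<^sub>R x + s *\<^sub>R z) \<le> (1 - s) * G x + s * G z"
      using conv x z s by (intro convex_onD) auto
    then have "G (x + s *\<^sub>R (z - x)) - G x \<le> s * (G z - G x)" by (simp add: algebra_simps)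
    then show "(G (x + s *\<^sub>R (z - x)) - G x) / s \<le> G z - G x"
      using s by (simp add: divide_le_eq mult.commute)
  qed simp
qed simp

text \<open>Only the smooth part \<open>G\<close> is differentiated. For \<open>\<rho>\<close>,
  convexity already bounds the difference quotient by \<open>\<rho> z - \<rho> x\<close>.\<close>

lemma composite_minimum_imp_vi:
  fixes G :: "'a::real_normed_vector \<Rightarrow> real"
  assumes G: "(G has_derivative G') (at x)" and \<rho>: "convex_on S \<rho>" and S: "convex S"
    and x: "x \<in> S" and z: "z \<in> S" and min: "\<And>y. y \<in> S \<Longrightarrow> G x + \<rho> x \<le> G y + \<rho> y"
  shows "0 \<le> G' (z - x) + \<rho> z - \<rho> x"
proof -
  have "\<rho> x - \<rho> z \<le> G' (z - x)"
  proof (rule tendsto_lowerbound[OF has_derivative_directional[OF G]])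
    show "\<forall>\<^sub>F s in at_right 0. \<rho> x - \<rho> z \<le> (G (x + s *\<^sub>R (z - x)) - G x) / s"
      unfolding eventually_at_right[OF zero_less_one]
    proof (intro exI[of _ 1] conjI allI impI)
      fix s :: real assume s: "0 < s" "s < 1"
      have y: "(1 - s) *\<^sub>R x + s *\<^sub>R z \<in> S" using S x z s by (intro convexD) auto
      have eq: "x + s *\<^sub>R (z - x) = (1 - s) *\<^sub>R x + s *\<^sub>R z" by (simp add: algebra_simps)
      have "\<rho> ((1 - s) *\<^sub>R x + s *\<^sub>R z) \<le> (1 - s) * \<rho> x + s * \<rho> z"
        using \<rho> x z s by (intro convex_onD) auto
      with min[OF y] have "s * (\<rho> x - \<rho> z) \<le> G (x + s *\<^sub>R (z - x)) - G x"
        unfolding eq by (simp add: algebra_simps)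
      then show "\<rho> x - \<rho> z \<le> (G (x + s *\<^sub>R (z - x)) - G x) / s"
        using s by (simp add: le_divide_eq mult.commute)
    qed simp
  qed simp
  then show ?thesis by simp
qed

section \<open>The game as a variational inequality\<close>

text \<open>The deterministic data of the game. Nonemptiness of the joint domain is supplied later
  by the initial point of the run.\<close>

locale aggregative_game =
  fixes own :: "'c::finite \<Rightarrow> 'p::finite"
    and h :: "'p \<Rightarrow> real^'c \<Rightarrow> real^'c"
    and f :: "'p \<Rightarrow> real^'c \<Rightarrow> real^'c \<Rightarrow> real"
    and r :: "'p \<Rightarrow> real^'c \<Rightarrow> ereal"
    and L :: real
  assumes h_C1: "\<And>i. continuously_differentiable_on (block_space own i) (\<lambda>y. h i (block own i y))"
    and r_proper: "\<And>i y. y \<in> block_space own i \<Longrightarrow> r i y \<noteq> -\<infinity>"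
    and r_convex: "\<And>i. ereal_convex_on (block_space own i) (r i)"
    and r_lsc: "\<And>i. lower_semicontinuous_on (block_space own i) (r i)"
    and X_compact: "\<And>i. compact (eff_dom own r i)"
    and joint_nonempty: "joint_dom own r \<noteq> {}"
    and cost_convex: "\<And>i y. (\<And>j. j \<noteq> i \<Longrightarrow> block own j y \<in> eff_dom own r j) \<Longrightarrow>
          convex_on (eff_dom own r i) (\<lambda>xi. f i xi (h i xi + others_aggregate own h i y))"
    and f_C1: "\<And>i. \<exists>U. eff_dom own r i \<times> UNIV \<subseteq> U \<and>
          continuously_differentiable_on U (\<lambda>(y, s). f i (block own i y) s)"
    and phi_lipschitz: "L-lipschitz_on (joint_dom own r) (pseudo_grad own h f)"
    and phi_monotone: "\<And>y y'. y \<in> joint_dom own r \<Longrightarrow> y' \<in> joint_dom own r \<Longrightarrow>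
          (pseudo_grad own h f y - pseudo_grad own h f y') \<bullet> (y - y') \<ge> 0"
begin

abbreviation X :: "'p \<Rightarrow> (real^'c) set" where "X \<equiv> eff_dom own r"
abbreviation XX :: "(real^'c) set" where "XX \<equiv> joint_dom own r"
abbreviation F :: "'p \<Rightarrow> real^'c \<Rightarrow> real^'c \<Rightarrow> real^'c" where "F i \<equiv> marginal_grad own h i (f i)"
abbreviation \<phi> :: "real^'c \<Rightarrow> real^'c" where "\<phi> \<equiv> pseudo_grad own h f"
abbreviation \<sigma> :: "real^'c \<Rightarrow> real^'c" where "\<sigma> \<equiv> aggregate own h"
abbreviation B :: "'p \<Rightarrow> real^'c \<Rightarrow> real^'c" where "B \<equiv> block own"

text \<open>Meaningful on \<open>X i\<close> only: outside it \<open>r i\<close> is infinite and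
  \<open>real_of_ereal\<close> returns 0.\<close>

definition \<rho> :: "'p \<Rightarrow> real^'c \<Rightarrow> real" where "\<rho> i y = real_of_ereal (r i y)"
definition R :: "real^'c \<Rightarrow> real" where "R y = (\<Sum>i\<in>UNIV. \<rho> i (B i y))"

lemma X_subset: "X i \<subseteq> block_space own i"
  by (auto simp: eff_dom_def)

lemma block_X: "y \<in> X i \<Longrightarrow> B i y = y"
  by (rule block_id) (rule subsetD[OF X_subset])

lemma block_in_X: "y \<in> XX \<Longrightarrow> B i y \<in> X i"
  by (simp add: joint_dom_def)

lemma r_eq: "y \<in> X i \<Longrightarrow> r i y = ereal (\<rho> i y)"
  using r_proper[of y i] by (cases "r i y") (auto simp: eff_dom_def \<rho>_def)

lemma r_outside: "y \<in> block_space own i \<Longrightarrow> y \<notin> X i \<Longrightarrow> r i y = \<infinity>"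
  by (auto simp: eff_dom_def)

lemma X_nonempty: "X i \<noteq> {}"
  using joint_nonempty block_in_X by blast

text \<open>Both parts come from one inequality: at a convex combination of two points of the domain
  \<open>r i\<close> is at most a finite number, so the combination lies in the domain too.\<close>

lemma X_convex: "convex (X i)" and \<rho>_convex: "convex_on (X i) (\<rho> i)"
proof -
  have *: "(1 - t) *\<^sub>R x + t *\<^sub>R y \<in> X i \<and>
      \<rho> i ((1 - t) *\<^sub>R x + t *\<^sub>R y) \<le> (1 - t) * \<rho> i x + t * \<rho> i y"
    if t: "0 < t" "t < 1" and x: "x \<in> X i" and y: "y \<in> X i" for t x y
  proof -
    let ?z = "(1 - t) *\<^sub>R x + t *\<^sub>R y"
    have xy: "x \<in> block_space own i" "y \<in> block_space own i" using x y X_subset by auto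
    have le: "r i ?z \<le> ereal (1 - t) * r i x + ereal t * r i y"
      using r_convex[of i] xy t by (simp add: ereal_convex_on_def)
    have z: "?z \<in> block_space own i"
      using r_convex[of i] xy t by (intro convexD) (auto simp: ereal_convex_on_def)
    have "r i ?z \<le> ereal ((1 - t) * \<rho> i x + t * \<rho> i y)"
      using le r_eq[OF x] r_eq[OF y] by simp
    then show ?thesis
      using z r_eq[of ?z i] r_outside[OF z] by (cases "?z \<in> X i") auto
  qed
  show X: "convex (X i)"
    unfolding convex_alt
  proof (intro ballI allI impI)
    fix x y and u :: real assume a: "x \<in> X i" "y \<in> X i" "0 \<le> u \<and> u \<le> 1"
    then consider "u = 0" | "u = 1" | "0 < u" "u < 1" by fastforce
    then show "(1 - u) *\<^sub>R x + u *\<^sub>R y \<in> X i"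
      by cases (use a *[of u x y] in auto)
  qed
  show "convex_on (X i) (\<rho> i)"
    by (rule convex_onI[OF _ X]) (use * in blast)
qed

lemma \<rho>_lsc: "lsc_on (X i) (\<rho> i)"
  unfolding lsc_on_def
proof (intro ballI allI impI)
  fix x and e :: real assume x: "x \<in> X i" and e: "0 < e"
  have "ereal (\<rho> i x - e) < r i x" using e by (simp add: r_eq[OF x])
  also have "\<dots> \<le> Liminf (at x within block_space own i) (r i)"
    using r_lsc[of i] x X_subset by (auto simp: lower_semicontinuous_on_def)
  finally have "\<forall>\<^sub>F y in at x within block_space own i. ereal (\<rho> i x - e) < r i y"
    by (rule less_LiminfD)
  then have "\<forall>\<^sub>F y in at x within X i. ereal (\<rho> i x - e) < r i y"
    using at_le[OF X_subset, of x i] by (rule filter_leD[rotated])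
  moreover have "\<forall>\<^sub>F y in at x within X i. y \<in> X i" by (simp add: eventually_at_filter)
  ultimately show "\<forall>\<^sub>F y in at x within X i. \<rho> i x - e < \<rho> i y"
    by eventually_elim (simp add: r_eq)
qed

lemma XX_convex: "convex XX"
  unfolding convex_alt
proof (intro ballI allI impI)
  fix x y and u :: real assume a: "x \<in> XX" "y \<in> XX" "0 \<le> u \<and> u \<le> 1"
  then show "(1 - u) *\<^sub>R x + u *\<^sub>R y \<in> XX"
    using X_convex unfolding convex_alt by (simp add: joint_dom_def block_add block_scaleR)
qed

lemma XX_compact: "compact XX"
proof -
  have "closed XX"
  proof -
    have "XX = (\<Inter>i. B i -` X i)" by (auto simp: joint_dom_def)
    moreover have "closed (B i -` X i)" for i
      by (rule closed_vimage[OF compact_imp_closed[OF X_compact]]) (intro continuous_intros)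
    ultimately show ?thesis by auto
  qed
  moreover have "bounded XX"
  proof -
    have "\<exists>b. \<forall>y\<in>X i. norm y \<le> b" for i
      using compact_imp_bounded[OF X_compact] by (simp add: bounded_iff)
    then obtain b where b: "\<And>i y. y \<in> X i \<Longrightarrow> norm y \<le> b i" by metis
    have "norm y \<le> (\<Sum>i\<in>UNIV. b i)" if "y \<in> XX" for y
    proof -
      have "norm y = norm (\<Sum>i\<in>UNIV. B i y)" by (simp add: sum_block)
      also have "\<dots> \<le> (\<Sum>i\<in>UNIV. norm (B i y))" by (rule norm_sum)
      also have "\<dots> \<le> (\<Sum>i\<in>UNIV. b i)" by (intro sum_mono b block_in_X that)
      finally show ?thesis .
    qed
    then show ?thesis by (auto simp: bounded_iff)
  qed
  ultimately show ?thesis by (simp add: compact_eq_bounded_closed)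
qed

lemma R_convex: "convex_on XX R"
proof (rule convex_onI[OF _ XX_convex])
  fix t x y assume t: "0 < t" "t < (1::real)" and xy: "x \<in> XX" "y \<in> XX"
  have "R ((1 - t) *\<^sub>R x + t *\<^sub>R y) \<le> (\<Sum>i\<in>UNIV. (1 - t) * \<rho> i (B i x) + t * \<rho> i (B i y))"
    unfolding R_def block_add block_scaleR
    using t by (intro sum_mono convex_onD[OF \<rho>_convex] block_in_X xy) auto
  then show "R ((1 - t) *\<^sub>R x + t *\<^sub>R y) \<le> (1 - t) * R x + t * R y"
    by (simp add: R_def sum.distrib sum_distrib_left)
qed

lemma R_lsc: "lsc_on XX R"
  unfolding R_def[abs_def]
proof (rule lsc_on_sum)
  fix i
  have "continuous_on XX (B i)" by (intro continuous_intros)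
  then show "lsc_on XX (\<lambda>y. \<rho> i (B i y))"
    by (rule lsc_on_compose[where g = "\<rho> i" and f = "B i", OF \<rho>_lsc]) (auto simp: block_in_X)
qed

text \<open>The unilateral deviation of player \<open>i\<close> from \<open>y\<close> to
  \<open>w\<close>.\<close>

definition deviate :: "'p \<Rightarrow> real^'c \<Rightarrow> real^'c \<Rightarrow> real^'c" where
  "deviate i y w = y + (w - B i y)"

lemma block_deviate:
  assumes "w \<in> X i"
  shows "B j (deviate i y w) = (if j = i then w else B j y)"
proof -
  have "B j w = (if j = i then w else 0)"
    using block_block[of own j i w] block_X[OF assms] by (cases "j = i") simp_all
  then show ?thesis
    unfolding deviate_def block_add block_diff block_block by simp
qed

lemma deviate_in_XX: "y \<in> XX \<Longrightarrow> w \<in> X i \<Longrightarrow> deviate i y w \<in> XX"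
  unfolding joint_dom_def mem_Collect_eq block_deviate by simp

text \<open>\<open>R\<close> is separable and the joint domain is a product. Unilateral deviations
  as test points give the inequalities of the single players, and these add up to the joint
  one.\<close>

lemma vi_solution_iff_blocks:
  "vi_solution XX R A y \<longleftrightarrow>
    y \<in> XX \<and> (\<forall>i. \<forall>w\<in>X i. A y \<bullet> (w - B i y) + \<rho> i w - \<rho> i (B i y) \<ge> 0)"
proof (intro iffI conjI allI ballI)
  fix i w assume vi: "vi_solution XX R A y" and w: "w \<in> X i"
  then have y: "y \<in> XX" by (simp add: vi_solution_def)
  have "R (deviate i y w) - R y = (\<Sum>j\<in>UNIV. if j = i then \<rho> i w - \<rho> i (B i y) else 0)"
    unfolding R_def sum_subtractf[symmetric] by (rule sum.cong) (auto simp: block_deviate[OF w])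
  also have "\<dots> = \<rho> i w - \<rho> i (B i y)" by simp
  finally show "A y \<bullet> (w - B i y) + \<rho> i w - \<rho> i (B i y) \<ge> 0"
    using vi deviate_in_XX[OF y w] by (auto simp: vi_solution_def deviate_def)
next
  assume a: "y \<in> XX \<and> (\<forall>i. \<forall>w\<in>X i. A y \<bullet> (w - B i y) + \<rho> i w - \<rho> i (B i y) \<ge> 0)"
  have "A y \<bullet> (z - y) + R z - R y \<ge> 0" if z: "z \<in> XX" for z
  proof -
    have "A y \<bullet> (z - y) = (\<Sum>i\<in>UNIV. A y \<bullet> (B i z - B i y))"
      using inner_sum_blocks[of "A y" "z - y" own] by (simp add: block_diff)
    then have "A y \<bullet> (z - y) + R z - R y
        = (\<Sum>i\<in>UNIV. A y \<bullet> (B i z - B i y) + \<rho> i (B i z) - \<rho> i (B i y))"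
      by (simp add: R_def sum.distrib sum_subtractf)
    also have "\<dots> \<ge> 0" using a block_in_X[OF z] by (intro sum_nonneg) auto
    finally show ?thesis .
  qed
  with a show "vi_solution XX R A y" by (simp add: vi_solution_def)
qed (auto simp: vi_solution_def)

lemma \<phi>_inner:
  assumes "d \<in> block_space own i"
  shows "\<phi> x \<bullet> d = F i (B i x) (\<sigma> x) \<bullet> d"
  unfolding inner_vec_def
proof (rule sum.cong[OF refl])
  fix c
  show "\<phi> x $ c \<bullet> d $ c = F i (B i x) (\<sigma> x) $ c \<bullet> d $ c"
    using assms by (cases "own c = i") (auto simp: pseudo_grad_def block_space_def)
qed

lemma h_derivative:
  "\<exists>H. (\<forall>y\<in>block_space own i. ((\<lambda>y. h i (B i y)) has_derivative blinfun_apply (H y)) (at y)) \<and>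
    continuous_on (block_space own i) H"
  using h_C1[of i] by (simp add: continuously_differentiable_on_def)

lemma f_derivative:
  "\<exists>D. (\<forall>y\<in>X i. \<forall>s. ((\<lambda>(y, s). f i (B i y) s) has_derivative blinfun_apply (D (y, s))) (at (y, s))) \<and>
    continuous_on (X i \<times> UNIV) D"
proof -
  from f_C1[of i] obtain U where U: "X i \<times> UNIV \<subseteq> U"
    "continuously_differentiable_on U (\<lambda>(y, s). f i (B i y) s)" by blast
  from U(2) obtain D where D: "\<forall>p\<in>U. ((\<lambda>(y, s). f i (B i y) s) has_derivative blinfun_apply (D p)) (at p)"
    "continuous_on U D"
    unfolding continuously_differentiable_on_def by blast
  have "((\<lambda>(y, s). f i (B i y) s) has_derivative blinfun_apply (D (y, s))) (at (y, s))"
    if "y \<in> X i" for y s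
  proof -
    have "(y, s) \<in> U" using U(1) that by blast
    then show ?thesis by (rule D(1)[rule_format])
  qed
  then show ?thesis using continuous_on_subset[OF D(2) U(1)] by (intro exI[of _ D]) simp
qed

lemma F_inner:
  assumes y: "y \<in> X i"
    and f: "((\<lambda>(y, s). f i (B i y) s) has_derivative D) (at (y, s))"
    and h: "((\<lambda>y. h i (B i y)) has_derivative H) (at y)"
  shows "F i y s \<bullet> d = D (d, H d)"
  by (rule marginal_grad_inner[where own = own and i = i and g = "f i" and h = h,
        OF subsetD[OF X_subset y] f h])

lemma h_continuous: "continuous_on (X i) (h i)"
proof -
  obtain H where H_all: "\<forall>y\<in>block_space own i.
      ((\<lambda>y. h i (B i y)) has_derivative blinfun_apply (H y)) (at y)"
    and Hc: "continuous_on (block_space own i) H"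
    using h_derivative[of i] by (elim exE conjE)
  note H = H_all[rule_format]
  have "continuous_on (X i) (\<lambda>y. h i (B i y))"
  proof (rule has_derivative_continuous_on)
    fix y assume "y \<in> X i"
    then show "((\<lambda>y. h i (B i y)) has_derivative blinfun_apply (H y)) (at y within X i)"
      using H X_subset by (blast intro: has_derivative_at_withinI)
  qed
  then show ?thesis by (rule continuous_on_eq) (simp add: block_X)
qed

text \<open>The inner product of \<open>F\<close> with a fixed \<open>b\<close> is
  \<open>D (b, H b)\<close>, and both derivatives depend continuously on the point. Boundedness and
  measurability of \<open>F\<close> along a run rest on this.\<close>

lemma F_continuous: "continuous_on (X i \<times> UNIV) (\<lambda>(y, s). F i y s)"
proof -
  obtain H where H_all: "\<forall>y\<in>block_space own i.
      ((\<lambda>y. h i (B i y)) has_derivative blinfun_apply (H y)) (at y)"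
    and Hc: "continuous_on (block_space own i) H"
    using h_derivative[of i] by (elim exE conjE)
  note H = H_all[rule_format]
  obtain D where D_all: "\<forall>y\<in>X i. \<forall>s.
      ((\<lambda>(y, s). f i (B i y) s) has_derivative blinfun_apply (D (y, s))) (at (y, s))"
    and Dc: "continuous_on (X i \<times> UNIV) D"
    using f_derivative[of i] by (elim exE conjE)
  note D = D_all[rule_format]
  have "continuous_on (X i \<times> UNIV) (\<lambda>p. F i (fst p) (snd p) \<bullet> b)" for b
  proof (rule continuous_on_eq)
    have "continuous_on (X i \<times> UNIV) (\<lambda>p :: (real^'c) \<times> (real^'c). H (fst p))"
      by (rule continuous_on_compose2[OF Hc]) (use X_subset in \<open>auto intro!: continuous_intros\<close>)
    then show "continuous_on (X i \<times> UNIV) (\<lambda>p. blinfun_apply (D p) (b, blinfun_apply (H (fst p)) b))"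
      by (intro continuous_intros Dc)
    fix p assume "p \<in> X i \<times> (UNIV :: (real^'c) set)"
    then obtain y s where p: "p = (y, s)" "y \<in> X i" by auto
    then show "blinfun_apply (D p) (b, blinfun_apply (H (fst p)) b) = F i (fst p) (snd p) \<bullet> b"
      using F_inner[OF p(2) D[OF p(2), of s] H[OF subsetD[OF X_subset p(2)]], of b] by simp
  qed
  then show ?thesis
    unfolding case_prod_unfold by (intro continuous_on_componentwise[THEN iffD2]) auto
qed

lemma F_bounded: "\<exists>C. \<forall>y\<in>X i. \<forall>s. norm s \<le> b \<longrightarrow> norm (F i y s) \<le> C"
proof -
  have "compact ((\<lambda>(y, s). F i y s) ` (X i \<times> cball 0 b))"
    by (intro compact_continuous_image continuous_on_subset[OF F_continuous] compact_Times X_compact) auto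
  then have "bounded ((\<lambda>(y, s). F i y s) ` (X i \<times> cball 0 b))" by (rule compact_imp_bounded)
  then obtain C where "\<forall>z\<in>(\<lambda>(y, s). F i y s) ` (X i \<times> cball 0 b). norm z \<le> C"
    unfolding bounded_iff by (elim exE)
  then show ?thesis by (intro exI[of _ C]) auto
qed

text \<open>The aggregate \<open>s\<close> of the others is frozen while the player's own
  contribution moves, which is what the Jacobian term of \<open>F\<close> accounts for.\<close>

lemma cost_derivative:
  assumes y: "y \<in> X i"
  shows "((\<lambda>y. f i (B i y) (h i (B i y) + s)) has_derivative
     (\<lambda>d. F i y (h i y + s) \<bullet> d)) (at y)"
proof -
  obtain H where H_all: "\<forall>y\<in>block_space own i.
      ((\<lambda>y. h i (B i y)) has_derivative blinfun_apply (H y)) (at y)"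
    and Hc: "continuous_on (block_space own i) H"
    using h_derivative[of i] by (elim exE conjE)
  note H = H_all[rule_format]
  obtain D where D_all: "\<forall>y\<in>X i. \<forall>s.
      ((\<lambda>(y, s). f i (B i y) s) has_derivative blinfun_apply (D (y, s))) (at (y, s))"
    and Dc: "continuous_on (X i \<times> UNIV) D"
    using f_derivative[of i] by (elim exE conjE)
  note D = D_all[rule_format]
  have yb: "y \<in> block_space own i" using y X_subset by blast
  have "((\<lambda>y. (y, h i (B i y) + s)) has_derivative (\<lambda>d. (d, blinfun_apply (H y) d))) (at y)"
    by (auto intro!: derivative_eq_intros H yb)
  from has_derivative_compose[OF this, of "\<lambda>(y, s). f i (B i y) s" "blinfun_apply (D (y, h i y + s))"]
  show ?thesis
    using D[OF y, of "h i y + s"] F_inner[OF y D[OF y, of "h i y + s"] H[OF yb]]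
    by (simp add: block_X[OF y])
qed

lemma aggregate_split: "\<sigma> x = h i (B i x) + others_aggregate own h i x"
  unfolding aggregate_def others_aggregate_def by (simp add: sum.remove[of UNIV i])

text \<open>Optimality of each player implies its block inequality by one-sided differentiation.
  Conversely, convexity of the player's cost turns that inequality into global optimality through
  the tangent bound.\<close>

lemma nash_iff_vi: "y \<in> nash_equilibria own h f r \<longleftrightarrow> vi_solution XX R \<phi> y"
proof
  assume nash: "y \<in> nash_equilibria own h f r"
  have min: "ereal (f i (B i y) (h i (B i y) + others_aggregate own h i y)) + r i (B i y)
      \<le> ereal (f i w (h i w + others_aggregate own h i y)) + r i w" if "w \<in> block_space own i" for i w
    using nash that unfolding nash_equilibria_def is_arg_min_linorder by blast
  \<comment> \<open>An infinite cost would be beaten by any point of the nonempty domain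
    \<open>X i\<close>.\<close>
  have BX: "B i y \<in> X i" for i
  proof (rule ccontr)
    assume "B i y \<notin> X i"
    then have "r i (B i y) = \<infinity>" using r_outside by simp
    moreover obtain w where "w \<in> X i" using X_nonempty by blast
    ultimately show False using min[of w i] X_subset r_eq[of w i] by auto
  qed
  then have y: "y \<in> XX" by (simp add: joint_dom_def)
  have "\<phi> y \<bullet> (w - B i y) + \<rho> i w - \<rho> i (B i y) \<ge> 0" if w: "w \<in> X i" for i w
  proof -
    let ?s = "others_aggregate own h i y"
    have le: "f i (B i (B i y)) (h i (B i (B i y)) + ?s) + \<rho> i (B i y)
        \<le> f i (B i u) (h i (B i u) + ?s) + \<rho> i u" if u: "u \<in> X i" for u
      using min[of u i] u X_subset r_eq[OF u] r_eq[OF BX] by (auto simp: block_X[OF u] block_X[OF BX])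
    have "0 \<le> F i (B i y) (h i (B i y) + ?s) \<bullet> (w - B i y) + \<rho> i w - \<rho> i (B i y)"
      by (rule composite_minimum_imp_vi[OF cost_derivative[OF BX] \<rho>_convex X_convex BX w le])
    then show ?thesis
      using \<phi>_inner[of "w - B i y" i y] block_space_diff[OF subsetD[OF X_subset w], of "B i y"]
      by (simp add: aggregate_split[of y i])
  qed
  then show "vi_solution XX R \<phi> y" using y by (simp add: vi_solution_iff_blocks)
next
  assume vi: "vi_solution XX R \<phi> y"
  then have y: "y \<in> XX" by (simp add: vi_solution_def)
  show "y \<in> nash_equilibria own h f r"
    unfolding nash_equilibria_def is_arg_min_linorder
  proof (intro CollectI allI conjI impI)
    fix i w assume wb: "w \<in> block_space own i"
    let ?s = "others_aggregate own h i y"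
    let ?G = "\<lambda>u. f i (B i u) (h i (B i u) + ?s)"
    have BX: "B i y \<in> X i" by (rule block_in_X[OF y])
    show "ereal (f i (B i y) (h i (B i y) + ?s)) + r i (B i y) \<le> ereal (f i w (h i w + ?s)) + r i w"
    proof (cases "w \<in> X i")
      case True
      have "convex_on (X i) (\<lambda>u. f i u (h i u + ?s))"
        using y by (intro cost_convex block_in_X)
      \<comment> \<open>The differentiable extension through \<open>B i\<close> agrees with the cost
        on \<open>X i\<close>, and convexity combines points of \<open>X i\<close> only.\<close>
      then have conv: "convex_on (X i) ?G"
        unfolding convex_on_def using block_X convexD[OF X_convex] by simp
      have "F i (B i y) (h i (B i y) + ?s) \<bullet> (w - B i y) \<le> ?G w - ?G (B i y)"
        by (rule convex_on_ge_tangent[OF cost_derivative[OF BX] conv BX True])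
      moreover have "\<phi> y \<bullet> (w - B i y) + \<rho> i w - \<rho> i (B i y) \<ge> 0"
        using vi True by (simp add: vi_solution_iff_blocks)
      moreover have "\<phi> y \<bullet> (w - B i y) = F i (B i y) (h i (B i y) + ?s) \<bullet> (w - B i y)"
        using \<phi>_inner[of "w - B i y" i y] wb by (simp add: aggregate_split[of y i] block_space_diff)
      ultimately show ?thesis
        by (simp add: r_eq[OF True] r_eq[OF BX] block_X[OF True] block_X[OF BX])
    next
      case False
      then show ?thesis using r_outside[OF wb] by simp
    qed
  qed simp
qed

text \<open>\<open>prox\<close> is a choice among minimizers over the whole block space, so it means
  something only once a minimizer exists; \<open>p0\<close>, found inside the compact domain, is one
  because \<open>r i\<close> is infinite elsewhere.\<close>

lemma prox_is_prox_point:
  assumes t: "t > 0"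
  shows "prox_point (X i) (\<rho> i) t u (prox (block_space own i) t (r i) u)"
proof -
  let ?q = "\<lambda>y. 1 / (2 * t) * (norm (y - u))\<^sup>2"
  let ?v = "\<lambda>y. r i y + ereal (?q y)"
  let ?p = "prox (block_space own i) t (r i) u"
  have "lsc_on (X i) (\<lambda>y. \<rho> i y + ?q y)"
    by (intro lsc_on_add \<rho>_lsc continuous_imp_lsc_on continuous_intros)
  from lsc_attains_inf[OF X_compact X_nonempty this] obtain p0 where
    p0: "p0 \<in> X i" "\<forall>y\<in>X i. \<rho> i p0 + ?q p0 \<le> \<rho> i y + ?q y" by blast
  have "is_arg_min ?v (\<lambda>y. y \<in> block_space own i) p0"
    unfolding is_arg_min_linorder
  proof (intro conjI allI impI)
    fix y assume "y \<in> block_space own i"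
    then show "?v p0 \<le> ?v y"
      using p0 r_eq[of _ i] r_outside[of y i] by (cases "y \<in> X i") auto
  qed (use p0 X_subset in auto)
  then have "is_arg_min ?v (\<lambda>y. y \<in> block_space own i) (prox (block_space own i) t (r i) u)"
    unfolding prox_def arg_min_def by (rule someI)
  then have p: "?p \<in> block_space own i" and min: "\<And>y. y \<in> block_space own i \<Longrightarrow> ?v ?p \<le> ?v y"
    unfolding is_arg_min_linorder by blast+
  have "?p \<in> X i"
  proof (rule ccontr)
    assume "?p \<notin> X i"
    then show False using r_outside[OF p] min[of p0] p0(1) X_subset r_eq[OF p0(1)] by auto
  qed
  then show ?thesis
  proof (rule prox_pointI[OF X_convex \<rho>_convex t])
    fix z assume z: "z \<in> X i"
    then show "\<rho> i ?p + ?q ?p \<le> \<rho> i z + ?q z"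
      using min[of z] X_subset r_eq[OF \<open>?p \<in> X i\<close>] r_eq[OF z] by auto
  qed
qed

end

section \<open>Tikhonov regularization\<close>

lemma convergent_if_unique_subsequence_limit:
  fixes y :: "nat \<Rightarrow> 'a::metric_space"
  assumes S: "compact S" "\<And>n. y n \<in> S"
    and unique: "\<And>s z. strict_mono s \<Longrightarrow> (\<lambda>n. y (s n)) \<longlonglongrightarrow> z \<Longrightarrow> z = l"
  shows "y \<longlonglongrightarrow> l"
proof (rule ccontr)
  assume "\<not> y \<longlonglongrightarrow> l"
  then obtain e where e: "e > 0" "\<not> (\<forall>\<^sub>F n in sequentially. dist (y n) l < e)"
    by (auto simp: tendsto_iff)
  from not_eventually_sequentiallyD[OF e(2)] obtain s :: "nat \<Rightarrow> nat"
    where s: "strict_mono s" "\<And>n. \<not> dist (y (s n)) l < e" by auto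
  from S have "\<And>n. (y \<circ> s) n \<in> S" by simp
  with S(1) obtain z t where t: "strict_mono t" "((y \<circ> s) \<circ> t) \<longlonglongrightarrow> z"
    unfolding compact_def by metis
  have lim: "(\<lambda>n. y ((s \<circ> t) n)) \<longlonglongrightarrow> z" using t(2) by (simp add: o_def)
  have "z = l" by (rule unique[OF strict_mono_o[OF s(1) t(1)] lim])
  then have "\<forall>\<^sub>F n in sequentially. dist (y ((s \<circ> t) n)) l < e"
    using tendstoD[OF lim e(1)] by simp
  then show False using s(2) by (auto simp: eventually_sequentially)
qed

lemma pmin_le: "pmin a k \<le> a k i" and le_pmax: "a k i \<le> pmax a k"
  by (auto simp: pmin_def pmax_def)

lemma pmin_pos: "(\<And>i. 0 < a k i) \<Longrightarrow> 0 < pmin a k"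
  by (auto simp: pmin_def)

text \<open>The block-diagonal matrix with diagonal entries \<open>e i\<close>. For
  \<open>e = \<eta> k\<close> it is the Tikhonov term with a separate parameter for each
  player.\<close>

definition player_scale :: "('c \<Rightarrow> 'p) \<Rightarrow> ('p \<Rightarrow> real) \<Rightarrow> real^'c \<Rightarrow> real^'c::finite" where
  "player_scale own e y = (\<chi> c. e (own c) * y $ c)"

lemma block_player_scale: "block own i (player_scale own e y) = e i *\<^sub>R block own i y"
  by (auto simp: block_def player_scale_def vec_eq_iff)

lemma player_scale_diff: "player_scale own e (x - y) = player_scale own e x - player_scale own e y"
  by (simp add: player_scale_def vec_eq_iff algebra_simps)

lemma norm_player_scale_le:
  assumes "\<And>i. \<bar>e i\<bar> \<le> \<delta>"
  shows "norm (player_scale own e y) \<le> \<delta> * norm y"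
proof -
  \<comment> \<open>\<open>undefined\<close> stands for an arbitrary player; there is at least
    one.\<close>
  have \<delta>: "0 \<le> \<delta>" using assms[of undefined] by linarith
  have "norm (player_scale own e y) \<le> norm (\<delta> *\<^sub>R y)"
    by (rule norm_le_componentwise_cart)
      (simp add: player_scale_def abs_mult mult_right_mono assms \<delta>)
  then show ?thesis using \<delta> by simp
qed

lemma player_scale_inner_ge:
  assumes "\<And>i. \<mu> \<le> e i"
  shows "\<mu> * (norm y)\<^sup>2 \<le> player_scale own e y \<bullet> y"
  unfolding power2_norm_eq_inner inner_vec_def sum_distrib_left
proof (rule sum_mono)
  fix c
  have "\<mu> * (y $ c * y $ c) \<le> e (own c) * (y $ c * y $ c)"
    by (rule mult_right_mono[OF assms]) simp
  then show "\<mu> * (y $ c \<bullet> y $ c) \<le> player_scale own e y $ c \<bullet> y $ c"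
    by (simp add: player_scale_def mult.assoc)
qed

lemma tendsto_player_scale:
  assumes "\<And>i. (\<lambda>n. e n i) \<longlonglongrightarrow> e' i" "y \<longlonglongrightarrow> y'"
  shows "(\<lambda>n. player_scale own (e n) (y n)) \<longlonglongrightarrow> player_scale own e' y'"
  unfolding player_scale_def by (intro tendsto_intros assms)

context aggregative_game
begin

abbreviation (input) regularized_map :: "('p \<Rightarrow> real) \<Rightarrow> real^'c \<Rightarrow> real^'c" where
  "regularized_map e y \<equiv> \<phi> y + player_scale own e y"

text \<open>A function of the parameters only, hence the same on all sample paths.\<close>

definition regularized :: "('p \<Rightarrow> real) \<Rightarrow> real^'c" where
  "regularized e = (SOME y. vi_solution XX R (regularized_map e) y)"

lemma L_nonneg: "0 \<le> L"
  using phi_lipschitz by (rule lipschitz_on_nonneg)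

lemma \<phi>_lipschitz_norm: "x \<in> XX \<Longrightarrow> y \<in> XX \<Longrightarrow> norm (\<phi> x - \<phi> y) \<le> L * norm (x - y)"
  using lipschitz_onD[OF phi_lipschitz] by (simp add: dist_norm)

lemma regularized_vi:
  assumes e: "\<And>i. 0 < e i"
  shows "vi_solution XX R (regularized_map e) (regularized e)"
  unfolding regularized_def
proof (rule someI_ex)
  define \<mu> M where "\<mu> = Min (range e)" and "M = Max (range e)"
  have \<mu>: "0 < \<mu>" "\<And>i. \<mu> \<le> e i" "\<And>i. e i \<le> M" "\<mu> \<le> M"
    using e by (auto simp: \<mu>_def M_def)
  show "\<exists>y. vi_solution XX R (regularized_map e) y"
  proof (rule strongly_monotone_vi_solution_exists[OF XX_compact joint_nonempty XX_convex R_convex R_lsc])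
    fix x y assume xy: "x \<in> XX" "y \<in> XX"
    have eq: "regularized_map e x - regularized_map e y = (\<phi> x - \<phi> y) + player_scale own e (x - y)"
      by (simp add: player_scale_diff)
    have "norm (player_scale own e (x - y)) \<le> M * norm (x - y)"
      using \<mu> e by (intro norm_player_scale_le) (simp add: less_imp_le)
    then show "norm (regularized_map e x - regularized_map e y) \<le> (L + M) * norm (x - y)"
      unfolding eq using \<phi>_lipschitz_norm[OF xy] norm_triangle_ineq[of "\<phi> x - \<phi> y"]
      by (smt (verit) distrib_right)
    show "\<mu> * (norm (x - y))\<^sup>2 \<le> (regularized_map e x - regularized_map e y) \<bullet> (x - y)"
      unfolding eq inner_add_left
      using phi_monotone[OF xy] player_scale_inner_ge[of \<mu> e "x - y" own, OF \<mu>(2)] by linarith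
  qed (use \<mu> L_nonneg in auto)
qed

lemma regularized_in_XX: "(\<And>i. 0 < e i) \<Longrightarrow> regularized e \<in> XX"
  using regularized_vi by (simp add: vi_solution_def)

text \<open>Testing each inequality at the other solution cancels \<open>R\<close>, and monotonicity
  disposes of \<open>\<phi>\<close>. Two regularizations give the drift bound; \<open>A' = 0\<close>
  gives the selection of the limit.\<close>

lemma monotone_vi_comparison:
  assumes "vi_solution XX R (\<lambda>y. \<phi> y + A y) y" "vi_solution XX R (\<lambda>y. \<phi> y + A' y) y'"
  shows "(A y - A' y') \<bullet> (y - y') \<le> 0"
proof -
  have yy: "y \<in> XX" "y' \<in> XX" using assms by (simp_all add: vi_solution_def)
  have "(\<phi> y + A y) \<bullet> (y' - y) + R y' - R y \<ge> 0" "(\<phi> y' + A' y') \<bullet> (y - y') + R y - R y' \<ge> 0"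
    using assms yy by (simp_all add: vi_solution_def)
  moreover have "(\<phi> y - \<phi> y') \<bullet> (y - y') \<ge> 0" by (rule phi_monotone[OF yy])
  ultimately show ?thesis by (simp add: algebra_simps inner_simps)
qed

text \<open>Write e y - e' y' as e (y - y') + (e - e') y'. The first part is strongly monotone with
  modulus \<open>m\<close>; the second is at most \<open>\<delta> * b\<close> in norm.\<close>

lemma regularized_drift:
  assumes e: "\<And>i. 0 < e i" "\<And>i. 0 < e' i" and m: "0 < m" "\<And>i. m \<le> e i"
    and \<delta>: "\<And>i. \<bar>e i - e' i\<bar> \<le> \<delta>" and b: "\<And>y. y \<in> XX \<Longrightarrow> norm y \<le> b"
  shows "norm (regularized e - regularized e') \<le> b * (\<delta> / m)"
proof -
  let ?y = "regularized e" and ?y' = "regularized e'"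
  have "0 \<le> \<delta>" using \<delta>[of undefined] by linarith
  have eq: "player_scale own e ?y - player_scale own e' ?y' =
      player_scale own e (?y - ?y') + player_scale own (\<lambda>i. e i - e' i) ?y'"
    by (simp add: player_scale_def vec_eq_iff algebra_simps)
  have "player_scale own e (?y - ?y') \<bullet> (?y - ?y') + player_scale own (\<lambda>i. e i - e' i) ?y' \<bullet> (?y - ?y') \<le> 0"
    using monotone_vi_comparison[OF regularized_vi regularized_vi, of e e'] e
    unfolding eq inner_add_left by simp
  moreover have "m * (norm (?y - ?y'))\<^sup>2 \<le> player_scale own e (?y - ?y') \<bullet> (?y - ?y')"
    by (rule player_scale_inner_ge[OF m(2)])
  moreover have "\<bar>player_scale own (\<lambda>i. e i - e' i) ?y' \<bullet> (?y - ?y')\<bar> \<le> \<delta> * b * norm (?y - ?y')"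
  proof -
    have "norm (player_scale own (\<lambda>i. e i - e' i) ?y') \<le> \<delta> * norm ?y'"
      by (rule norm_player_scale_le[OF \<delta>])
    also have "\<dots> \<le> \<delta> * b"
      using b[OF regularized_in_XX[of e']] e \<open>0 \<le> \<delta>\<close> by (intro mult_left_mono) auto
    finally have "norm (player_scale own (\<lambda>i. e i - e' i) ?y') * norm (?y - ?y') \<le> \<delta> * b * norm (?y - ?y')"
      by (rule mult_right_mono) simp
    then show ?thesis using Cauchy_Schwarz_ineq2 order_trans by blast
  qed
  ultimately have "m * (norm (?y - ?y'))\<^sup>2 \<le> \<delta> * b * norm (?y - ?y')" by linarith
  then have le: "(m * norm (?y - ?y')) * norm (?y - ?y') \<le> (\<delta> * b) * norm (?y - ?y')"
    by (simp add: power2_eq_square mult.assoc)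
  have "m * norm (?y - ?y') \<le> \<delta> * b"
  proof (cases "norm (?y - ?y') = 0")
    case True
    have "0 \<le> b" using b[OF regularized_in_XX[of e]] e norm_ge_zero order_trans by blast
    then show ?thesis using True \<open>0 \<le> \<delta>\<close> by simp
  next
    case False
    then show ?thesis using mult_right_le_imp_le[OF le] by simp
  qed
  then show ?thesis using m(1) by (simp add: field_simps)
qed

lemma \<phi>_tendsto:
  assumes "y \<longlonglongrightarrow> l" "\<And>n. y n \<in> XX" "l \<in> XX"
  shows "(\<lambda>n. \<phi> (y n)) \<longlonglongrightarrow> \<phi> l"
  using continuous_on_tendsto_compose[OF lipschitz_on_continuous_on[OF phi_lipschitz] assms(1,3)] assms(2)
  by simp

lemma regularized_limit_is_vi_solution:
  assumes e: "\<And>n i. 0 < e n i" "\<And>i. (\<lambda>n. e n i) \<longlonglongrightarrow> 0"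
    and lim: "(\<lambda>n. regularized (e n)) \<longlonglongrightarrow> y"
  shows "vi_solution XX R \<phi> y"
proof -
  let ?y = "\<lambda>n. regularized (e n)"
  have inX: "?y n \<in> XX" for n by (rule regularized_in_XX[OF e(1)])
  have y: "y \<in> XX" by (rule closed_sequentially[OF compact_imp_closed[OF XX_compact] inX lim])
  \<comment> \<open>\<open>R\<close> is only lower semicontinuous, so \<open>R y\<close> stands
    alone on the smaller side; everything on the other side converges. Scaling by 0 is the limit of
    the regularization.\<close>
  have "R y \<le> (\<phi> y + player_scale own (\<lambda>_. 0) y) \<bullet> (z - y) + R z" if z: "z \<in> XX" for z
  proof (rule lsc_on_sequentially[OF R_lsc lim inX y])
    show "(\<lambda>n. (\<phi> (?y n) + player_scale own (e n) (?y n)) \<bullet> (z - ?y n) + R z) \<longlonglongrightarrow>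
        (\<phi> y + player_scale own (\<lambda>_. 0) y) \<bullet> (z - y) + R z"
      by (intro tendsto_intros \<phi>_tendsto tendsto_player_scale lim inX y e(2))
    show "R (?y n) \<le> (\<phi> (?y n) + player_scale own (e n) (?y n)) \<bullet> (z - ?y n) + R z" for n
      using regularized_vi[of "e n"] e(1) z by (simp add: vi_solution_def)
  qed
  then show ?thesis using y by (simp add: vi_solution_def player_scale_def zero_vec_def[symmetric])
qed

text \<open>Comparison with an unregularized solution leaves only the Tikhonov term, which tends to
  0. Dividing it by \<open>pmin e n\<close> keeps it visible in the limit, and the ratio condition
  sends all the weights to 1.\<close>

lemma regularized_limit_selects:
  assumes e: "\<And>n i. 0 < e n i" and ratio: "(\<lambda>n. pmax e n / pmin e n) \<longlonglongrightarrow> 1"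
    and lim: "(\<lambda>n. regularized (e n)) \<longlonglongrightarrow> y" and z: "vi_solution XX R \<phi> z"
  shows "0 \<le> y \<bullet> (z - y)"
proof -
  let ?y = "\<lambda>n. regularized (e n)"
  define w where "w n i = e n i / pmin e n" for n i
  have pos: "0 < pmin e n" for n using e by (rule pmin_pos)
  have w: "(\<lambda>n. w n i) \<longlonglongrightarrow> 1" for i
  proof (rule tendsto_sandwich[OF _ _ tendsto_const ratio])
    show "\<forall>\<^sub>F n in sequentially. 1 \<le> w n i"
      using pmin_le[of e _ i] pos by (simp add: w_def)
    show "\<forall>\<^sub>F n in sequentially. w n i \<le> pmax e n / pmin e n"
      using le_pmax[of e _ i] pos by (simp add: w_def divide_right_mono less_imp_le)
  qed
  have "0 \<le> player_scale own (w n) (?y n) \<bullet> (z - ?y n)" for n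
  proof -
    have "player_scale own (e n) (?y n) \<bullet> (?y n - z) \<le> 0"
      using monotone_vi_comparison[of "player_scale own (e n)" "?y n" "\<lambda>_. 0" z]
        regularized_vi[of "e n"] e z by simp
    moreover have "player_scale own (w n) (?y n) = (1 / pmin e n) *\<^sub>R player_scale own (e n) (?y n)"
      by (simp add: player_scale_def w_def vec_eq_iff)
    ultimately have "player_scale own (w n) (?y n) \<bullet> (?y n - z) \<le> 0"
      using pos[of n] by (simp add: divide_le_0_iff)
    then show ?thesis by (simp add: inner_diff_right)
  qed
  moreover have "(\<lambda>n. player_scale own (w n) (?y n) \<bullet> (z - ?y n)) \<longlonglongrightarrow>
      player_scale own (\<lambda>_. 1) y \<bullet> (z - y)"
    by (intro tendsto_intros tendsto_player_scale w lim)
  ultimately have "0 \<le> player_scale own (\<lambda>_. 1) y \<bullet> (z - y)"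
    by (intro tendsto_lowerbound[where F = sequentially]) auto
  then show ?thesis by (simp add: player_scale_def)
qed

text \<open>Each subsequential limit \<open>l\<close> satisfies the inequality characterizing the
  projection of 0 onto the equilibria. Two such points coincide, since their inequalities add up to
  \<open>(norm (z - l))\<^sup>2 \<le> 0\<close>.\<close>

lemma regularized_converges_to_least_norm:
  assumes e: "\<And>n i. 0 < e n i" "\<And>i. (\<lambda>n. e n i) \<longlonglongrightarrow> 0"
    and ratio: "(\<lambda>n. pmax e n / pmin e n) \<longlonglongrightarrow> 1"
  shows "\<exists>l. {y. is_arg_min norm (\<lambda>y. y \<in> nash_equilibria own h f r) y} = {l} \<and>
    (\<lambda>n. regularized (e n)) \<longlonglongrightarrow> l"
proof -
  let ?y = "\<lambda>n. regularized (e n)" and ?S = "nash_equilibria own h f r"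
  have inX: "?y n \<in> XX" for n by (rule regularized_in_XX[OF e(1)])
  have sub: "l \<in> ?S \<and> (\<forall>z\<in>?S. 0 \<le> l \<bullet> (z - l))"
    if s: "strict_mono s" "(\<lambda>n. ?y (s n)) \<longlonglongrightarrow> l" for s l
  proof (intro conjI ballI)
    show "l \<in> ?S"
      unfolding nash_iff_vi using s
      by (intro regularized_limit_is_vi_solution[of "\<lambda>n. e (s n)"] e(1) LIMSEQ_subseq_LIMSEQ[OF e(2), unfolded o_def])
    fix z assume "z \<in> ?S"
    then have z: "vi_solution XX R \<phi> z" by (simp add: nash_iff_vi)
    have "(\<lambda>n. pmax (\<lambda>n. e (s n)) n / pmin (\<lambda>n. e (s n)) n) \<longlonglongrightarrow> 1"
      using LIMSEQ_subseq_LIMSEQ[OF ratio s(1)] by (simp add: o_def pmax_def pmin_def)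
    from regularized_limit_selects[OF e(1) this s(2) z] show "0 \<le> l \<bullet> (z - l)" .
  qed
  obtain l s where s: "strict_mono s" "(?y \<circ> s) \<longlonglongrightarrow> l"
    using XX_compact inX unfolding compact_def by metis
  have l: "l \<in> ?S" "\<And>z. z \<in> ?S \<Longrightarrow> 0 \<le> l \<bullet> (z - l)"
    using sub[OF s(1)] s(2) by (auto simp: o_def)
  have "?y \<longlonglongrightarrow> l"
  proof (rule convergent_if_unique_subsequence_limit[OF XX_compact inX])
    fix t z assume "strict_mono t" "(\<lambda>n. ?y (t n)) \<longlonglongrightarrow> z"
    from sub[OF this] l have "0 \<le> z \<bullet> (l - z)" "0 \<le> l \<bullet> (z - l)" by auto
    then have "(z - l) \<bullet> (z - l) \<le> 0" by (simp add: algebra_simps inner_simps inner_commute)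
    then have "(norm (z - l))\<^sup>2 \<le> 0" by (simp add: power2_norm_eq_inner)
    then show "z = l" by simp
  qed
  moreover have "{y. is_arg_min norm (\<lambda>y. y \<in> ?S) y} = {l}"
  proof -
    have le: "(norm l)\<^sup>2 \<le> l \<bullet> z" if "z \<in> ?S" for z
      using l(2)[OF that] by (simp add: power2_norm_eq_inner inner_diff_right)
    have least: "norm l \<le> norm z" if "z \<in> ?S" for z
    proof (cases "norm l = 0")
      case False
      have "norm l * norm l \<le> norm l * norm z"
        using le[OF that] norm_cauchy_schwarz[of l z] by (simp add: power2_eq_square)
      then show ?thesis using False by (simp add: mult_le_cancel_left)
    qed simp
    have "y = l" if y: "y \<in> ?S" "norm y \<le> norm l" for y
    proof -
      have "(norm y)\<^sup>2 \<le> (norm l)\<^sup>2" using y(2) by (intro power_mono) auto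
      then have "(norm (y - l))\<^sup>2 \<le> 0"
        using le[OF y(1)] unfolding norm_diff_square inner_commute[of y l] by linarith
      then show ?thesis by simp
    qed
    then show ?thesis using l(1) least by (auto simp: is_arg_min_linorder)
  qed
  ultimately show ?thesis by blast
qed

end

section \<open>Tracking along a run\<close>

lemma power2_sum_le_card:
  fixes f :: "'a \<Rightarrow> real"
  shows "(\<Sum>i\<in>I. f i)\<^sup>2 \<le> real (card I) * (\<Sum>i\<in>I. (f i)\<^sup>2)"
  using Cauchy_Schwarz_ineq_sum[of "\<lambda>i. 1" f I] by simp

lemma power2_add_le:
  fixes a b :: real
  shows "(a + b)\<^sup>2 \<le> 2 * a\<^sup>2 + 2 * b\<^sup>2"
  using sum_squares_bound[of a b] by (simp add: power2_sum)

text \<open>The weight is free so that, with \<open>t\<close> proportional to the contraction rate,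
  replacing one reference point by the next costs only a fraction of the contraction.\<close>

lemma power2_norm_add_weighted:
  fixes a b :: "'a::real_inner"
  assumes t: "t > 0"
  shows "(norm (a + b))\<^sup>2 \<le> (1 + t) * (norm a)\<^sup>2 + (1 + 1 / t) * (norm b)\<^sup>2"
proof -
  have "0 \<le> (norm (t *\<^sub>R a - b))\<^sup>2" by simp
  also have "\<dots> = t\<^sup>2 * (norm a)\<^sup>2 - 2 * t * (a \<bullet> b) + (norm b)\<^sup>2"
    by (simp add: norm_diff_square power_mult_distrib)
  finally have "0 \<le> t * (t * (norm a)\<^sup>2 - 2 * (a \<bullet> b) + (1 / t) * (norm b)\<^sup>2)"
    using t by (simp add: power2_eq_square algebra_simps)
  then have "0 \<le> t * (norm a)\<^sup>2 - 2 * (a \<bullet> b) + (1 / t) * (norm b)\<^sup>2"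
    using t by (simp only: zero_le_mult_iff) linarith
  moreover have "(norm (a + b))\<^sup>2 = (norm a)\<^sup>2 + 2 * (a \<bullet> b) + (norm b)\<^sup>2"
    using norm_diff_square[of a "- b"] by simp
  ultimately show ?thesis by (simp add: algebra_simps)
qed

text \<open>A single sample path. The sampled gradient is written as \<open>F\<close> plus
  \<open>\<zeta>\<close>, and the last two assumptions are the outcomes of the two almost sure
  statements.\<close>

locale algorithm_run = aggregative_game own h f r L
  for own :: "'c::finite \<Rightarrow> 'p::finite"
    and h :: "'p \<Rightarrow> real^'c \<Rightarrow> real^'c"
    and f :: "'p \<Rightarrow> real^'c \<Rightarrow> real^'c \<Rightarrow> real"
    and r :: "'p \<Rightarrow> real^'c \<Rightarrow> ereal"
    and L :: real +
  fixes Lh :: "'p \<Rightarrow> real"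
    and E :: "nat \<Rightarrow> ('p \<times> 'p) set"
    and W :: "nat \<Rightarrow> real^'p^'p"
    and \<alpha> \<eta> :: "nat \<Rightarrow> 'p \<Rightarrow> real"
    and x :: "nat \<Rightarrow> real^'c"
    and v vh \<zeta> :: "nat \<Rightarrow> 'p \<Rightarrow> real^'c"
  assumes h_lipschitz: "\<And>i. (Lh i)-lipschitz_on (eff_dom own r i) (h i)"
    and F_lipschitz: "\<And>i cz. cz > 0 \<Longrightarrow> \<exists>Lf. \<forall>y\<in>eff_dom own r i. \<forall>z1 z2. norm z1 \<le> cz \<longrightarrow> norm z2 \<le> cz \<longrightarrow>
          norm (marginal_grad own h i (f i) y z1 - marginal_grad own h i (f i) y z2) \<le> Lf * norm (z1 - z2)"
    and self_loop: "\<And>k i. (i, i) \<in> E k"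
    and W_stochastic: "\<And>k. doubly_stochastic (W k)"
    and W_lower_bound: "\<exists>c. 0 < c \<and> c < 1 \<and> (\<forall>k i j. (j, i) \<in> E k \<longrightarrow> W k $ i $ j \<ge> c)"
    and E_connected: "\<exists>P::nat. P > 0 \<and> (\<forall>k. strongly_connected (\<Union>l\<in>{1..P}. E (k + l)))"
    and alpha_pos: "\<And>k i. \<alpha> k i > 0" and eta_pos: "\<And>k i. \<eta> k i > 0"
    and alpha_decreasing: "\<And>i. decseq (\<lambda>k. \<alpha> k i)" and eta_decreasing: "\<And>i. decseq (\<lambda>k. \<eta> k i)"
    and alpha_tendsto: "\<And>i. (\<lambda>k. \<alpha> k i) \<longlonglongrightarrow> 0" and eta_tendsto: "\<And>i. (\<lambda>k. \<eta> k i) \<longlonglongrightarrow> 0"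
    and rate2: "(\<lambda>k. (pmax \<alpha> k - pmin \<alpha> k) / (pmin \<alpha> k * pmin \<eta> k)) \<longlonglongrightarrow> 0"
    and rate3: "filterlim (\<lambda>n. \<Sum>k<n. pmin \<alpha> k * pmin \<eta> k) at_top sequentially"
    and rate4: "\<And>i. summable (\<lambda>k. (\<alpha> k i)\<^sup>2)"
    and rate5: "summable (\<lambda>k. (1 + 1 / (pmin \<alpha> (Suc k) * pmin \<eta> (Suc k))) *
          ((pmax \<eta> k - pmin \<eta> (Suc k))\<^sup>2 / (pmin \<eta> (Suc k))\<^sup>2))"
    and x_init: "x 0 \<in> joint_dom own r"
    and v_init: "\<And>i. v 0 i = h i (block own i (x 0))"
    and vh_step: "\<And>k i. vh k i = (\<Sum>j\<in>UNIV. (W k $ i $ j) *\<^sub>R v k j)"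
    and x_step: "\<And>k i. block own i (x (Suc k)) =
            prox (block_space own i) (\<alpha> k i) (r i)
              (block own i (x k) - \<alpha> k i *\<^sub>R
                 (marginal_grad own h i (f i) (block own i (x k)) (real CARD('p) *\<^sub>R vh k i) + \<zeta> k i
                  + \<eta> k i *\<^sub>R block own i (x k)))"
    and v_step: "\<And>k i. v (Suc k) i = vh k i + h i (block own i (x (Suc k))) - h i (block own i (x k))"
    and noise_square: "\<And>i. summable (\<lambda>k. (\<alpha> k i)\<^sup>2 * (norm (\<zeta> k i))\<^sup>2)"
    and noise_martingale: "\<And>i. summable (\<lambda>k. \<alpha> k i *
          ((block own i (x k) - block own i (aggregative_game.regularized own h f r (\<eta> k))) \<bullet> \<zeta> k i))"
begin

definition direction :: "nat \<Rightarrow> 'p \<Rightarrow> real^'c" where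
  "direction k i = F i (B i (x k)) (real CARD('p) *\<^sub>R vh k i) + \<zeta> k i + \<eta> k i *\<^sub>R B i (x k)"

lemma x_step_prox_point: "prox_point (X i) (\<rho> i) (\<alpha> k i) (B i (x k) - \<alpha> k i *\<^sub>R direction k i) (B i (x (Suc k)))"
  unfolding x_step[of i k] direction_def[symmetric] by (rule prox_is_prox_point[OF alpha_pos])

lemma x_in_XX: "x k \<in> XX"
proof (cases k)
  case (Suc l)
  then show ?thesis using x_step_prox_point by (simp add: joint_dom_def prox_point_def)
qed (simp add: x_init)

lemmas x_in_X = block_in_X[OF x_in_XX]

lemma XX_bound: obtains b where "0 < b" "\<And>y. y \<in> XX \<Longrightarrow> norm y \<le> b"
  using compact_imp_bounded[OF XX_compact] unfolding bounded_pos by blast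

text \<open>Unit column sums preserve the total in the averaging, and each correction of
  \<open>v\<close> adds exactly the change of the player's own contribution. So
  \<open>CARD('p)\<close> times the mean of the \<open>v k i\<close> is the true aggregate.\<close>

lemma sum_v: "(\<Sum>i\<in>UNIV. v k i) = \<sigma> (x k)"
proof (induction k)
  case 0
  then show ?case by (simp add: v_init aggregate_def)
next
  case (Suc k)
  have "(\<Sum>i\<in>UNIV. vh k i) = (\<Sum>j\<in>UNIV. (\<Sum>i\<in>UNIV. W k $ i $ j) *\<^sub>R v k j)"
    unfolding vh_step scaleR_sum_left by (rule sum.swap)
  also have "\<dots> = \<sigma> (x k)"
    using W_stochastic[of k] Suc by (simp add: doubly_stochastic_def)
  finally show ?case by (simp add: v_step sum.distrib sum_subtractf aggregate_def)
qed

lemma W_row_stochastic: "row_stochastic (W k)"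
  using W_stochastic[of k] by (simp add: doubly_stochastic_def row_stochastic_def)

definition displacement :: "nat \<Rightarrow> 'p \<Rightarrow> real" where "displacement k i = norm (B i (x (Suc k)) - B i (x k))"
text \<open>One number that bounds the input of every player in every coordinate, as the averaging
  lemma requires.\<close>

definition perturbation :: "nat \<Rightarrow> real" where "perturbation k = (\<Sum>i\<in>UNIV. Lh i * displacement k i)"
definition disagreement :: "nat \<Rightarrow> real" where "disagreement k = (\<Sum>c\<in>UNIV. spread (\<lambda>i. v k i $ c))"

lemma Lh_nonneg: "0 \<le> Lh i"
  by (rule lipschitz_on_nonneg[OF h_lipschitz])

lemma perturbation_nonneg: "0 \<le> perturbation k"
  by (simp add: perturbation_def displacement_def sum_nonneg Lh_nonneg)

lemma disagreement_nonneg: "0 \<le> disagreement k"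
  by (simp add: disagreement_def sum_nonneg spread_nonneg)

lemma h_increment: "\<bar>(h i (B i (x (Suc k))) - h i (B i (x k))) $ c\<bar> \<le> perturbation k"
proof -
  have "\<bar>(h i (B i (x (Suc k))) - h i (B i (x k))) $ c\<bar> \<le> norm (h i (B i (x (Suc k))) - h i (B i (x k)))"
    by (rule component_le_norm_cart)
  also have "\<dots> \<le> Lh i * displacement k i"
    using lipschitz_onD[OF h_lipschitz x_in_X x_in_X] by (simp add: displacement_def dist_norm)
  also have "\<dots> \<le> perturbation k"
    unfolding perturbation_def by (rule member_le_sum) (auto simp: displacement_def Lh_nonneg)
  finally show ?thesis .
qed

text \<open>Each coordinate of \<open>v\<close> is a scalar averaging process with the same weights,
  perturbed by the increments of \<open>h\<close>. Neither the lower bound on the weights nor the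
  connectivity window depends on time, so \<open>T\<close> and \<open>d\<close> are uniform in
  \<open>k\<close>.\<close>

lemma spread_contraction:
  obtains T d where "0 < T" "0 < d" "d \<le> 1"
    "\<And>k c. spread (\<lambda>i. v (k + T) i $ c) \<le> (1 - d) * spread (\<lambda>i. v k i $ c) + (\<Sum>l<T. 2 * perturbation (k + l))"
proof -
  obtain c0 where c0: "0 < c0" "c0 < 1" "\<And>k i j. (j, i) \<in> E k \<Longrightarrow> W k $ i $ j \<ge> c0"
    using W_lower_bound by auto
  obtain P :: nat where P: "\<And>k. strongly_connected (\<Union>l\<in>{1..P}. E (k + l))"
    using E_connected by auto
  define T where "T = CARD('p) * Suc P"
  have "spread (\<lambda>i. v (k + T) i $ c) \<le> (1 - c0 ^ T) * spread (\<lambda>i. v k i $ c) + (\<Sum>l<T. 2 * perturbation (k + l))" for k c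
  proof -
    have reach: "reachable_at (\<lambda>t. E (k + t)) j T = UNIV" for j
      unfolding T_def
    proof (rule reachable_at_UNIV)
      show "strongly_connected (\<Union>l\<in>{1..P}. E (k + (m + l)))" for m
        using P[of "k + m"] by (simp add: add.assoc)
    qed (rule self_loop)
    have "spread (\<lambda>i. v (k + T) i $ c) \<le>
        (1 - c0 ^ T) * spread (\<lambda>i. v (k + 0) i $ c) + 2 * (\<Sum>t<T. perturbation (k + t))"
    proof (rule perturbed_averaging_contracts[where A = "\<lambda>t. W (k + t)" and E = "\<lambda>t. E (k + t)"
          and u = "\<lambda>t i. v (k + t) i $ c"
          and d = "\<lambda>t i. (h i (B i (x (Suc (k + t)))) - h i (B i (x (k + t)))) $ c"])
      show "v (k + Suc t) i $ c = (\<Sum>j\<in>UNIV. W (k + t) $ i $ j * v (k + t) j $ c)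
          + (h i (B i (x (Suc (k + t)))) - h i (B i (x (k + t)))) $ c" for t i
        by (simp add: v_step vh_step)
    qed (use W_row_stochastic c0 reach h_increment in auto)
    then show ?thesis by (simp add: sum_distrib_left)
  qed
  moreover have "0 < T" "0 < c0 ^ T" "c0 ^ T \<le> 1"
    using c0 by (auto simp: T_def power_le_one)
  ultimately show ?thesis by (rule that[rotated 3])
qed

lemma perturbation_bounded: "\<exists>b. \<forall>k. perturbation k \<le> b"
proof -
  obtain b where b: "0 < b" "\<And>y. y \<in> XX \<Longrightarrow> norm y \<le> b" by (rule XX_bound) blast
  have "displacement k i \<le> 2 * b" for k i
  proof -
    have "displacement k i \<le> norm (x (Suc k) - x k)"
      unfolding displacement_def block_diff[symmetric] by (rule norm_block_le)
    also have "\<dots> \<le> norm (x (Suc k)) + norm (x k)" by (rule norm_triangle_ineq4)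
    finally show ?thesis using b(2)[OF x_in_XX[of k]] b(2)[OF x_in_XX[of "Suc k"]] by linarith
  qed
  then have "perturbation k \<le> (\<Sum>i\<in>UNIV. Lh i * (2 * b))" for k
    unfolding perturbation_def by (intro sum_mono mult_left_mono Lh_nonneg)
  then show ?thesis by blast
qed

text \<open>The crude bound, from bounded domains alone. It confines the estimates to a ball, on
  which \<open>F\<close> has a Lipschitz constant.\<close>

lemma disagreement_bounded: "\<exists>b. \<forall>k. disagreement k \<le> b"
proof -
  obtain T d where T: "0 < T" "0 < d" "d \<le> 1"
    "\<And>k c. spread (\<lambda>i. v (k + T) i $ c) \<le> (1 - d) * spread (\<lambda>i. v k i $ c) + (\<Sum>l<T. 2 * perturbation (k + l))"
    by (rule spread_contraction) blast
  obtain b where b: "\<And>k. perturbation k \<le> b" using perturbation_bounded by blast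
  have "\<exists>bc. \<forall>k. spread (\<lambda>i. v k i $ c) \<le> bc" for c
  proof (rule delayed_contraction_bounded[OF T(1-3)])
    fix k
    have "(\<Sum>l<T. 2 * perturbation (k + l)) \<le> (\<Sum>l<T. 2 * b)" using b by (intro sum_mono) simp
    then show "spread (\<lambda>i. v (k + T) i $ c) \<le> (1 - d) * spread (\<lambda>i. v k i $ c) + (\<Sum>l<T. 2 * b)"
      using T(4)[of k c] by linarith
  qed
  then obtain bc where "\<And>c k. spread (\<lambda>i. v k i $ c) \<le> bc c" by metis
  then have "disagreement k \<le> (\<Sum>c\<in>UNIV. bc c)" for k unfolding disagreement_def by (intro sum_mono)
  then show ?thesis by blast
qed

text \<open>In each coordinate both \<open>vh k i\<close> and the mean of the \<open>v k j\<close>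
  lie between the smallest and the largest \<open>v k j\<close>.\<close>

lemma tracking_error: "norm (real CARD('p) *\<^sub>R vh k i - \<sigma> (x k)) \<le> real CARD('p) * disagreement k"
proof -
  have comp: "\<bar>(real CARD('p) *\<^sub>R vh k i - \<sigma> (x k)) $ c\<bar> \<le> real CARD('p) * spread (\<lambda>i. v k i $ c)" for c
  proof -
    let ?u = "\<lambda>i. v k i $ c"
    have vh: "vh k i $ c = (\<Sum>j\<in>UNIV. W k $ i $ j * ?u j)" by (simp add: vh_step)
    have mean: "\<sigma> (x k) $ c = (\<Sum>j\<in>UNIV. ?u j)" by (simp add: sum_v[symmetric])
    have "\<bar>vh k i $ c - (\<Sum>j\<in>UNIV. ?u j) / real CARD('p)\<bar> \<le> spread ?u"
    proof (rule abs_diff_le_spread)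
      show "Min (range ?u) \<le> vh k i $ c" unfolding vh by (rule row_stochastic_ge[OF W_row_stochastic]) simp
      show "vh k i $ c \<le> Max (range ?u)" unfolding vh by (rule row_stochastic_le[OF W_row_stochastic]) simp
      have c: "0 < real CARD('p)" by simp
      have "real CARD('p) * Min (range ?u) \<le> (\<Sum>j\<in>UNIV. ?u j)"
        using sum_mono[of UNIV "\<lambda>_. Min (range ?u)" ?u] by simp
      then show "Min (range ?u) \<le> (\<Sum>j\<in>UNIV. ?u j) / real CARD('p)"
        using c by (simp add: le_divide_eq mult.commute)
      have "(\<Sum>j\<in>UNIV. ?u j) \<le> real CARD('p) * Max (range ?u)"
        using sum_mono[of UNIV ?u "\<lambda>_. Max (range ?u)"] by simp
      then show "(\<Sum>j\<in>UNIV. ?u j) / real CARD('p) \<le> Max (range ?u)"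
        using c by (simp add: divide_le_eq mult.commute)
    qed
    then have "real CARD('p) * \<bar>vh k i $ c - (\<Sum>j\<in>UNIV. ?u j) / real CARD('p)\<bar> \<le> real CARD('p) * spread ?u"
      by (rule mult_left_mono) simp
    moreover have "real CARD('p) * \<bar>vh k i $ c - (\<Sum>j\<in>UNIV. ?u j) / real CARD('p)\<bar> = \<bar>real CARD('p) * (vh k i $ c - (\<Sum>j\<in>UNIV. ?u j) / real CARD('p))\<bar>"
      by (simp add: abs_mult)
    moreover have "real CARD('p) * (vh k i $ c - (\<Sum>j\<in>UNIV. ?u j) / real CARD('p)) = (real CARD('p) *\<^sub>R vh k i - \<sigma> (x k)) $ c"
      by (simp add: mean right_diff_distrib)
    ultimately show ?thesis by simp
  qed
  have "norm (real CARD('p) *\<^sub>R vh k i - \<sigma> (x k)) \<le> (\<Sum>c\<in>UNIV. \<bar>(real CARD('p) *\<^sub>R vh k i - \<sigma> (x k)) $ c\<bar>)"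
    by (rule norm_le_l1_cart)
  also have "\<dots> \<le> (\<Sum>c\<in>UNIV. real CARD('p) * spread (\<lambda>i. v k i $ c))" by (intro sum_mono comp)
  finally show ?thesis by (simp add: disagreement_def sum_distrib_left)
qed

lemma \<sigma>_bounded: "\<exists>b. \<forall>y\<in>XX. norm (\<sigma> y) \<le> b"
proof -
  have "bounded (h i ` X i)" for i
    by (intro compact_imp_bounded compact_continuous_image h_continuous X_compact)
  then have "\<forall>i. \<exists>b. \<forall>y\<in>X i. norm (h i y) \<le> b" by (simp add: bounded_iff)
  then obtain b where b: "\<And>i y. y \<in> X i \<Longrightarrow> norm (h i y) \<le> b i" by metis
  have "norm (\<sigma> y) \<le> (\<Sum>i\<in>UNIV. b i)" if y: "y \<in> XX" for y
  proof -
    have "norm (\<sigma> y) \<le> (\<Sum>i\<in>UNIV. norm (h i (B i y)))" unfolding aggregate_def by (rule norm_sum)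
    also have "\<dots> \<le> (\<Sum>i\<in>UNIV. b i)" by (intro sum_mono b block_in_X y)
    finally show ?thesis .
  qed
  then show ?thesis by blast
qed

lemma estimates_bounded:
  obtains b where "0 < b" "\<And>k i. norm (real CARD('p) *\<^sub>R vh k i) \<le> b" "\<And>y. y \<in> XX \<Longrightarrow> norm (\<sigma> y) \<le> b"
proof -
  obtain b1 where b1: "\<And>y. y \<in> XX \<Longrightarrow> norm (\<sigma> y) \<le> b1" using \<sigma>_bounded by blast
  obtain b2 where b2: "\<And>k. disagreement k \<le> b2" using disagreement_bounded by blast
  have b10: "0 \<le> b1" using b1[OF x_in_XX[of 0]] norm_ge_zero[of "\<sigma> (x 0)"] by linarith
  have b20: "0 \<le> b2" using b2[of 0] disagreement_nonneg[of 0] by linarith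
  \<comment> \<open>The summand 1 makes the bound strictly positive, as \<open>F_lipschitz\<close>
    demands of its radius.\<close>
  have vh: "norm (real CARD('p) *\<^sub>R vh k i) \<le> b1 + real CARD('p) * b2 + 1" for k i
  proof -
    have "norm (real CARD('p) *\<^sub>R vh k i) \<le> norm (real CARD('p) *\<^sub>R vh k i - \<sigma> (x k)) + norm (\<sigma> (x k))"
      using norm_triangle_ineq[of "real CARD('p) *\<^sub>R vh k i - \<sigma> (x k)" "\<sigma> (x k)"] by simp
    moreover have "real CARD('p) * disagreement k \<le> real CARD('p) * b2" by (rule mult_left_mono[OF b2]) simp
    ultimately show ?thesis using tracking_error[of k i] b1[OF x_in_XX[of k]] by linarith
  qed
  have Nb: "0 \<le> real CARD('p) * b2" using b20 by simp
  show ?thesis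
  proof (rule that[of "b1 + real CARD('p) * b2 + 1"])
    show "0 < b1 + real CARD('p) * b2 + 1" using b10 Nb by linarith
    show "norm (\<sigma> y) \<le> b1 + real CARD('p) * b2 + 1" if "y \<in> XX" for y using b1[OF that] Nb by linarith
  qed (rule vh)
qed

lemma gradients_bounded:
  obtains C where "0 \<le> C"
    "\<And>k i. norm (F i (B i (x k)) (real CARD('p) *\<^sub>R vh k i)) \<le> C"
    "\<And>y i. y \<in> XX \<Longrightarrow> norm (F i (B i y) (\<sigma> y)) \<le> C"
    "\<And>k i y. y \<in> XX \<Longrightarrow> norm (\<eta> k i *\<^sub>R B i y) \<le> C"
proof -
  obtain b where b: "0 < b" "\<And>k i. norm (real CARD('p) *\<^sub>R vh k i) \<le> b" "\<And>y. y \<in> XX \<Longrightarrow> norm (\<sigma> y) \<le> b"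
    by (rule estimates_bounded) blast
  obtain b' where b': "0 < b'" "\<And>y. y \<in> XX \<Longrightarrow> norm y \<le> b'" by (rule XX_bound) blast
  have "\<forall>i. \<exists>C. \<forall>y\<in>X i. \<forall>s. norm s \<le> b \<longrightarrow> norm (F i y s) \<le> C" using F_bounded by blast
  then obtain C where C: "\<And>i y s. y \<in> X i \<Longrightarrow> norm s \<le> b \<Longrightarrow> norm (F i y s) \<le> C i" by metis
  define M where "M = (\<Sum>i\<in>UNIV. \<bar>C i\<bar>) + (\<Sum>i\<in>UNIV. \<eta> 0 i) * b'"
  have s1: "C i \<le> (\<Sum>i\<in>UNIV. \<bar>C i\<bar>)" for i
    using member_le_sum[of i UNIV "\<lambda>i. \<bar>C i\<bar>"] by simp
  have s10: "0 \<le> (\<Sum>i\<in>UNIV. \<bar>C i\<bar>)" by (simp add: sum_nonneg)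
  have s2: "\<eta> k i \<le> (\<Sum>i\<in>UNIV. \<eta> 0 i)" for i k
    using member_le_sum[of i UNIV "\<eta> 0"] eta_pos[of 0] decseqD[OF eta_decreasing[of i], of 0 k]
    by (simp add: less_imp_le)
  have s20: "0 \<le> (\<Sum>i\<in>UNIV. \<eta> 0 i) * b'"
    using b'(1) eta_pos[of 0] by (simp add: sum_nonneg less_imp_le)
  show ?thesis
  proof (rule that[of M])
    show "0 \<le> M" using s10 s20 by (simp add: M_def)
    show "norm (F i (B i (x k)) (real CARD('p) *\<^sub>R vh k i)) \<le> M" for k i
      using C[OF x_in_X b(2)[of k i]] s1[of i] s20 by (simp add: M_def) (smt (verit))
    show "norm (F i (B i y) (\<sigma> y)) \<le> M" if "y \<in> XX" for y i
      using C[OF block_in_X[OF that] b(3)[OF that], of i] s1[of i] s20 by (simp add: M_def)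
    show "norm (\<eta> k i *\<^sub>R B i y) \<le> M" if "y \<in> XX" for k i y
    proof -
      have "norm (\<eta> k i *\<^sub>R B i y) = \<eta> k i * norm (B i y)" using eta_pos[of k i] by simp
      also have "\<dots> \<le> (\<Sum>i\<in>UNIV. \<eta> 0 i) * b'"
        using s2[of k i] eta_pos[of k i] norm_block_le[of own i y] b'(2)[OF that]
        by (intro mult_mono) auto
      finally show ?thesis unfolding M_def using s10 by linarith
    qed
  qed
qed

end

section \<open>Square-summable errors and the distance to the regularized solutions\<close>

context algorithm_run
begin

definition y :: "nat \<Rightarrow> real^'c" where "y k = regularized (\<eta> k)"
definition decay :: "nat \<Rightarrow> real" where "decay k = pmin \<alpha> k * pmin \<eta> k"

lemma y_in_XX: "y k \<in> XX"
  unfolding y_def by (rule regularized_in_XX[OF eta_pos])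

text \<open>The proximal inequality tested at the previous iterate has the form of the weighted
  descent lemma, with the norm of the direction as \<open>g\<close>. The direction is a bounded
  vector plus noise, so its product with the step size is square summable.\<close>

lemma displacement_square_summable: "summable (\<lambda>k. (displacement k i)\<^sup>2)"
proof -
  obtain C where C: "0 \<le> C" "\<And>k i. norm (F i (B i (x k)) (real CARD('p) *\<^sub>R vh k i)) \<le> C"
    "\<And>k i y. y \<in> XX \<Longrightarrow> norm (\<eta> k i *\<^sub>R B i y) \<le> C"
    by (rule gradients_bounded) blast
  have direction: "norm (direction k i) \<le> 2 * C + norm (\<zeta> k i)" for k
    unfolding direction_def
    using norm_triangle_ineq[of "F i (B i (x k)) (real CARD('p) *\<^sub>R vh k i) + \<zeta> k i" "\<eta> k i *\<^sub>R B i (x k)"]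
      norm_triangle_ineq[of "F i (B i (x k)) (real CARD('p) *\<^sub>R vh k i)" "\<zeta> k i"]
      C(2)[of i k] C(3)[OF x_in_XX, of k i k] by linarith
  have "(norm (direction k i))\<^sup>2 \<le> 2 * (2 * C)\<^sup>2 + 2 * (norm (\<zeta> k i))\<^sup>2" for k
    using power_mono[OF direction norm_ge_zero, of k 2] power2_add_le[of "2 * C" "norm (\<zeta> k i)"] by linarith
  then have "(\<alpha> k i)\<^sup>2 * (norm (direction k i))\<^sup>2 \<le> (\<alpha> k i)\<^sup>2 * (2 * (2 * C)\<^sup>2 + 2 * (norm (\<zeta> k i))\<^sup>2)" for k
    by (rule mult_left_mono) simp
  then have le: "norm ((\<alpha> k i)\<^sup>2 * (norm (direction k i))\<^sup>2)
      \<le> 2 * (2 * C)\<^sup>2 * (\<alpha> k i)\<^sup>2 + 2 * ((\<alpha> k i)\<^sup>2 * (norm (\<zeta> k i))\<^sup>2)" for k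
    by (simp add: algebra_simps)
  have sum_g: "summable (\<lambda>k. (\<alpha> k i)\<^sup>2 * (norm (direction k i))\<^sup>2)"
    by (rule summable_comparison_test'[OF _ le]) (intro summable_add summable_mult rate4 noise_square)
  \<comment> \<open>\<open>\<rho> i\<close> is bounded below on the compact domain, even where its
    subgradients are unbounded.\<close>
  obtain z where z: "\<And>w. w \<in> X i \<Longrightarrow> \<rho> i z \<le> \<rho> i w"
    using lsc_attains_inf[OF X_compact X_nonempty \<rho>_lsc] by blast
  show ?thesis
  proof (rule summable_square_from_weighted_descent[of "\<lambda>k. \<alpha> k i" "\<rho> i z" "\<lambda>k. \<rho> i (B i (x k))" "\<lambda>k. norm (direction k i)"])
    show "decseq (\<lambda>k. \<alpha> k i)" by (rule alpha_decreasing)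
    show "0 \<le> \<alpha> k i" for k using alpha_pos[of k i] by simp
    show "\<rho> i z \<le> \<rho> i (B i (x k))" for k by (rule z[OF x_in_X])
    show "(displacement k i)\<^sup>2 \<le> \<alpha> k i * (\<rho> i (B i (x k)) - \<rho> i (B i (x (Suc k)))) + \<alpha> k i * norm (direction k i) * displacement k i" for k
    proof -
      let ?d = "B i (x k) - B i (x (Suc k))"
      have "(?d - \<alpha> k i *\<^sub>R direction k i) \<bullet> ?d \<le> \<alpha> k i * (\<rho> i (B i (x k)) - \<rho> i (B i (x (Suc k))))"
      proof -
        have "\<forall>z\<in>X i. (B i (x k) - \<alpha> k i *\<^sub>R direction k i - B i (x (Suc k))) \<bullet> (z - B i (x (Suc k)))
            \<le> \<alpha> k i * (\<rho> i z - \<rho> i (B i (x (Suc k))))"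
          using x_step_prox_point[of i k] unfolding prox_point_def by (elim conjE)
        from bspec[OF this x_in_X[of i k]] show ?thesis
          by (simp only: diff_diff_eq add.commute)
      qed
      moreover have "(?d - \<alpha> k i *\<^sub>R direction k i) \<bullet> ?d = (displacement k i)\<^sup>2 - \<alpha> k i * (direction k i \<bullet> ?d)"
        by (simp add: displacement_def norm_minus_commute[of "B i (x (Suc k))"] power2_norm_eq_inner inner_diff_left)
      moreover have "\<alpha> k i * (direction k i \<bullet> ?d) \<le> \<alpha> k i * (norm (direction k i) * displacement k i)"
        using alpha_pos[of k i] norm_cauchy_schwarz[of "direction k i" ?d]
        by (intro mult_left_mono) (auto simp: displacement_def norm_minus_commute)
      ultimately show ?thesis by (simp add: mult.assoc)
    qed
  qed (rule sum_g)
qed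

lemma disagreement_square_summable: "summable (\<lambda>k. (disagreement k)\<^sup>2)"
proof -
  obtain T d where T: "0 < T" "0 < d" "d \<le> 1"
    "\<And>k c. spread (\<lambda>i. v (k + T) i $ c) \<le> (1 - d) * spread (\<lambda>i. v k i $ c) + (\<Sum>l<T. 2 * perturbation (k + l))"
    by (rule spread_contraction) blast
  have e2: "summable (\<lambda>k. (2 * perturbation k)\<^sup>2)"
  proof (rule summable_comparison_test')
    show "summable (\<lambda>k. 4 * (real CARD('p) * (\<Sum>i\<in>UNIV. (Lh i)\<^sup>2 * (displacement k i)\<^sup>2)))"
      by (intro summable_mult summable_sum displacement_square_summable)
    show "norm ((2 * perturbation k)\<^sup>2) \<le> 4 * (real CARD('p) * (\<Sum>i\<in>UNIV. (Lh i)\<^sup>2 * (displacement k i)\<^sup>2))" for k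
      using power2_sum_le_card[of "\<lambda>i. Lh i * displacement k i" UNIV] by (simp add: perturbation_def power_mult_distrib)
  qed
  have "summable (\<lambda>k. (spread (\<lambda>i. v k i $ c))\<^sup>2)" for c
    by (rule delayed_contraction_square_summable[OF T(1-3) spread_nonneg _ T(4) e2]) (simp add: perturbation_nonneg)
  then have "summable (\<lambda>k. real CARD('c) * (\<Sum>c\<in>UNIV. (spread (\<lambda>i. v k i $ c))\<^sup>2))"
    by (intro summable_mult summable_sum)
  then show ?thesis
    by (rule summable_comparison_test'[where N = 0])
      (simp add: disagreement_def power2_sum_le_card)
qed

text \<open>\<open>y k\<close> is a fixed point of the exact proximal step for every step size, in
  particular for each player's own \<open>\<alpha> k i\<close>. The step of \<open>x\<close> can
  thus be compared with it by nonexpansiveness, with no subgradient of \<open>r i\<close> in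
  sight.\<close>

lemma prox_point_y:
  "prox_point (X i) (\<rho> i) (\<alpha> k i) (B i (y k) - \<alpha> k i *\<^sub>R (F i (B i (y k)) (\<sigma> (y k)) + \<eta> k i *\<^sub>R B i (y k))) (B i (y k))"
  unfolding prox_point_def
proof (intro conjI ballI)
  fix w assume w: "w \<in> X i"
  let ?d = "w - B i (y k)"
  have d: "?d \<in> block_space own i" using block_space_diff[OF subsetD[OF X_subset w]] by simp
  have scale: "player_scale own (\<eta> k) (y k) \<bullet> ?d = (\<eta> k i *\<^sub>R B i (y k)) \<bullet> ?d"
    using inner_block_right[of "player_scale own (\<eta> k) (y k)" own i ?d]
    by (simp add: block_id[OF d] block_player_scale)
  have "0 \<le> (F i (B i (y k)) (\<sigma> (y k)) + \<eta> k i *\<^sub>R B i (y k)) \<bullet> ?d + \<rho> i w - \<rho> i (B i (y k))"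
  proof -
    have "\<forall>w\<in>X i. 0 \<le> (\<phi> (y k) + player_scale own (\<eta> k) (y k)) \<bullet> (w - B i (y k)) + \<rho> i w - \<rho> i (B i (y k))"
      using regularized_vi[of "\<eta> k", OF eta_pos] unfolding vi_solution_iff_blocks y_def by simp
    from bspec[OF this w] show ?thesis
      using scale \<phi>_inner[OF d, of "y k"]
      by (simp only: inner_add_left)
  qed
  then have "0 \<le> \<alpha> k i * ((F i (B i (y k)) (\<sigma> (y k)) + \<eta> k i *\<^sub>R B i (y k)) \<bullet> ?d + \<rho> i w - \<rho> i (B i (y k)))"
    using alpha_pos[of k i] by simp
  then show "(B i (y k) - \<alpha> k i *\<^sub>R (F i (B i (y k)) (\<sigma> (y k)) + \<eta> k i *\<^sub>R B i (y k)) - B i (y k)) \<bullet> ?d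
      \<le> \<alpha> k i * (\<rho> i w - \<rho> i (B i (y k)))"
    by (simp add: algebra_simps)
qed (rule block_in_X[OF y_in_XX])

text \<open>Expand the square of the difference of the two arguments of the proximal map. Its linear
  term splits into the monotone part, the regularization, the consensus error and the noise; the
  quadratic term is bounded outright.\<close>

lemma player_step:
  obtains K C where "\<And>k i. (norm (B i (x (Suc k)) - B i (y k)))\<^sup>2 \<le> (norm (B i (x k) - B i (y k)))\<^sup>2
      - 2 * (\<alpha> k i * ((\<phi> (x k) - \<phi> (y k)) \<bullet> (B i (x k) - B i (y k))))
      - 2 * (\<alpha> k i * \<eta> k i * (norm (B i (x k) - B i (y k)))\<^sup>2)
      + 2 * (K * (\<alpha> k i * disagreement k)) - 2 * (\<alpha> k i * ((B i (x k) - B i (y k)) \<bullet> \<zeta> k i))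
      + (2 * C\<^sup>2 * (\<alpha> k i)\<^sup>2 + 2 * ((\<alpha> k i)\<^sup>2 * (norm (\<zeta> k i))\<^sup>2))"
proof -
  obtain C where C: "0 \<le> C" "\<And>k i. norm (F i (B i (x k)) (real CARD('p) *\<^sub>R vh k i)) \<le> C"
    "\<And>y i. y \<in> XX \<Longrightarrow> norm (F i (B i y) (\<sigma> y)) \<le> C"
    "\<And>k i y. y \<in> XX \<Longrightarrow> norm (\<eta> k i *\<^sub>R B i y) \<le> C"
    by (rule gradients_bounded) blast
  obtain b where b: "0 < b" "\<And>k i. norm (real CARD('p) *\<^sub>R vh k i) \<le> b" "\<And>y. y \<in> XX \<Longrightarrow> norm (\<sigma> y) \<le> b"
    by (rule estimates_bounded) blast
  obtain b' where b': "0 < b'" "\<And>y. y \<in> XX \<Longrightarrow> norm y \<le> b'" by (rule XX_bound) blast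
  have "\<forall>i. \<exists>Lf. \<forall>y\<in>X i. \<forall>z1 z2. norm z1 \<le> b \<longrightarrow> norm z2 \<le> b \<longrightarrow>
      norm (F i y z1 - F i y z2) \<le> Lf * norm (z1 - z2)"
    using F_lipschitz[OF b(1)] by blast
  from choice[OF this] obtain Lf where Lf: "\<forall>i. \<forall>y\<in>X i. \<forall>z1 z2. norm z1 \<le> b \<longrightarrow> norm z2 \<le> b \<longrightarrow>
      norm (F i y z1 - F i y z2) \<le> Lf i * norm (z1 - z2)" by blast
  define Lf' where "Lf' = (\<Sum>i\<in>UNIV. \<bar>Lf i\<bar>)"
  have Lf': "Lf i \<le> Lf'" "0 \<le> Lf'" for i
    using member_le_sum[of i UNIV "\<lambda>i. \<bar>Lf i\<bar>"] by (auto simp: Lf'_def sum_nonneg)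
  \<comment> \<open>\<open>2 * b'\<close> bounds the distance of two points of the domain; the other
    factor turns disagreement into an error of the gradient.\<close>
  define K where "K = 2 * b' * (Lf' * real CARD('p))"
  have "(norm (B i (x (Suc k)) - B i (y k)))\<^sup>2 \<le> (norm (B i (x k) - B i (y k)))\<^sup>2
      - 2 * (\<alpha> k i * ((\<phi> (x k) - \<phi> (y k)) \<bullet> (B i (x k) - B i (y k))))
      - 2 * (\<alpha> k i * \<eta> k i * (norm (B i (x k) - B i (y k)))\<^sup>2)
      + 2 * (K * (\<alpha> k i * disagreement k)) - 2 * (\<alpha> k i * ((B i (x k) - B i (y k)) \<bullet> \<zeta> k i))
      + (2 * (4 * C)\<^sup>2 * (\<alpha> k i)\<^sup>2 + 2 * ((\<alpha> k i)\<^sup>2 * (norm (\<zeta> k i))\<^sup>2))" for k i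
  proof -
    define d where "d = B i (x k) - B i (y k)"
    define Fx where "Fx = F i (B i (x k)) (\<sigma> (x k))"
    define Fv where "Fv = F i (B i (x k)) (real CARD('p) *\<^sub>R vh k i)"
    define Fy where "Fy = F i (B i (y k)) (\<sigma> (y k))"
    define G where "G = Fv + \<zeta> k i + \<eta> k i *\<^sub>R B i (x k) - (Fy + \<eta> k i *\<^sub>R B i (y k))"
    have "norm (B i (x (Suc k)) - B i (y k)) \<le> norm (d - \<alpha> k i *\<^sub>R G)"
      using prox_point_nonexpansive[OF x_step_prox_point prox_point_y, of i k]
      by (simp add: d_def G_def direction_def Fv_def Fy_def algebra_simps)
    then have "(norm (B i (x (Suc k)) - B i (y k)))\<^sup>2 \<le> (norm (d - \<alpha> k i *\<^sub>R G))\<^sup>2"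
      by (rule power_mono) simp
    also have "\<dots> = (norm d)\<^sup>2 - 2 * (\<alpha> k i * (d \<bullet> G)) + (\<alpha> k i)\<^sup>2 * (norm G)\<^sup>2"
      by (simp add: norm_diff_square[of d] power_mult_distrib)
    finally have step: "(norm (B i (x (Suc k)) - B i (y k)))\<^sup>2
        \<le> (norm d)\<^sup>2 - 2 * (\<alpha> k i * (d \<bullet> G)) + (\<alpha> k i)\<^sup>2 * (norm G)\<^sup>2" .
    have db: "d \<in> block_space own i" by (simp add: d_def block_space_diff)
    have G_split: "d \<bullet> G = (\<phi> (x k) - \<phi> (y k)) \<bullet> d + \<eta> k i * (norm d)\<^sup>2 + d \<bullet> (Fv - Fx) + d \<bullet> \<zeta> k i"
    proof -
      have "G = (Fx - Fy) + \<eta> k i *\<^sub>R d + (Fv - Fx) + \<zeta> k i"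
        by (simp add: G_def d_def algebra_simps)
      moreover have "d \<bullet> (Fx - Fy) = (\<phi> (x k) - \<phi> (y k)) \<bullet> d"
        using \<phi>_inner[OF db, of "x k"] \<phi>_inner[OF db, of "y k"]
        by (simp add: Fx_def Fy_def inner_diff_left inner_diff_right inner_commute[of d])
      ultimately show ?thesis
        by (simp only: inner_add_right inner_scaleR_right power2_norm_eq_inner)
    qed
    have "\<bar>d \<bullet> (Fv - Fx)\<bar> \<le> K * disagreement k"
    proof -
      have "norm d \<le> norm (B i (x k)) + norm (B i (y k))" unfolding d_def by (rule norm_triangle_ineq4)
      also have "\<dots> \<le> 2 * b'"
        using norm_block_le[of own i "x k"] norm_block_le[of own i "y k"] b'(2)[OF x_in_XX, of k] b'(2)[OF y_in_XX, of k]
        by linarith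
      finally have d: "norm d \<le> 2 * b'" .
      have "norm (Fv - Fx) \<le> Lf i * norm (real CARD('p) *\<^sub>R vh k i - \<sigma> (x k))"
        unfolding Fv_def Fx_def using Lf x_in_X[of i k] b(2)[of k i] b(3)[OF x_in_XX, of k] by simp
      also have "\<dots> \<le> Lf' * (real CARD('p) * disagreement k)"
        using Lf' tracking_error[of k i] by (intro mult_mono) auto
      finally have "norm d * norm (Fv - Fx) \<le> (2 * b') * (Lf' * (real CARD('p) * disagreement k))"
        using d b'(1) by (intro mult_mono) auto
      then show ?thesis
        using Cauchy_Schwarz_ineq2[of d "Fv - Fx"] by (simp add: K_def mult.assoc)
    qed
    then have err: "- (\<alpha> k i * (d \<bullet> (Fv - Fx))) \<le> K * (\<alpha> k i * disagreement k)"
      using mult_left_mono[of "- (d \<bullet> (Fv - Fx))" "K * disagreement k" "\<alpha> k i"] alpha_pos[of k i]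
      by (simp add: abs_le_iff mult.left_commute)
    \<comment> \<open>Besides the noise, \<open>G\<close> has four terms, each bounded by
      \<open>C\<close>.\<close>
    have "norm G \<le> 4 * C + norm (\<zeta> k i)"
    proof -
      have "norm G \<le> norm (Fv + \<zeta> k i + \<eta> k i *\<^sub>R B i (x k)) + norm (Fy + \<eta> k i *\<^sub>R B i (y k))"
        unfolding G_def by (rule norm_triangle_ineq4)
      moreover have "norm (Fv + \<zeta> k i + \<eta> k i *\<^sub>R B i (x k)) \<le> norm Fv + norm (\<zeta> k i) + norm (\<eta> k i *\<^sub>R B i (x k))"
        using norm_triangle_ineq[of "Fv + \<zeta> k i" "\<eta> k i *\<^sub>R B i (x k)"] norm_triangle_ineq[of Fv "\<zeta> k i"]
        by linarith
      moreover have "norm (Fy + \<eta> k i *\<^sub>R B i (y k)) \<le> norm Fy + norm (\<eta> k i *\<^sub>R B i (y k))"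
        by (rule norm_triangle_ineq)
      ultimately show ?thesis
        using C(2)[of i k] C(3)[OF y_in_XX, of i k] C(4)[OF x_in_XX, of k i k] C(4)[OF y_in_XX, of k i k]
        unfolding Fv_def Fy_def by linarith
    qed
    from power_mono[OF this norm_ge_zero, of 2]
    have "(norm G)\<^sup>2 \<le> 2 * (4 * C)\<^sup>2 + 2 * (norm (\<zeta> k i))\<^sup>2"
      using power2_add_le[of "4 * C" "norm (\<zeta> k i)"] by linarith
    then have "(\<alpha> k i)\<^sup>2 * (norm G)\<^sup>2 \<le> (\<alpha> k i)\<^sup>2 * (2 * (4 * C)\<^sup>2 + 2 * (norm (\<zeta> k i))\<^sup>2)"
      by (rule mult_left_mono) simp
    then have G2: "(\<alpha> k i)\<^sup>2 * (norm G)\<^sup>2 \<le> 2 * (4 * C)\<^sup>2 * (\<alpha> k i)\<^sup>2 + 2 * ((\<alpha> k i)\<^sup>2 * (norm (\<zeta> k i))\<^sup>2)"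
      by (simp add: algebra_simps)
    have "\<alpha> k i * (d \<bullet> G) = \<alpha> k i * ((\<phi> (x k) - \<phi> (y k)) \<bullet> d) + \<alpha> k i * \<eta> k i * (norm d)\<^sup>2
        + \<alpha> k i * (d \<bullet> (Fv - Fx)) + \<alpha> k i * (d \<bullet> \<zeta> k i)"
      unfolding G_split by (simp add: algebra_simps)
    then show ?thesis
      using step err G2 unfolding d_def[symmetric] by linarith
  qed
  then show ?thesis by (rule that)
qed

text \<open>Take the common weight \<open>pmin \<alpha> k\<close> out: monotonicity makes that part
  nonnegative. The remaining weights lie between 0 and
  \<open>pmax \<alpha> k - pmin \<alpha> k\<close>, and each inner product is bounded by Lipschitz
  continuity.\<close>

lemma monotone_part_lower_bound:
  "(\<Sum>i\<in>UNIV. \<alpha> k i * ((\<phi> (x k) - \<phi> (y k)) \<bullet> (B i (x k) - B i (y k))))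
    \<ge> - ((pmax \<alpha> k - pmin \<alpha> k) * (real CARD('p) * L) * (norm (x k - y k))\<^sup>2)"
proof -
  define t where "t i = (\<phi> (x k) - \<phi> (y k)) \<bullet> (B i (x k) - B i (y k))" for i
  have sum_t: "(\<Sum>i\<in>UNIV. t i) \<ge> 0"
    using phi_monotone[OF x_in_XX y_in_XX, of k k]
      inner_sum_blocks[of "\<phi> (x k) - \<phi> (y k)" "x k - y k" own] by (simp add: t_def block_diff)
  have abs_t: "\<bar>t i\<bar> \<le> L * (norm (x k - y k))\<^sup>2" for i
  proof -
    have "\<bar>t i\<bar> \<le> norm (\<phi> (x k) - \<phi> (y k)) * norm (B i (x k) - B i (y k))"
      unfolding t_def by (rule Cauchy_Schwarz_ineq2)
    also have "\<dots> \<le> (L * norm (x k - y k)) * norm (x k - y k)"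
      using \<phi>_lipschitz_norm[OF x_in_XX y_in_XX, of k k] norm_block_le[of own i "x k - y k"] L_nonneg
      by (intro mult_mono) (auto simp: block_diff)
    finally show ?thesis by (simp add: power2_eq_square mult.assoc)
  qed
  have "(\<Sum>i\<in>UNIV. (\<alpha> k i - pmin \<alpha> k) * t i)
      \<ge> (\<Sum>i\<in>(UNIV::'p set). - ((pmax \<alpha> k - pmin \<alpha> k) * (L * (norm (x k - y k))\<^sup>2)))"
  proof (rule sum_mono)
    fix i
    have "(\<alpha> k i - pmin \<alpha> k) * \<bar>t i\<bar> \<le> (pmax \<alpha> k - pmin \<alpha> k) * (L * (norm (x k - y k))\<^sup>2)"
      using pmin_le[of \<alpha> k i] le_pmax[of \<alpha> k i] abs_t[of i] by (intro mult_mono) auto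
    moreover have "- ((\<alpha> k i - pmin \<alpha> k) * \<bar>t i\<bar>) \<le> (\<alpha> k i - pmin \<alpha> k) * t i"
      using mult_left_mono[of "- \<bar>t i\<bar>" "t i" "\<alpha> k i - pmin \<alpha> k"] pmin_le[of \<alpha> k i] by simp
    ultimately show "- ((pmax \<alpha> k - pmin \<alpha> k) * (L * (norm (x k - y k))\<^sup>2)) \<le> (\<alpha> k i - pmin \<alpha> k) * t i"
      by linarith
  qed
  moreover have "(\<Sum>i\<in>UNIV. \<alpha> k i * t i) = pmin \<alpha> k * (\<Sum>i\<in>UNIV. t i) + (\<Sum>i\<in>UNIV. (\<alpha> k i - pmin \<alpha> k) * t i)"
    by (simp add: sum_distrib_left sum.distrib[symmetric] algebra_simps)
  moreover have "0 \<le> pmin \<alpha> k * (\<Sum>i\<in>UNIV. t i)"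
    using sum_t pmin_pos[of \<alpha> k] alpha_pos by simp
  ultimately show ?thesis by (simp add: t_def mult_ac)
qed

lemma decay_pos: "0 < decay k"
  unfolding decay_def by (intro mult_pos_pos pmin_pos alpha_pos eta_pos)

lemma joint_step:
  obtains m where "summable m"
    "\<And>k. (norm (x (Suc k) - y k))\<^sup>2 \<le>
      (1 - 2 * decay k + 2 * ((pmax \<alpha> k - pmin \<alpha> k) * (real CARD('p) * L))) * (norm (x k - y k))\<^sup>2 + m k"
proof -
  obtain K C where step: "\<And>k i. (norm (B i (x (Suc k)) - B i (y k)))\<^sup>2 \<le> (norm (B i (x k) - B i (y k)))\<^sup>2
      - 2 * (\<alpha> k i * ((\<phi> (x k) - \<phi> (y k)) \<bullet> (B i (x k) - B i (y k))))
      - 2 * (\<alpha> k i * \<eta> k i * (norm (B i (x k) - B i (y k)))\<^sup>2)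
      + 2 * (K * (\<alpha> k i * disagreement k)) - 2 * (\<alpha> k i * ((B i (x k) - B i (y k)) \<bullet> \<zeta> k i))
      + (2 * C\<^sup>2 * (\<alpha> k i)\<^sup>2 + 2 * ((\<alpha> k i)\<^sup>2 * (norm (\<zeta> k i))\<^sup>2))"
    by (rule player_step) blast
  \<comment> \<open>The inner products with the noise keep their sign here; taking absolute values
    would destroy summability.\<close>
  define m where "m k = (\<Sum>i\<in>UNIV. 2 * (K * (\<alpha> k i * disagreement k)) - 2 * (\<alpha> k i * ((B i (x k) - B i (y k)) \<bullet> \<zeta> k i))
      + (2 * C\<^sup>2 * (\<alpha> k i)\<^sup>2 + 2 * ((\<alpha> k i)\<^sup>2 * (norm (\<zeta> k i))\<^sup>2)))" for k
  have "summable m"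
    unfolding m_def
    by (intro summable_sum summable_add summable_diff summable_mult rate4 noise_square
        summable_product_if_square_summable disagreement_square_summable noise_martingale[folded y_def])
  moreover have "(norm (x (Suc k) - y k))\<^sup>2 \<le>
      (1 - 2 * decay k + 2 * ((pmax \<alpha> k - pmin \<alpha> k) * (real CARD('p) * L))) * (norm (x k - y k))\<^sup>2 + m k" for k
  proof -
    define d where "d i = (norm (B i (x k) - B i (y k)))\<^sup>2" for i
    have sum_d: "(\<Sum>i\<in>UNIV. d i) = (norm (x k - y k))\<^sup>2"
      unfolding norm_sq_sum_blocks[of "x k - y k" own] by (simp add: d_def block_diff)
    have "(\<Sum>i\<in>UNIV. decay k * d i) \<le> (\<Sum>i\<in>UNIV. \<alpha> k i * \<eta> k i * d i)"
    proof (intro sum_mono mult_right_mono)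
      show "decay k \<le> \<alpha> k i * \<eta> k i" for i
        unfolding decay_def using pmin_le[of \<alpha> k i] pmin_le[of \<eta> k i] pmin_pos[of \<eta> k] eta_pos[of k] alpha_pos[of k i]
        by (intro mult_mono) (auto simp: less_imp_le)
    qed (simp add: d_def)
    then have strong: "decay k * (norm (x k - y k))\<^sup>2 \<le> (\<Sum>i\<in>UNIV. \<alpha> k i * \<eta> k i * d i)"
      by (simp add: sum_distrib_left[symmetric] sum_d)
    have "(norm (x (Suc k) - y k))\<^sup>2 = (\<Sum>i\<in>UNIV. (norm (B i (x (Suc k)) - B i (y k)))\<^sup>2)"
      unfolding norm_sq_sum_blocks[of "x (Suc k) - y k" own] by (simp add: block_diff)
    also have "\<dots> \<le> (\<Sum>i\<in>UNIV. d i
      - 2 * (\<alpha> k i * ((\<phi> (x k) - \<phi> (y k)) \<bullet> (B i (x k) - B i (y k))))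
      - 2 * (\<alpha> k i * \<eta> k i * d i)
      + (2 * (K * (\<alpha> k i * disagreement k)) - 2 * (\<alpha> k i * ((B i (x k) - B i (y k)) \<bullet> \<zeta> k i))
      + (2 * C\<^sup>2 * (\<alpha> k i)\<^sup>2 + 2 * ((\<alpha> k i)\<^sup>2 * (norm (\<zeta> k i))\<^sup>2))))"
      unfolding d_def using step by (intro sum_mono) (simp add: algebra_simps)
    also have "\<dots> = (norm (x k - y k))\<^sup>2
      - 2 * (\<Sum>i\<in>UNIV. \<alpha> k i * ((\<phi> (x k) - \<phi> (y k)) \<bullet> (B i (x k) - B i (y k))))
      - 2 * (\<Sum>i\<in>UNIV. \<alpha> k i * \<eta> k i * d i) + m k"
      unfolding m_def sum_d[symmetric] by (simp only: sum.distrib sum_subtractf sum_distrib_left)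
    finally show ?thesis
      using strong monotone_part_lower_bound[of k] by (simp add: algebra_simps)
  qed
  ultimately show ?thesis by (rule that)
qed

lemma drift_summable: "summable (\<lambda>k. (1 + 1 / decay (Suc k)) * (norm (y (Suc k) - y k))\<^sup>2)"
proof -
  obtain b where b: "0 < b" "\<And>z. z \<in> XX \<Longrightarrow> norm z \<le> b" by (rule XX_bound) blast
  show ?thesis
  proof (rule summable_comparison_test'[OF summable_mult[OF rate5, of "b\<^sup>2"]])
    fix k
    have "norm (y (Suc k) - y k) \<le> b * ((pmax \<eta> k - pmin \<eta> (Suc k)) / pmin \<eta> (Suc k))"
      unfolding y_def
    proof (rule regularized_drift[OF eta_pos eta_pos pmin_pos[of \<eta>, OF eta_pos] pmin_le _ b(2)])
      \<comment> \<open>The parameters decrease, so the largest old and the smallest new one bracket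
        the change of every player.\<close>
      show "\<bar>\<eta> (Suc k) i - \<eta> k i\<bar> \<le> pmax \<eta> k - pmin \<eta> (Suc k)" for i
        using decseqD[OF eta_decreasing[of i], of k "Suc k"] le_pmax[of \<eta> k i] pmin_le[of \<eta> "Suc k" i] by simp
    qed
    from power_mono[OF this norm_ge_zero, of 2]
    have "(norm (y (Suc k) - y k))\<^sup>2 \<le> b\<^sup>2 * ((pmax \<eta> k - pmin \<eta> (Suc k))\<^sup>2 / (pmin \<eta> (Suc k))\<^sup>2)"
      by (simp add: power_mult_distrib power_divide)
    then have "(1 + 1 / decay (Suc k)) * (norm (y (Suc k) - y k))\<^sup>2 \<le>
        (1 + 1 / decay (Suc k)) * (b\<^sup>2 * ((pmax \<eta> k - pmin \<eta> (Suc k))\<^sup>2 / (pmin \<eta> (Suc k))\<^sup>2))"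
      using decay_pos[of "Suc k"] by (intro mult_left_mono) auto
    moreover have "0 \<le> (1 + 1 / decay (Suc k)) * (norm (y (Suc k) - y k))\<^sup>2"
      using decay_pos[of "Suc k"] by simp
    ultimately show "norm ((1 + 1 / decay (Suc k)) * (norm (y (Suc k) - y k))\<^sup>2) \<le>
        b\<^sup>2 * ((1 + 1 / (pmin \<alpha> (Suc k) * pmin \<eta> (Suc k))) *
          ((pmax \<eta> k - pmin \<eta> (Suc k))\<^sup>2 / (pmin \<eta> (Suc k))\<^sup>2))"
      by (simp add: decay_def mult_ac)
  qed
qed

lemma decay_tendsto_0: "decay \<longlonglongrightarrow> 0"
proof (rule tendsto_sandwich[OF _ _ tendsto_const])
  fix i
  show "\<forall>\<^sub>F k in sequentially. 0 \<le> decay k" using less_imp_le[OF decay_pos] by simp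
  show "\<forall>\<^sub>F k in sequentially. decay k \<le> \<alpha> k i * \<eta> k i"
    unfolding decay_def using pmin_le[of \<alpha> _ i] pmin_le[of \<eta> _ i] pmin_pos[of \<eta>] eta_pos alpha_pos
    by (intro always_eventually allI mult_mono) (auto simp: less_imp_le)
  show "(\<lambda>k. \<alpha> k i * \<eta> k i) \<longlonglongrightarrow> 0"
    using tendsto_mult[OF alpha_tendsto eta_tendsto] by simp
qed

theorem tracks_regularized: "(\<lambda>k. x k - regularized (\<eta> k)) \<longlonglongrightarrow> 0"
proof -
  obtain m where m: "summable m" "\<And>k. (norm (x (Suc k) - y k))\<^sup>2 \<le>
      (1 - 2 * decay k + 2 * ((pmax \<alpha> k - pmin \<alpha> k) * (real CARD('p) * L))) * (norm (x k - y k))\<^sup>2 + m k"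
    by (rule joint_step) blast
  define w where "w k = (norm (y (Suc k) - y k))\<^sup>2" for k
  \<comment> \<open>The lagged distance: the left side of \<open>joint_step\<close>, and the change
    of reference point then meets \<open>decay (Suc k)\<close>, the weight in
    \<open>drift_summable\<close>.\<close>
  define u where "u k = (norm (x (Suc k) - y k))\<^sup>2" for k
  have ev_a: "\<forall>\<^sub>F k in sequentially. decay k \<le> 1"
    using order_tendstoD(2)[OF decay_tendsto_0, of 1] by (auto elim: eventually_mono)
  \<comment> \<open>The unequal step sizes use up at most one of the two units of
    \<open>decay k\<close> in the contraction factor.\<close>
  have ev_alpha: "\<forall>\<^sub>F k in sequentially. 2 * ((pmax \<alpha> k - pmin \<alpha> k) * (real CARD('p) * L)) \<le> decay k"
  proof -
    have "(\<lambda>k. (pmax \<alpha> k - pmin \<alpha> k) / decay k * (2 * (real CARD('p) * L))) \<longlonglongrightarrow> 0 * (2 * (real CARD('p) * L))"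
      unfolding decay_def by (intro tendsto_mult tendsto_const rate2)
    then have "\<forall>\<^sub>F k in sequentially. (pmax \<alpha> k - pmin \<alpha> k) / decay k * (2 * (real CARD('p) * L)) < 1"
      by (intro order_tendstoD(2)) auto
    then show ?thesis
    proof eventually_elim
      case (elim k)
      then show ?case using decay_pos[of k] by (simp add: field_simps)
    qed
  qed
  have u0: "u \<longlonglongrightarrow> 0"
  proof (rule contraction_with_summable_error_tendsto_0[where a = "\<lambda>k. decay (Suc k) / 2"
        and m = "\<lambda>k. 2 * ((1 + 1 / decay (Suc k)) * w k) + m (Suc k)"])
    show "0 \<le> u k" for k by (simp add: u_def)
    show "0 \<le> decay (Suc k) / 2" for k using decay_pos[of "Suc k"] by simp
    show "summable (\<lambda>k. 2 * ((1 + 1 / decay (Suc k)) * w k) + m (Suc k))"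
      unfolding w_def using m(1) by (intro summable_add summable_mult drift_summable) (simp add: summable_Suc_iff)
    have ev: "\<forall>\<^sub>F k in sequentially. decay (Suc k) \<le> 1 \<and>
        2 * ((pmax \<alpha> (Suc k) - pmin \<alpha> (Suc k)) * (real CARD('p) * L)) \<le> decay (Suc k)"
      using eventually_conj[OF ev_a ev_alpha] by (subst eventually_sequentially_Suc)
    from ev show "\<forall>\<^sub>F k in sequentially. decay (Suc k) / 2 \<le> 1"
      by eventually_elim simp
    from ev show "\<forall>\<^sub>F k in sequentially. u (Suc k) \<le> (1 - decay (Suc k) / 2) * u k + (2 * ((1 + 1 / decay (Suc k)) * w k) + m (Suc k))"
    proof eventually_elim
      case (elim k)
      define a' where "a' = decay (Suc k)"
      \<comment> \<open>Young's inequality with weight \<open>a' / 2\<close> for passing from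
        \<open>y k\<close> to \<open>y (Suc k)\<close>.\<close>
      define U Z where "U = (norm (x (Suc k) - y (Suc k)))\<^sup>2" and "Z = (1 + a' / 2) * u k + (1 + 1 / (a' / 2)) * w k"
      have a': "0 < a'" "a' \<le> 1" using elim decay_pos by (simp_all add: a'_def)
      have w0: "0 \<le> w k" and u_nonneg: "0 \<le> u k" by (simp_all add: w_def u_def)
      have "(1 - 2 * decay (Suc k) + 2 * ((pmax \<alpha> (Suc k) - pmin \<alpha> (Suc k)) * (real CARD('p) * L))) * U \<le> (1 - a') * U"
        using elim by (intro mult_right_mono) (auto simp: a'_def U_def)
      then have "u (Suc k) \<le> (1 - a') * U + m (Suc k)"
        using m(2)[of "Suc k"] unfolding U_def u_def by linarith
      moreover have "(1 - a') * U \<le> (1 - a') * Z"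
      proof (rule mult_left_mono)
        show "U \<le> Z"
          using power2_norm_add_weighted[of "a' / 2" "x (Suc k) - y k" "y k - y (Suc k)"] a'
          by (simp add: U_def Z_def u_def w_def norm_minus_commute[of "y k"])
      qed (use a' in simp)
      \<comment> \<open>The product is 1 - a'/2 - a'^2/2, so half of the contraction
        survives.\<close>
      moreover have "(1 - a') * (1 + a' / 2) * u k \<le> (1 - a' / 2) * u k"
        using a' u_nonneg by (intro mult_right_mono) (auto simp: algebra_simps)
      moreover have "(1 - a') * ((1 + 1 / (a' / 2)) * w k) \<le> 1 * (2 * ((1 + 1 / a') * w k))"
      proof (rule mult_mono)
        have "(1 + 1 / (a' / 2)) * w k \<le> (2 * (1 + 1 / a')) * w k"
          using w0 by (intro mult_right_mono) auto
        then show "(1 + 1 / (a' / 2)) * w k \<le> 2 * ((1 + 1 / a') * w k)" by (simp only: mult.assoc)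
      qed (use a' w0 in auto)
      moreover have "(1 - a') * Z = (1 - a') * (1 + a' / 2) * u k + (1 - a') * ((1 + 1 / (a' / 2)) * w k)"
        unfolding Z_def distrib_left[of "1 - a'" "(1 + a' / 2) * u k"] mult.assoc ..
      ultimately show ?case unfolding a'_def[symmetric] by linarith
    qed
    \<comment> \<open>Starting at index 1 loses only the summand \<open>decay 0\<close>.\<close>
    have "filterlim (\<lambda>n. \<Sum>k<Suc n. decay k) at_top sequentially"
      using filterlim_sequentially_Suc[of "\<lambda>n. \<Sum>k<n. decay k" at_top] rate3[folded decay_def] by (rule iffD2)
    then have "filterlim (\<lambda>n. (1 / 2) * (- decay 0 + (\<Sum>k<Suc n. decay k))) at_top sequentially"
      by (intro filterlim_tendsto_pos_mult_at_top[OF tendsto_const] filterlim_tendsto_add_at_top[OF tendsto_const])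
        simp_all
    moreover have "(1 / 2) * (- decay 0 + (\<Sum>k<Suc n. decay k)) = (\<Sum>k<n. decay (Suc k) / 2)" for n
      by (simp add: sum.lessThan_Suc_shift sum_divide_distrib[symmetric] del: sum.lessThan_Suc)
    ultimately show "filterlim (\<lambda>n. \<Sum>k<n. decay (Suc k) / 2) at_top sequentially" by simp
  qed
  \<comment> \<open>Needed to undo the lag. The weight in \<open>drift_summable\<close> is at least
    1, so the drift itself tends to 0.\<close>
  have w0: "w \<longlonglongrightarrow> 0"
  proof (rule tendsto_sandwich[OF _ _ tendsto_const summable_LIMSEQ_zero[OF drift_summable]])
    show "\<forall>\<^sub>F k in sequentially. w k \<le> (1 + 1 / decay (Suc k)) * (norm (y (Suc k) - y k))\<^sup>2"
      using decay_pos by (auto simp: w_def mult_right_mono algebra_simps less_imp_le intro!: always_eventually)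
  qed (simp add: w_def)
  have "(\<lambda>k. sqrt (w k)) \<longlonglongrightarrow> sqrt 0" "(\<lambda>k. sqrt (u k)) \<longlonglongrightarrow> sqrt 0"
    by (rule tendsto_real_sqrt[OF w0], rule tendsto_real_sqrt[OF u0])
  then have "(\<lambda>k. y (Suc k) - y k) \<longlonglongrightarrow> 0" "(\<lambda>k. x (Suc k) - y k) \<longlonglongrightarrow> 0"
    by (simp_all add: w_def u_def tendsto_norm_zero_iff)
  from tendsto_diff[OF this(2,1)] have "(\<lambda>k. x (Suc k) - y (Suc k)) \<longlonglongrightarrow> 0" by simp
  then show ?thesis unfolding y_def by (rule LIMSEQ_imp_Suc)
qed

end

section \<open>Noise and measurability\<close>

lemma AE_all_finite:
  fixes P :: "'i::finite \<Rightarrow> 'a \<Rightarrow> bool"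
  assumes "\<And>i. AE x in M. P i x"
  shows "AE x in M. \<forall>i. P i x"
  using AE_finite_allI[of UNIV P M] assms by simp

lemma nn_integral_le_of_nn_cond_exp_le:
  assumes "prob_space M" "subalgebra M G" and f: "f \<in> borel_measurable M"
    and le: "AE \<omega> in M. nn_cond_exp M G f \<omega> \<le> c"
  shows "(\<integral>\<^sup>+\<omega>. f \<omega> \<partial>M) \<le> c"
proof -
  interpret prob_space M by fact
  interpret finite_measure_subalgebra M G by unfold_locales fact
  have "(\<integral>\<^sup>+\<omega>. f \<omega> \<partial>M) = (\<integral>\<^sup>+\<omega>. nn_cond_exp M G f \<omega> \<partial>M)"
    using nn_cond_exp_intg[of "\<lambda>_. 1" f] f by simp
  also have "\<dots> \<le> (\<integral>\<^sup>+\<omega>. c \<partial>M)" by (rule nn_integral_mono_AE[OF le])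
  finally show ?thesis by (simp add: emeasure_space_1)
qed

context
  fixes M :: "'w measure" and G :: "nat \<Rightarrow> 'w measure" and Z :: "nat \<Rightarrow> 'w \<Rightarrow> real^'c::finite"
    and u :: real and t :: "nat \<Rightarrow> real"
  assumes prob: "prob_space M" and subalg: "\<And>k. subalgebra M (G k)"
    and Z_meas: "\<And>k. Z k \<in> borel_measurable M"
    and Z_variance: "\<And>k. AE \<omega> in M. nn_cond_exp M (G k) (\<lambda>\<omega>'. ennreal ((norm (Z k \<omega>'))\<^sup>2)) \<omega> \<le> ennreal (u\<^sup>2)"
    and t_sq: "summable (\<lambda>k. (t k)\<^sup>2)"
begin

lemma noise_second_moment: "(\<integral>\<^sup>+\<omega>. ennreal ((norm (Z k \<omega>))\<^sup>2) \<partial>M) \<le> ennreal (u\<^sup>2)"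
  using nn_integral_le_of_nn_cond_exp_le[OF prob subalg _ Z_variance[of k]] Z_meas[of k] by measurable

lemma noise_square_integrable:
  "integrable M (\<lambda>\<omega>. (norm (Z k \<omega>))\<^sup>2)" "(\<integral>\<omega>. (norm (Z k \<omega>))\<^sup>2 \<partial>M) \<le> u\<^sup>2"
proof -
  have [measurable]: "Z k \<in> borel_measurable M" by (rule Z_meas)
  show int: "integrable M (\<lambda>\<omega>. (norm (Z k \<omega>))\<^sup>2)"
    using noise_second_moment[of k] by (intro integrableI_nonneg) (auto intro: le_less_trans)
  have "ennreal (\<integral>\<omega>. (norm (Z k \<omega>))\<^sup>2 \<partial>M) \<le> ennreal (u\<^sup>2)"
    using noise_second_moment[of k] by (subst nn_integral_eq_integral[OF int, symmetric]) auto
  then show "(\<integral>\<omega>. (norm (Z k \<omega>))\<^sup>2 \<partial>M) \<le> u\<^sup>2" by simp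
qed

text \<open>The series has finite expectation by exchanging sum and integral, so it is finite almost
  surely.\<close>

lemma AE_weighted_noise_square_summable:
  "AE \<omega> in M. summable (\<lambda>k. (t k)\<^sup>2 * (norm (Z k \<omega>))\<^sup>2)"
proof -
  have [measurable]: "Z k \<in> borel_measurable M" for k by (rule Z_meas)
  let ?f = "\<lambda>k \<omega>. (t k)\<^sup>2 * (norm (Z k \<omega>))\<^sup>2"
  have "(\<integral>\<^sup>+\<omega>. (\<Sum>k. ennreal (?f k \<omega>)) \<partial>M) = (\<Sum>k. \<integral>\<^sup>+\<omega>. ennreal (?f k \<omega>) \<partial>M)"
    by (intro nn_integral_suminf) measurable
  also have "\<dots> \<le> (\<Sum>k. ennreal ((t k)\<^sup>2 * u\<^sup>2))"
  proof (rule suminf_le)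
    fix k
    have "(\<integral>\<^sup>+\<omega>. ennreal (?f k \<omega>) \<partial>M) = ennreal ((t k)\<^sup>2) * (\<integral>\<^sup>+\<omega>. ennreal ((norm (Z k \<omega>))\<^sup>2) \<partial>M)"
      by (subst nn_integral_cmult[symmetric]) (simp_all add: ennreal_mult)
    also have "\<dots> \<le> ennreal ((t k)\<^sup>2) * ennreal (u\<^sup>2)" by (intro mult_left_mono noise_second_moment) simp
    finally show "(\<integral>\<^sup>+\<omega>. ennreal (?f k \<omega>) \<partial>M) \<le> ennreal ((t k)\<^sup>2 * u\<^sup>2)" by (simp add: ennreal_mult)
  qed auto
  also have "\<dots> = ennreal (\<Sum>k. (t k)\<^sup>2 * u\<^sup>2)"
    by (rule suminf_ennreal2) (auto intro: summable_mult2 t_sq)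
  also have "\<dots> < \<infinity>" by simp
  finally have "AE \<omega> in M. (\<Sum>k. ennreal (?f k \<omega>)) \<noteq> \<infinity>"
    by (intro nn_integral_PInf_AE) auto
  then show ?thesis
    by eventually_elim (rule summable_suminf_not_top, auto)
qed

lemma AE_weighted_noise_inner_summable:
  assumes mono: "\<And>k. sets (G k) \<subseteq> sets (G (Suc k))"
    and Z_adapted: "\<And>k. Z k \<in> borel_measurable (G (Suc k))"
    and Z_int: "\<And>k. integrable M (Z k)"
    and Z_centered: "\<And>k. AE \<omega> in M. vec_cond_exp M (G k) (Z k) \<omega> = 0"
    and p: "\<And>k. p k \<in> borel_measurable (G k)" and b: "\<And>k \<omega>. \<omega> \<in> space M \<Longrightarrow> norm (p k \<omega>) \<le> b"
  shows "AE \<omega> in M. summable (\<lambda>k. t k * (p k \<omega> \<bullet> Z k \<omega>))"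
proof -
  interpret prob_space M by (rule prob)
  have [measurable]: "Z k \<in> borel_measurable M" for k by (rule Z_meas)
  have pM [measurable]: "p k \<in> borel_measurable M" for k by (rule measurable_from_subalg[OF subalg p])
  define m where "m k \<omega> = t k * (p k \<omega> \<bullet> Z k \<omega>)" for k \<omega>
  have m_sq: "(m k \<omega>)\<^sup>2 \<le> (t k)\<^sup>2 * (b\<^sup>2 * (norm (Z k \<omega>))\<^sup>2)" if "\<omega> \<in> space M" for k \<omega>
  proof -
    have "\<bar>p k \<omega> \<bullet> Z k \<omega>\<bar> \<le> b * norm (Z k \<omega>)"
      by (rule order_trans[OF Cauchy_Schwarz_ineq2 mult_right_mono[OF b[OF that]]]) simp
    then have "\<bar>p k \<omega> \<bullet> Z k \<omega>\<bar>\<^sup>2 \<le> (b * norm (Z k \<omega>))\<^sup>2" by (rule power_mono) simp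
    then show ?thesis by (simp add: m_def power_mult_distrib mult_left_mono)
  qed
  have dominating: "integrable M (\<lambda>\<omega>. (t k)\<^sup>2 * (b\<^sup>2 * (norm (Z k \<omega>))\<^sup>2))" for k
    by (intro integrable_mult_right noise_square_integrable(1))
  have m_meas [measurable]: "m k \<in> borel_measurable M" for k unfolding m_def by measurable
  have m_int: "integrable M (\<lambda>\<omega>. (m k \<omega>)\<^sup>2)" for k
    by (rule Bochner_Integration.integrable_bound[OF dominating[of k]])
      (use m_sq in \<open>auto intro!: AE_I2\<close>)
  have "square_integrable_martingale_differences M G m"
  proof unfold_locales
    fix k
    show "m k \<in> borel_measurable (G (Suc k))"
    proof -
      have "subalgebra (G (Suc k)) (G k)"
        using subalg[of k] subalg[of "Suc k"] mono[of k] by (simp add: subalgebra_def)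
      from measurable_from_subalg[OF this p] have [measurable]: "p k \<in> borel_measurable (G (Suc k))" .
      have [measurable]: "Z k \<in> borel_measurable (G (Suc k))" by (rule Z_adapted)
      show ?thesis unfolding m_def by measurable
    qed
    interpret finite_measure_subalgebra M "G k" by unfold_locales (rule subalg)
    \<comment> \<open>The conditional expectation is componentwise, so the known factor is pulled
      out in each coordinate separately.\<close>
    define pc where "pc c \<omega> = t k * p k \<omega> $ c" for c \<omega>
    have pc_meas: "pc c \<in> borel_measurable (G k)" for c
    proof -
      have "(\<lambda>\<omega>. p k \<omega> $ c) \<in> borel_measurable (G k)"
        by (rule borel_measurable_continuous_on[OF linear_continuous_on[OF bounded_linear_vec_nth] p])
      then show ?thesis unfolding pc_def by measurable
    qed
    have Zc_int: "integrable M (\<lambda>\<omega>. Z k \<omega> $ c)" for c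
      using integrable_bounded_linear[OF bounded_linear_vec_nth Z_int] .
    have int: "integrable M (\<lambda>\<omega>. pc c \<omega> * Z k \<omega> $ c)" for c
    proof (rule Bochner_Integration.integrable_bound)
      show "integrable M (\<lambda>\<omega>. (\<bar>t k\<bar> * b) * \<bar>Z k \<omega> $ c\<bar>)" by (intro integrable_mult_right integrable_abs Zc_int)
      show "AE \<omega> in M. norm (pc c \<omega> * Z k \<omega> $ c) \<le> norm ((\<bar>t k\<bar> * b) * \<bar>Z k \<omega> $ c\<bar>)"
      proof (rule AE_I2)
        fix \<omega> assume \<omega>: "\<omega> \<in> space M"
        have "\<bar>p k \<omega> $ c\<bar> \<le> b" using component_le_norm_cart b[OF \<omega>] order_trans by blast
        then have "\<bar>t k\<bar> * \<bar>p k \<omega> $ c\<bar> * \<bar>Z k \<omega> $ c\<bar> \<le> \<bar>t k\<bar> * \<bar>b\<bar> * \<bar>Z k \<omega> $ c\<bar>"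
          by (intro mult_right_mono mult_left_mono) auto
        then show "norm (pc c \<omega> * Z k \<omega> $ c) \<le> norm ((\<bar>t k\<bar> * b) * \<bar>Z k \<omega> $ c\<bar>)"
          by (simp add: pc_def abs_mult)
      qed
      show "(\<lambda>\<omega>. pc c \<omega> * Z k \<omega> $ c) \<in> borel_measurable M"
        using measurable_from_subalg[OF subalg pc_meas] borel_measurable_integrable[OF Zc_int]
        by (rule borel_measurable_times)
    qed
    have eq: "m k = (\<lambda>\<omega>. \<Sum>c\<in>UNIV. pc c \<omega> * Z k \<omega> $ c)"
      by (simp add: fun_eq_iff m_def pc_def inner_vec_def sum_distrib_left mult.assoc)
    have sum: "AE \<omega> in M. real_cond_exp M (G k) (m k) \<omega> = (\<Sum>c\<in>UNIV. real_cond_exp M (G k) (\<lambda>\<omega>. pc c \<omega> * Z k \<omega> $ c) \<omega>)"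
      unfolding eq by (rule real_cond_exp_sum[OF int])
    have "AE \<omega> in M. \<forall>c\<in>UNIV. real_cond_exp M (G k) (\<lambda>\<omega>. pc c \<omega> * Z k \<omega> $ c) \<omega>
        = pc c \<omega> * real_cond_exp M (G k) (\<lambda>\<omega>. Z k \<omega> $ c) \<omega>"
      by (intro AE_finite_allI real_cond_exp_mult pc_meas int borel_measurable_integrable[OF Zc_int]) auto
    with sum Z_centered[of k] show "AE \<omega> in M. real_cond_exp M (G k) (m k) \<omega> = 0"
      by eventually_elim (simp add: vec_cond_exp_def vec_eq_iff)
  qed (use subalg mono m_int in auto)
  moreover have "summable (\<lambda>k. \<integral>\<omega>. (m k \<omega>)\<^sup>2 \<partial>M)"
  proof (rule summable_comparison_test'[where N = 0])
    show "summable (\<lambda>k. (t k)\<^sup>2 * (b\<^sup>2 * u\<^sup>2))" by (rule summable_mult2[OF t_sq])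
    fix k
    have "(\<integral>\<omega>. (m k \<omega>)\<^sup>2 \<partial>M) \<le> (\<integral>\<omega>. (t k)\<^sup>2 * (b\<^sup>2 * (norm (Z k \<omega>))\<^sup>2) \<partial>M)"
      by (rule integral_mono[OF m_int dominating m_sq])
    also have "\<dots> = (t k)\<^sup>2 * (b\<^sup>2 * (\<integral>\<omega>. (norm (Z k \<omega>))\<^sup>2 \<partial>M))" by simp
    also have "\<dots> \<le> (t k)\<^sup>2 * (b\<^sup>2 * u\<^sup>2)"
      by (intro mult_left_mono noise_square_integrable(2)) auto
    finally show "norm (\<integral>\<omega>. (m k \<omega>)\<^sup>2 \<partial>M) \<le> (t k)\<^sup>2 * (b\<^sup>2 * u\<^sup>2)" by simp
  qed
  ultimately show ?thesis
    using square_summable_martingale_differences_converge unfolding m_def by blast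
qed

end

lemma space_noise_history [simp]: "space (noise_history M x0 \<zeta> k) = space M"
  by (simp add: noise_history_def space_measure_of_conv)

lemma sets_noise_history:
  "sets (noise_history M x0 \<zeta> k) = sigma_sets (space M)
     ({x0 -` A \<inter> space M |A. A \<in> sets borel} \<union>
      {\<zeta> l i -` A \<inter> space M |l i A. l < k \<and> A \<in> sets borel})"
  unfolding noise_history_def by (rule sets_measure_of) auto

lemma noise_history_mono: "k \<le> l \<Longrightarrow> sets (noise_history M x0 \<zeta> k) \<subseteq> sets (noise_history M x0 \<zeta> l)"
  unfolding sets_noise_history
  by (rule sigma_sets_mono', rule Un_mono[OF order_refl]) (blast intro: less_le_trans)

lemma subalgebra_noise_history:
  assumes "x0 \<in> borel_measurable M" "\<And>l i. \<zeta> l i \<in> borel_measurable M"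
  shows "subalgebra M (noise_history M x0 \<zeta> k)"
  unfolding subalgebra_def space_noise_history sets_noise_history
  using assms by (intro conjI refl sets.sigma_sets_subset) (auto intro: measurable_sets)

lemma initial_measurable_noise_history: "x0 \<in> borel_measurable (noise_history M x0 \<zeta> k)"
  by (rule measurableI) (auto simp: sets_noise_history intro!: sigma_sets.Basic)

lemma noise_measurable_noise_history: "l < k \<Longrightarrow> \<zeta> l i \<in> borel_measurable (noise_history M x0 \<zeta> k)"
  by (rule measurableI) (auto simp: sets_noise_history intro!: sigma_sets.Basic)

text \<open>\<open>h\<close> and \<open>F\<close> are continuous only over the domains of the
  players; the composition goes through the restricted space.\<close>

lemma measurable_compose_continuous_on:
  assumes "continuous_on S f" "\<And>\<omega>. \<omega> \<in> space N \<Longrightarrow> g \<omega> \<in> S" "g \<in> borel_measurable N"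
  shows "(\<lambda>\<omega>. f (g \<omega>)) \<in> borel_measurable N"
  by (rule measurable_compose[OF measurable_restrict_space2 borel_measurable_continuous_on_restrict[OF assms(1)]])
    (use assms in auto)

text \<open>The lower bound 1 squeezes the limes inferior between 1 and the limes superior.\<close>

lemma tendsto_1_if_limsup_1:
  fixes f :: "nat \<Rightarrow> real"
  assumes "limsup (\<lambda>k. ereal (f k)) = 1" "\<And>k. 1 \<le> f k"
  shows "f \<longlonglongrightarrow> 1"
proof -
  have "1 \<le> liminf (\<lambda>k. ereal (f k))" by (rule Liminf_bounded) (use assms(2) in auto)
  moreover have "liminf (\<lambda>k. ereal (f k)) \<le> limsup (\<lambda>k. ereal (f k))"
    by (rule Liminf_le_Limsup) simp
  ultimately have "liminf (\<lambda>k. ereal (f k)) = 1" using assms(1) by simp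
  then have "(\<lambda>k. ereal (f k)) \<longlonglongrightarrow> 1"
    using assms(1) by (intro Liminf_eq_Limsup) auto
  then show ?thesis by (simp add: one_ereal_def)
qed

section \<open>Adaptedness of the run to the noise history\<close>

context aggregative_game
begin

lemma prox_continuous:
  assumes "t > 0"
  shows "continuous_on UNIV (prox (block_space own i) t (r i))"
proof (rule lipschitz_on_continuous_on)
  show "1-lipschitz_on UNIV (prox (block_space own i) t (r i))"
    by (rule lipschitz_onI)
      (use prox_point_nonexpansive[OF prox_is_prox_point prox_is_prox_point] assms in \<open>auto simp: dist_norm\<close>)
qed

lemma block_measurable: "g \<in> borel_measurable G \<Longrightarrow> (\<lambda>\<omega>. B i (g \<omega>)) \<in> borel_measurable G"
  by (rule borel_measurable_continuous_on[OF linear_continuous_on[OF bounded_linear_block]])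

text \<open>Written with \<open>F\<close> and \<open>\<zeta>\<close>, a step is a continuous
  function of the current state and the current noise: \<open>F\<close> and \<open>h\<close> are
  continuous on the domains and the proximal map is 1-Lipschitz. Thus \<open>x k\<close> depends
  measurably on \<open>x 0\<close> and the noise before \<open>k\<close>.\<close>

lemma run_measurable:
  fixes x :: "nat \<Rightarrow> 'w \<Rightarrow> real^'c" and v vh \<zeta> :: "nat \<Rightarrow> 'p \<Rightarrow> 'w \<Rightarrow> real^'c"
  assumes x_init: "\<And>\<omega>. \<omega> \<in> space M \<Longrightarrow> x 0 \<omega> \<in> XX"
    and \<alpha>: "\<And>k i. \<alpha> k i > 0"
    and v_init: "\<And>i \<omega>. \<omega> \<in> space M \<Longrightarrow> v 0 i \<omega> = h i (B i (x 0 \<omega>))"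
    and vh_step: "\<And>k i \<omega>. \<omega> \<in> space M \<Longrightarrow> vh k i \<omega> = (\<Sum>j\<in>UNIV. (W k $ i $ j) *\<^sub>R v k j \<omega>)"
    and x_step: "\<And>k i \<omega>. \<omega> \<in> space M \<Longrightarrow> B i (x (Suc k) \<omega>) =
        prox (block_space own i) (\<alpha> k i) (r i) (B i (x k \<omega>) - \<alpha> k i *\<^sub>R
          (F i (B i (x k \<omega>)) (real CARD('p) *\<^sub>R vh k i \<omega>) + \<zeta> k i \<omega> + \<eta> k i *\<^sub>R B i (x k \<omega>)))"
    and v_step: "\<And>k i \<omega>. \<omega> \<in> space M \<Longrightarrow>
        v (Suc k) i \<omega> = vh k i \<omega> + h i (B i (x (Suc k) \<omega>)) - h i (B i (x k \<omega>))"
  shows "\<omega> \<in> space M \<Longrightarrow> x k \<omega> \<in> XX"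
    and "x k \<in> borel_measurable (noise_history M (x 0) \<zeta> k)"
proof -
  let ?G = "noise_history M (x 0) \<zeta>"
  have inX: "x k \<omega> \<in> XX" if \<omega>: "\<omega> \<in> space M" for k \<omega>
  proof (cases k)
    case (Suc l)
    then show ?thesis
      using prox_is_prox_point[OF \<alpha>] unfolding joint_dom_def prox_point_def by (simp add: x_step[OF \<omega>])
  qed (simp add: x_init \<omega>)
  then show "\<omega> \<in> space M \<Longrightarrow> x k \<omega> \<in> XX" .
  have h_meas: "(\<lambda>\<omega>. h i (B i (x k \<omega>))) \<in> borel_measurable G"
    if "x k \<in> borel_measurable G" "space G = space M" for i k G
    by (rule measurable_compose_continuous_on[OF h_continuous _ block_measurable])
      (use that inX block_in_X in auto)
  \<comment> \<open>\<open>v\<close> joins the induction because the step of \<open>x\<close> uses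
    the averaged estimates.\<close>
  have "x k \<in> borel_measurable (?G k) \<and> (\<forall>i. v k i \<in> borel_measurable (?G k))" for k
  proof (induction k)
    case 0
    have x0: "x 0 \<in> borel_measurable (?G 0)" by (rule initial_measurable_noise_history)
    moreover have "v 0 i \<in> borel_measurable (?G 0)" for i
      using h_meas[OF x0, of i] by (subst measurable_cong[of _ _ "\<lambda>\<omega>. h i (B i (x 0 \<omega>))"]) (simp_all add: v_init)
    ultimately show ?case by blast
  next
    case (Suc k)
    have sub: "subalgebra (?G (Suc k)) (?G k)"
      unfolding subalgebra_def by (simp add: noise_history_mono)
    have x [measurable]: "x k \<in> borel_measurable (?G (Suc k))"
      by (rule measurable_from_subalg[OF sub]) (use Suc in blast)
    have v [measurable]: "v k j \<in> borel_measurable (?G (Suc k))" for j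
      by (rule measurable_from_subalg[OF sub]) (use Suc in blast)
    have \<zeta> [measurable]: "\<zeta> k i \<in> borel_measurable (?G (Suc k))" for i
      by (rule noise_measurable_noise_history) simp
    have vh [measurable]: "vh k i \<in> borel_measurable (?G (Suc k))" for i
    proof -
      have "(\<lambda>\<omega>. \<Sum>j\<in>UNIV. (W k $ i $ j) *\<^sub>R v k j \<omega>) \<in> borel_measurable (?G (Suc k))" by measurable
      then show ?thesis by (subst measurable_cong[OF vh_step]) simp_all
    qed
    have Bx [measurable]: "(\<lambda>\<omega>. B i (x k \<omega>)) \<in> borel_measurable (?G (Suc k))" for i
      by (rule block_measurable[OF x])
    have Fm [measurable]: "(\<lambda>\<omega>. F i (B i (x k \<omega>)) (real CARD('p) *\<^sub>R vh k i \<omega>)) \<in> borel_measurable (?G (Suc k))" for i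
    proof -
      have "(\<lambda>\<omega>. (\<lambda>(y, s). F i y s) (B i (x k \<omega>), real CARD('p) *\<^sub>R vh k i \<omega>)) \<in> borel_measurable (?G (Suc k))"
      proof (rule measurable_compose_continuous_on[OF F_continuous])
        show "(\<lambda>\<omega>. (B i (x k \<omega>), real CARD('p) *\<^sub>R vh k i \<omega>)) \<in> borel_measurable (?G (Suc k))"
          by (intro borel_measurable_Pair) measurable
      qed (use inX block_in_X in auto)
      then show ?thesis by simp
    qed
    have Bx': "(\<lambda>\<omega>. B i (x (Suc k) \<omega>)) \<in> borel_measurable (?G (Suc k))" for i
    proof -
      have "(\<lambda>\<omega>. prox (block_space own i) (\<alpha> k i) (r i) (B i (x k \<omega>) - \<alpha> k i *\<^sub>R
          (F i (B i (x k \<omega>)) (real CARD('p) *\<^sub>R vh k i \<omega>) + \<zeta> k i \<omega> + \<eta> k i *\<^sub>R B i (x k \<omega>))))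
          \<in> borel_measurable (?G (Suc k))"
        by (rule borel_measurable_continuous_on[OF prox_continuous[OF \<alpha>]]) measurable
      then show ?thesis by (subst measurable_cong[OF x_step]) simp_all
    qed
    have x': "x (Suc k) \<in> borel_measurable (?G (Suc k))"
    proof -
      have "(\<lambda>\<omega>. \<Sum>i\<in>UNIV. B i (x (Suc k) \<omega>)) \<in> borel_measurable (?G (Suc k))"
        by (rule borel_measurable_sum[OF Bx'])
      then show ?thesis by (simp add: sum_block)
    qed
    moreover have "v (Suc k) i \<in> borel_measurable (?G (Suc k))" for i
    proof -
      have [measurable]: "(\<lambda>\<omega>. h i (B i (x k \<omega>))) \<in> borel_measurable (?G (Suc k))"
        "(\<lambda>\<omega>. h i (B i (x (Suc k) \<omega>))) \<in> borel_measurable (?G (Suc k))"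
        by (rule h_meas[OF x] h_meas[OF x'], simp)+
      have "(\<lambda>\<omega>. vh k i \<omega> + h i (B i (x (Suc k) \<omega>)) - h i (B i (x k \<omega>))) \<in> borel_measurable (?G (Suc k))"
        by measurable
      then show ?thesis by (subst measurable_cong[OF v_step]) simp_all
    qed
    ultimately show ?case by blast
  qed
  then show "x k \<in> borel_measurable (?G k)" by blast
qed

end

theorem theorem1:
  fixes own :: "'c::finite \<Rightarrow> 'p::finite"
    and ownd :: "'d::finite \<Rightarrow> 'p"
    and M :: "'w measure"
    and h :: "'p \<Rightarrow> real^'c \<Rightarrow> real^'c"
    and \<psi> :: "'p \<Rightarrow> real^'c \<Rightarrow> real^'c \<Rightarrow> real^'d \<Rightarrow> real"
    and r :: "'p \<Rightarrow> real^'c \<Rightarrow> ereal"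
    and \<xi> :: "'p \<Rightarrow> 'w \<Rightarrow> real^'d"
    and \<xi>s :: "nat \<Rightarrow> 'p \<Rightarrow> 'w \<Rightarrow> real^'d"
    and f :: "'p \<Rightarrow> real^'c \<Rightarrow> real^'c \<Rightarrow> real"
    and F :: "'p \<Rightarrow> real^'c \<Rightarrow> real^'c \<Rightarrow> real^'c"
    and q :: "'p \<Rightarrow> real^'c \<Rightarrow> real^'c \<Rightarrow> real^'d \<Rightarrow> real^'c"
    and X :: "'p \<Rightarrow> (real^'c) set"
    and L :: real and Lh \<upsilon> :: "'p \<Rightarrow> real"
    and E :: "nat \<Rightarrow> ('p \<times> 'p) set"
    and W :: "nat \<Rightarrow> real^'p^'p"
    and \<alpha> \<eta> :: "nat \<Rightarrow> 'p \<Rightarrow> real"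
    and x :: "nat \<Rightarrow> 'w \<Rightarrow> real^'c"
    and v vh \<zeta> :: "nat \<Rightarrow> 'p \<Rightarrow> 'w \<Rightarrow> real^'c"
  assumes prob: "prob_space M"
    and h_C1: "\<And>i. continuously_differentiable_on (block_space own i) (\<lambda>y. h i (block own i y))"
    and xi_rv: "\<And>i. \<xi> i \<in> borel_measurable M"
    and xi_range: "\<And>i \<omega>. \<omega> \<in> space M \<Longrightarrow> \<xi> i \<omega> \<in> block_space ownd i"
    and r_proper: "\<And>i y. y \<in> block_space own i \<Longrightarrow> r i y \<noteq> -\<infinity>"
    and f_def: "\<And>i y s. f i y s = (\<integral>\<omega>. \<psi> i y s (\<xi> i \<omega>) \<partial>M)"
    and F_def: "\<And>i y z. F i y z = marginal_grad own h i (f i) y z"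
    and q_def: "\<And>i y z e. q i y z e = marginal_grad own h i (\<lambda>y' s. \<psi> i y' s e) y z"
    and X_def: "\<And>i. X i = eff_dom own r i"
    and r_convex: "\<And>i. ereal_convex_on (block_space own i) (r i)"
    and r_lsc: "\<And>i. lower_semicontinuous_on (block_space own i) (r i)"
    and X_compact: "\<And>i. compact (X i)"
    and cost_convex: "\<And>i y. (\<And>j. j \<noteq> i \<Longrightarrow> block own j y \<in> X j) \<Longrightarrow>
          convex_on (X i) (\<lambda>xi. f i xi (h i xi + others_aggregate own h i y))"
    and f_C1: "\<And>i. \<exists>U. openin (top_of_set (block_space own i \<times> UNIV)) U \<and> X i \<times> UNIV \<subseteq> U \<and>
          (\<forall>(y, s)\<in>U. integrable M (\<lambda>\<omega>. \<psi> i y s (\<xi> i \<omega>))) \<and>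
          continuously_differentiable_on U (\<lambda>(y, s). f i (block own i y) s)"
    and phi_lipschitz: "L-lipschitz_on (joint_dom own r) (pseudo_grad own h f)"
    and phi_monotone: "\<And>y y'. y \<in> joint_dom own r \<Longrightarrow> y' \<in> joint_dom own r \<Longrightarrow>
          (pseudo_grad own h f y - pseudo_grad own h f y') \<bullet> (y - y') \<ge> 0"
    and h_lipschitz: "\<And>i. (Lh i)-lipschitz_on (X i) (h i)"
    and F_lipschitz: "\<And>i cz. cz > 0 \<Longrightarrow> \<exists>Lf. \<forall>y\<in>X i. \<forall>z1 z2. norm z1 \<le> cz \<longrightarrow> norm z2 \<le> cz \<longrightarrow>
          norm (F i y z1 - F i y z2) \<le> Lf * norm (z1 - z2)"
    and psi_differentiable: "\<And>i. \<exists>C. openin (top_of_set (block_space own i)) C \<and> X i \<subseteq> C \<and>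
          (\<forall>e\<in>block_space ownd i. \<forall>y\<in>C. \<forall>s.
             (\<lambda>(y', s'). \<psi> i (block own i y') s' e) differentiable (at (y, s)))"
    and upsilon_pos: "\<And>i. \<upsilon> i > 0"
    and q_integrable: "\<And>i y z. y \<in> X i \<Longrightarrow> integrable M (\<lambda>\<omega>. q i y z (\<xi> i \<omega>))"
    and q_mean: "\<And>i y z. y \<in> X i \<Longrightarrow> (\<integral>\<omega>. q i y z (\<xi> i \<omega>) \<partial>M) = F i y z"
    and q_variance: "\<And>i y z. y \<in> X i \<Longrightarrow>
          (\<integral>\<^sup>+\<omega>. ennreal ((norm (q i y z (\<xi> i \<omega>) - F i y z))\<^sup>2) \<partial>M) \<le> ennreal ((\<upsilon> i)\<^sup>2)"
    and self_loop: "\<And>k i. (i, i) \<in> E k"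
    and W_edge: "\<And>k i j. W k $ i $ j > 0 \<longleftrightarrow> (j, i) \<in> E k"
    and W_no_edge: "\<And>k i j. (j, i) \<notin> E k \<Longrightarrow> W k $ i $ j = 0"
    and W_stochastic: "\<And>k. doubly_stochastic (W k)"
    and W_lower_bound: "\<exists>c. 0 < c \<and> c < 1 \<and> (\<forall>k i j. (j, i) \<in> E k \<longrightarrow> W k $ i $ j \<ge> c)"
    and E_connected: "\<exists>P::nat. P > 0 \<and> (\<forall>k. strongly_connected (\<Union>l\<in>{1..P}. E (k + l)))"
    and alpha_pos: "\<And>k i. \<alpha> k i > 0" and eta_pos: "\<And>k i. \<eta> k i > 0"
    and alpha_decreasing: "\<And>i. decseq (\<lambda>k. \<alpha> k i)" and eta_decreasing: "\<And>i. decseq (\<lambda>k. \<eta> k i)"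
    and alpha_tendsto: "\<And>i. (\<lambda>k. \<alpha> k i) \<longlonglongrightarrow> 0" and eta_tendsto: "\<And>i. (\<lambda>k. \<eta> k i) \<longlonglongrightarrow> 0"
    and rate1: "(\<lambda>k. (pmax \<alpha> k)\<^sup>2 / (pmin \<alpha> k * pmin \<eta> k)) \<longlonglongrightarrow> 0"
    and rate2: "(\<lambda>k. (pmax \<alpha> k - pmin \<alpha> k) / (pmin \<alpha> k * pmin \<eta> k)) \<longlonglongrightarrow> 0"
    and rate3: "filterlim (\<lambda>n. \<Sum>k<n. pmin \<alpha> k * pmin \<eta> k) at_top sequentially"
    and rate4: "\<And>i. summable (\<lambda>k. (\<alpha> k i)\<^sup>2)"
    and rate5: "summable (\<lambda>k. (1 + 1 / (pmin \<alpha> (Suc k) * pmin \<eta> (Suc k))) *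
          ((pmax \<eta> k - pmin \<eta> (Suc k))\<^sup>2 / (pmin \<eta> (Suc k))\<^sup>2))"
    and x_init_rv: "x 0 \<in> borel_measurable M"
    and x_init: "\<And>i \<omega>. \<omega> \<in> space M \<Longrightarrow> block own i (x 0 \<omega>) \<in> X i"
    and v_init: "\<And>i \<omega>. \<omega> \<in> space M \<Longrightarrow> v 0 i \<omega> = h i (block own i (x 0 \<omega>))"
    and vh_step: "\<And>k i \<omega>. \<omega> \<in> space M \<Longrightarrow>
          vh k i \<omega> = (\<Sum>j\<in>{j. (j, i) \<in> E k}. (W k $ i $ j) *\<^sub>R v k j \<omega>)"
    and x_step: "\<And>k i \<omega>. \<omega> \<in> space M \<Longrightarrow>
          block own i (x (Suc k) \<omega>) =
            prox (block_space own i) (\<alpha> k i) (r i)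
              (block own i (x k \<omega>) - \<alpha> k i *\<^sub>R
                 (q i (block own i (x k \<omega>)) (real CARD('p) *\<^sub>R vh k i \<omega>) (\<xi>s k i \<omega>)
                  + \<eta> k i *\<^sub>R block own i (x k \<omega>)))"
    and v_step: "\<And>k i \<omega>. \<omega> \<in> space M \<Longrightarrow>
          v (Suc k) i \<omega> = vh k i \<omega> + h i (block own i (x (Suc k) \<omega>)) - h i (block own i (x k \<omega>))"
    and xis_rv: "\<And>k i. \<xi>s k i \<in> borel_measurable M"
    and xis_range: "\<And>k i \<omega>. \<omega> \<in> space M \<Longrightarrow> \<xi>s k i \<omega> \<in> block_space ownd i"
    and xis_law: "\<And>k i. distr M borel (\<xi>s k i) = distr M borel (\<xi> i)"
    and zeta_def: "\<And>k i \<omega>. \<zeta> k i \<omega> =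
          q i (block own i (x k \<omega>)) (real CARD('p) *\<^sub>R vh k i \<omega>) (\<xi>s k i \<omega>)
          - F i (block own i (x k \<omega>)) (real CARD('p) *\<^sub>R vh k i \<omega>)"
    and zeta_integrable: "\<And>k i. integrable M (\<zeta> k i)"
    and zeta_mean: "\<And>k i. AE \<omega> in M. vec_cond_exp M (noise_history M (x 0) \<zeta> k) (\<zeta> k i) \<omega> = 0"
    and zeta_variance: "\<And>k i. AE \<omega> in M.
          nn_cond_exp M (noise_history M (x 0) \<zeta> k) (\<lambda>\<omega>'. ennreal ((norm (\<zeta> k i \<omega>'))\<^sup>2)) \<omega>
          \<le> ennreal ((\<upsilon> i)\<^sup>2)"
  shows "AE \<omega> in M.
      (limsup (\<lambda>k. ereal (pmax \<eta> k / pmin \<eta> k)) < \<infinity> \<longrightarrow>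
         (\<forall>xl s. strict_mono (s :: nat \<Rightarrow> nat) \<longrightarrow> (\<lambda>n. x (s n) \<omega>) \<longlonglongrightarrow> xl \<longrightarrow>
            xl \<in> nash_equilibria own h f r)) \<and>
      (limsup (\<lambda>k. ereal (pmax \<eta> k / pmin \<eta> k)) = 1 \<longrightarrow>
         (\<exists>xs. {y. is_arg_min norm (\<lambda>y. y \<in> nash_equilibria own h f r) y} = {xs} \<and>
            (\<lambda>k. x k \<omega>) \<longlonglongrightarrow> xs))"
proof -
  interpret prob_space M by (rule prob)
  have F_eq: "F i = marginal_grad own h i (f i)" for i by (intro ext) (rule F_def)
  have X_eq: "X = eff_dom own r" by (intro ext) (rule X_def)
  have x0: "x 0 \<omega> \<in> joint_dom own r" if "\<omega> \<in> space M" for \<omega>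
    using x_init[OF that] by (simp add: joint_dom_def X_eq)
  \<comment> \<open>A probability space has a sample point, and the initial iterate there shows that
    the joint domain is nonempty.\<close>
  obtain \<omega>0 where "\<omega>0 \<in> space M" using not_empty by blast
  then have nonempty: "joint_dom own r \<noteq> {}" using x0 by blast
  interpret game: aggregative_game own h f r L
  proof unfold_locales
    fix i
    show "\<exists>U. eff_dom own r i \<times> UNIV \<subseteq> U \<and> continuously_differentiable_on U (\<lambda>(y, s). f i (block own i y) s)"
      using f_C1[of i] unfolding X_eq by blast
    show "compact (eff_dom own r i)" using X_compact[of i] unfolding X_eq .
    show "convex_on (eff_dom own r i) (\<lambda>xi. f i xi (h i xi + others_aggregate own h i y))"
      if "\<And>j. j \<noteq> i \<Longrightarrow> block own j y \<in> eff_dom own r j" for y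
      using cost_convex[of i y] that unfolding X_eq .
  qed (use h_C1 r_proper r_convex r_lsc nonempty phi_lipschitz phi_monotone in auto)
  have vh_sum: "vh k i \<omega> = (\<Sum>j\<in>UNIV. (W k $ i $ j) *\<^sub>R v k j \<omega>)" if "\<omega> \<in> space M" for k i \<omega>
    unfolding vh_step[OF that] by (rule sum.mono_neutral_left) (auto simp: W_no_edge)
  \<comment> \<open>By the definition of \<open>\<zeta>\<close> the sampled gradient is
    \<open>F\<close> plus \<open>\<zeta>\<close>; from here on the samples occur only through the
    noise.\<close>
  have x_step': "block own i (x (Suc k) \<omega>) = prox (block_space own i) (\<alpha> k i) (r i)
      (block own i (x k \<omega>) - \<alpha> k i *\<^sub>R
        (marginal_grad own h i (f i) (block own i (x k \<omega>)) (real CARD('p) *\<^sub>R vh k i \<omega>)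
          + \<zeta> k i \<omega> + \<eta> k i *\<^sub>R block own i (x k \<omega>)))" if "\<omega> \<in> space M" for k i \<omega>
    using x_step[OF that, of i k] zeta_def[of k i \<omega>] by (simp add: F_eq)
  let ?G = "noise_history M (x 0) \<zeta>"
  note run = game.run_measurable[where x = x and v = v and vh = vh and \<zeta> = \<zeta> and M = M and W = W and \<alpha> = \<alpha> and \<eta> = \<eta>,
      OF x0 alpha_pos v_init vh_sum x_step' v_step]
  have x_in: "x k \<omega> \<in> joint_dom own r" if "\<omega> \<in> space M" for k \<omega>
    by (rule run(1)) (assumption | rule that)+
  have x_meas: "x k \<in> borel_measurable (?G k)" for k
    by (rule run(2))
  have zeta_meas: "\<zeta> k i \<in> borel_measurable M" for k i
    by (rule borel_measurable_integrable[OF zeta_integrable])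
  have subalg: "subalgebra M (?G k)" for k
    by (rule subalgebra_noise_history[OF x_init_rv zeta_meas])
  define y where "y k = game.regularized (\<eta> k)" for k
  obtain b where b: "\<And>z. z \<in> joint_dom own r \<Longrightarrow> norm z \<le> b"
    using compact_imp_bounded[OF game.XX_compact] unfolding bounded_iff by blast
  have "AE \<omega> in M. \<forall>i. summable (\<lambda>k. (\<alpha> k i)\<^sup>2 * (norm (\<zeta> k i \<omega>))\<^sup>2)"
  proof -
    have "AE \<omega> in M. summable (\<lambda>k. (\<alpha> k i)\<^sup>2 * (norm (\<zeta> k i \<omega>))\<^sup>2)" for i
      by (rule AE_weighted_noise_square_summable[where Z = "\<lambda>k. \<zeta> k i",
            OF prob subalg zeta_meas zeta_variance rate4])
    then show ?thesis by (rule AE_all_finite)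
  qed
  moreover have "AE \<omega> in M. \<forall>i. summable (\<lambda>k. \<alpha> k i * ((block own i (x k \<omega>) - block own i (y k)) \<bullet> \<zeta> k i \<omega>))"
  proof -
    have "AE \<omega> in M. summable (\<lambda>k. \<alpha> k i * ((block own i (x k \<omega>) - block own i (y k)) \<bullet> \<zeta> k i \<omega>))" for i
    proof (rule AE_weighted_noise_inner_summable[where Z = "\<lambda>k. \<zeta> k i", OF prob subalg zeta_meas zeta_variance rate4])
      show "sets (?G k) \<subseteq> sets (?G (Suc k))" for k by (rule noise_history_mono) simp
      show "\<zeta> k i \<in> borel_measurable (?G (Suc k))" for k by (rule noise_measurable_noise_history) simp
      show "(\<lambda>\<omega>. block own i (x k \<omega>) - block own i (y k)) \<in> borel_measurable (?G k)" for k
        by (intro borel_measurable_diff game.block_measurable x_meas borel_measurable_const)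
      \<comment> \<open>Both points lie in the bounded joint domain, so the bound holds at every
        sample point, as the martingale lemma requires.\<close>
      show "norm (block own i (x k \<omega>) - block own i (y k)) \<le> 2 * b" if "\<omega> \<in> space M" for k \<omega>
      proof -
        have "norm (block own i (x k \<omega>) - block own i (y k)) \<le> norm (x k \<omega> - y k)"
          unfolding block_diff[symmetric] by (rule norm_block_le)
        also have "\<dots> \<le> norm (x k \<omega>) + norm (y k)" by (rule norm_triangle_ineq4)
        finally show ?thesis
          using b[OF x_in[OF that], of k] b[OF game.regularized_in_XX[of "\<eta> k", OF eta_pos]]
          unfolding y_def by linarith
      qed
    qed (use zeta_integrable zeta_mean in auto)
    then show ?thesis by (rule AE_all_finite)
  qed
  ultimately have "AE \<omega> in M. (\<lambda>k. x k \<omega> - y k) \<longlonglongrightarrow> 0"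
    using AE_space
  proof eventually_elim
    case (elim \<omega>)
    have "algorithm_run own h f r L Lh E W \<alpha> \<eta> (\<lambda>k. x k \<omega>) (\<lambda>k i. v k i \<omega>) (\<lambda>k i. vh k i \<omega>) (\<lambda>k i. \<zeta> k i \<omega>)"
    proof unfold_locales
      show "(Lh i)-lipschitz_on (eff_dom own r i) (h i)" for i
        using h_lipschitz[of i] unfolding X_eq .
      show "\<exists>Lf. \<forall>y\<in>eff_dom own r i. \<forall>z1 z2. norm z1 \<le> cz \<longrightarrow> norm z2 \<le> cz \<longrightarrow>
          norm (marginal_grad own h i (f i) y z1 - marginal_grad own h i (f i) y z2) \<le> Lf * norm (z1 - z2)"
        if "cz > 0" for i cz
        using F_lipschitz[OF that, of i] unfolding X_eq F_eq .
      show "summable (\<lambda>k. (\<alpha> k i)\<^sup>2 * (norm (\<zeta> k i \<omega>))\<^sup>2)" for i using elim(1) by blast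
      show "summable (\<lambda>k. \<alpha> k i * ((block own i (x k \<omega>) - block own i (game.regularized (\<eta> k))) \<bullet> \<zeta> k i \<omega>))" for i
        using elim(2) unfolding y_def by blast
    qed (fact self_loop W_stochastic W_lower_bound E_connected alpha_pos eta_pos alpha_decreasing eta_decreasing
        alpha_tendsto eta_tendsto rate2 rate3 rate4 rate5 x0[OF elim(3)] v_init[OF elim(3)] vh_sum[OF elim(3)]
        x_step'[OF elim(3)] v_step[OF elim(3)])+
    from algorithm_run.tracks_regularized[OF this] show ?case unfolding y_def .
  qed
  then show ?thesis
  proof eventually_elim
    case (elim \<omega>)
    show ?case
    proof (intro conjI impI allI)
      fix xl and s :: "nat \<Rightarrow> nat"
      assume s: "strict_mono s" and lim: "(\<lambda>n. x (s n) \<omega>) \<longlonglongrightarrow> xl"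
      have "(\<lambda>n. x (s n) \<omega> - (x (s n) \<omega> - y (s n))) \<longlonglongrightarrow> xl - 0"
        using LIMSEQ_subseq_LIMSEQ[OF elim s] by (intro tendsto_diff lim) (simp add: o_def)
      then have "(\<lambda>n. game.regularized (\<eta> (s n))) \<longlonglongrightarrow> xl" by (simp add: y_def)
      moreover have "(\<lambda>n. \<eta> (s n) i) \<longlonglongrightarrow> 0" for i
        using LIMSEQ_subseq_LIMSEQ[OF eta_tendsto s] by (simp add: o_def)
      ultimately show "xl \<in> nash_equilibria own h f r"
        unfolding game.nash_iff_vi
        by (intro game.regularized_limit_is_vi_solution[of "\<lambda>n. \<eta> (s n)"] eta_pos)
    next
      assume limsup: "limsup (\<lambda>k. ereal (pmax \<eta> k / pmin \<eta> k)) = 1"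
      have "1 \<le> pmax \<eta> k / pmin \<eta> k" for k
        \<comment> \<open>Any player's parameter, here that of \<open>undefined\<close>, lies
          between the minimum and the maximum.\<close>
        using order_trans[OF pmin_le[of \<eta> k undefined] le_pmax[of \<eta> k undefined]] pmin_pos[of \<eta> k] eta_pos by simp
      then have "(\<lambda>k. pmax \<eta> k / pmin \<eta> k) \<longlonglongrightarrow> 1" by (rule tendsto_1_if_limsup_1[OF limsup])
      from game.regularized_converges_to_least_norm[OF eta_pos eta_tendsto this]
      obtain xs where xs: "{z. is_arg_min norm (\<lambda>z. z \<in> nash_equilibria own h f r) z} = {xs}"
        "y \<longlonglongrightarrow> xs" unfolding y_def by blast
      have "(\<lambda>k. (x k \<omega> - y k) + y k) \<longlonglongrightarrow> 0 + xs" by (rule tendsto_add[OF elim xs(2)])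
      then show "\<exists>xs. {y. is_arg_min norm (\<lambda>y. y \<in> nash_equilibria own h f r) y} = {xs} \<and>
          (\<lambda>k. x k \<omega>) \<longlonglongrightarrow> xs"
        using xs(1) by (intro exI[of _ xs]) simp
    qed
  qed
qed

end
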